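(* Let $k,N\in\mathbb N$, $\Omega\subset\mathbb R^k$ open, $\mathbb K\in\{\mathbb R,\mathbb C\}$, $V$ a separable Banach space over $\mathbb K$, and let $f_1,\dots,f_N\colon\Omega\to\Omega$, $g_1,\dots,g_N\colon\Omega\to\mathbb K$, $h_0\colon\Omega\to V$ satisfy hypothesis (H) (with constants $K,L$ as in (H)). Let $\psi$ be as in the context and assume $h_0\in L^{\psi,1}(\Omega,V)$. If there is $\alpha\in[0,\tfrac12)$ with $$|g_n(x)|\le \alpha\min\Big\{\frac{|J_{f_n}(x)|}{KL},\frac1N\Big\}\quad\text{for all } n\in\{1,\dots,N\}\text{ and almost all }x\in\Omega,$$ then the elementary solution of $\varphi(x)=\sum_{n=1}^N g_n(x)\varphi(f_n(x))+h_0(x)$ in $L^{\psi,1}(\Omega,V)$ exists, it is the unique solution of this equation in $L^{\psi,1}(\Omega,V)$, and for every $j\in\mathbb N\cup\{0\}$ $$\Big\|\sum_{i=j}^\infty P^i h_0\Big\|_{L^{\psi,1}(\Omega,V)}\le \frac{(2\alpha)^j}{1-2\alpha}\|h_0\|_{L^{\psi,1}(\Omega,V)}.$$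
   Context: $\mu$ denotes $k$-dimensional Lebesgue measure. A Young function is a non-decreasing, left-continuous, convex $\Psi\colon[0,\infty)\to[0,\infty]$ with $\lim_{t\to0+}\Psi(t)=\Psi(0)=0$, $\lim_{t\to\infty}\Psi(t)=\infty$. $\psi\colon[0,\infty)\to[0,\infty)$ is a strictly increasing Young function satisfying $\Delta_2$ globally (there is $d>1$ with $\psi(2t)\le d\psi(t)$ for all $t>0$) and $\lim_{t\to0+}\psi(t)/t=\lim_{t\to\infty}t/\psi(t)=0$. $\tau(0)=0$, $\tau(t)=1/\psi(1/t)$ for $t>0$, $\tau^{-1}$ its inverse, $\tau^{-1}(\infty)=\infty$. For measurable $f\colon\Omega\to\mathbb K$, $\mu_f(s)=\mu(\{x\in\Omega:|f(x)|>s\})$. $L^{\psi,1}(\Omega,\mathbb K)$ is the set of $f\in L^1_{\mathrm{loc}}(\Omega,\mathbb K)$ with $\|f\|_{L^{\psi,1}(\Omega,\mathbb K)}:=\int_0^\infty\tau^{-1}(\mu_f(s))\,ds<\infty$. $L^{\psi,1}(\Omega,V)$ is the set of Lebesgue measurable $f\colon\Omega\to V$ with $\|f(\cdot)\|_V\in L^{\psi,1}(\Omega,\mathbb K)$, normed by $\|f\|_{L^{\psi,1}(\Omega,V)}=\|\,\|f(\cdot)\|_V\|_{L^{\psi,1}(\Omega,\mathbb K)}$ (functions equal a.e. identified). Approximate differential: a linear map $A$ is an approximate differential of measurable $F\colon\Omega\to\mathbb R^k$ at $x_0$ if for every $\varepsilon>0$, $x_0$ is a density point of $\{x\in\Omega\setminus\{x_0\}:\|F(x)-F(x_0)-A(x-x_0)\|/\|x-x_0\|<\varepsilon\}$.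 $J_F(x)$ is the determinant of the approximate differential at $x$, set to $0$ where it does not exist. Luzin's condition N: null sets are mapped to null sets. Hypothesis (H): $f_1,\dots,f_N$ are measurable, a.e. approximately differentiable and satisfy Luzin's condition N; for every $n$ and null $M\subset\mathbb R^k$, $f_n^{-1}(M)$ is null; there is $K\in\mathbb N$ such that for each $n$, $\{x\in\Omega:\operatorname{card} f_n^{-1}(x)>K\}$ is null; $g_1,\dots,g_N,h_0$ are measurable; $L=\max\{l\in\{1,\dots,N\}: \mu(\bigcap_{i=1}^l f_{n_i}(\Omega))>0\text{ for some } n_1<\dots<n_l\}$. $P\psi=\sum_{n=1}^N g_n\cdot(\psi\circ f_n)$. The elementary solution in a normed function space $\mathcal F_0$ is $\sum_{i=0}^\infty P^i h_0$, when this series converges in the norm of $\mathcal F_0$ to a function in $\mathcal F_0$ solving the equation. *)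

theory Defs
  imports "HOL-Analysis.Analysis"
begin

text \<open>The scalar field K in {R, C} is rendered as a type 'k of class
  real_normed_field and banach (complete real normed fields are exactly R and C
  up to isometric isomorphism).  A Banach space V over K is a real Banach space
  'v together with a scalar multiplication by 'k extending the real one.\<close>

definition K_banach_space :: "('k::{real_normed_field,banach} \<Rightarrow> 'v::banach \<Rightarrow> 'v) \<Rightarrow> bool" where
  "K_banach_space smul \<longleftrightarrow>
     (\<forall>c d v. smul (c * d) v = smul c (smul d v)) \<and>
     (\<forall>v. smul 1 v = v) \<and>
     (\<forall>c v w. smul c (v + w) = smul c v + smul c w) \<and>
     (\<forall>c d v. smul (c + d) v = smul c v + smul d v) \<and>
     (\<forall>r v. smul (of_real r) v = scaleR r v) \<and>
     (\<forall>c v. norm (smul c v) = norm c * norm v)"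

definition separable_space :: "'v::metric_space itself \<Rightarrow> bool" where
  "separable_space _ \<longleftrightarrow> (\<exists>D::'v set. countable D \<and> closure D = UNIV)"

definition density_point :: "(real^'n) set \<Rightarrow> real^'n \<Rightarrow> bool" where
  "density_point E x \<longleftrightarrow>
     ((\<lambda>r. measure lebesgue (E \<inter> ball x r) / measure lebesgue (ball x r)) \<longlongrightarrow> 1) (at_right 0)"

definition approx_differential ::
  "(real^'n \<Rightarrow> real^'n) \<Rightarrow> (real^'n) set \<Rightarrow> (real^'n \<Rightarrow> real^'n) \<Rightarrow> real^'n \<Rightarrow> bool" where
  "approx_differential F \<Omega> A x0 \<longleftrightarrow> linear A \<and>
     (\<forall>\<epsilon>>0. density_point
        {x \<in> \<Omega> - {x0}. norm (F x - F x0 - A (x - x0)) / norm (x - x0) < \<epsilon>} x0)"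

definition approx_jacobian :: "(real^'n \<Rightarrow> real^'n) \<Rightarrow> (real^'n) set \<Rightarrow> real^'n \<Rightarrow> real" where
  "approx_jacobian F \<Omega> x =
     (if \<exists>A. approx_differential F \<Omega> A x
      then det (matrix (SOME A. approx_differential F \<Omega> A x)) else 0)"

definition luzin_N :: "(real^'n \<Rightarrow> real^'n) \<Rightarrow> (real^'n) set \<Rightarrow> bool" where
  "luzin_N F \<Omega> \<longleftrightarrow> (\<forall>M. M \<subseteq> \<Omega> \<longrightarrow> M \<in> null_sets lebesgue \<longrightarrow> F ` M \<in> null_sets lebesgue)"

definition hypH ::
  "nat \<Rightarrow> (real^'n) set \<Rightarrow> (nat \<Rightarrow> real^'n \<Rightarrow> real^'n) \<Rightarrow> (nat \<Rightarrow> real^'n \<Rightarrow> 'k::real_normed_field)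
     \<Rightarrow> (real^'n \<Rightarrow> 'v::real_normed_vector) \<Rightarrow> nat \<Rightarrow> bool" where
  "hypH N \<Omega> f g h0 K \<longleftrightarrow>
     (\<forall>n\<in>{1..N}.
        f n \<in> borel_measurable (lebesgue_on \<Omega>) \<and>
        (AE x in lebesgue_on \<Omega>. \<exists>A. approx_differential (f n) \<Omega> A x) \<and>
        luzin_N (f n) \<Omega> \<and>
        (\<forall>M. M \<in> null_sets lebesgue \<longrightarrow> f n -` M \<inter> \<Omega> \<in> null_sets lebesgue) \<and>
        {x \<in> \<Omega>. infinite (f n -` {x} \<inter> \<Omega>) \<or> card (f n -` {x} \<inter> \<Omega>) > K}
           \<in> null_sets lebesgue \<and>
        g n \<in> borel_measurable (lebesgue_on \<Omega>)) \<and>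
     h0 \<in> borel_measurable (lebesgue_on \<Omega>)"

definition constL :: "nat \<Rightarrow> (real^'n) set \<Rightarrow> (nat \<Rightarrow> real^'n \<Rightarrow> real^'n) \<Rightarrow> nat" where
  "constL N \<Omega> f = Max {l. 1 \<le> l \<and> l \<le> N \<and>
      (\<exists>S. S \<subseteq> {1..N} \<and> card S = l \<and> (\<Inter>n\<in>S. f n ` \<Omega>) \<notin> null_sets lebesgue)}"

definition young_function_real :: "(real \<Rightarrow> real) \<Rightarrow> bool" where
  "young_function_real \<psi> \<longleftrightarrow>
     (\<forall>t\<ge>0. \<psi> t \<ge> 0) \<and> mono_on {0..} \<psi> \<and>
     (\<forall>t>0. continuous (at_left t) \<psi>) \<and> convex_on {0..} \<psi> \<and>
     \<psi> 0 = 0 \<and> (\<psi> \<longlongrightarrow> 0) (at_right 0) \<and> filterlim \<psi> at_top at_top"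

definition admissible_psi :: "(real \<Rightarrow> real) \<Rightarrow> bool" where
  "admissible_psi \<psi> \<longleftrightarrow>
     young_function_real \<psi> \<and> strict_mono_on {0..} \<psi> \<and>
     (\<exists>d>1. \<forall>t>0. \<psi> (2 * t) \<le> d * \<psi> t) \<and>
     ((\<lambda>t. \<psi> t / t) \<longlongrightarrow> 0) (at_right 0) \<and>
     ((\<lambda>t. t / \<psi> t) \<longlongrightarrow> 0) at_top"

definition tau :: "(real \<Rightarrow> real) \<Rightarrow> real \<Rightarrow> real" where
  "tau \<psi> t = (if t = 0 then 0 else 1 / \<psi> (1 / t))"

definition tau_inv :: "(real \<Rightarrow> real) \<Rightarrow> ennreal \<Rightarrow> ennreal" where
  "tau_inv \<psi> y = (if y = \<infinity> then \<infinity>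
      else ennreal (THE t. t \<ge> 0 \<and> tau \<psi> t = enn2real y))"

definition distrib_fun :: "(real^'n) set \<Rightarrow> (real^'n \<Rightarrow> real) \<Rightarrow> real \<Rightarrow> ennreal" where
  "distrib_fun \<Omega> u s = emeasure lebesgue {x \<in> \<Omega>. \<bar>u x\<bar> > s}"

definition Lpsi1_enorm :: "(real \<Rightarrow> real) \<Rightarrow> (real^'n) set \<Rightarrow> (real^'n \<Rightarrow> real) \<Rightarrow> ennreal" where
  "Lpsi1_enorm \<psi> \<Omega> u = (\<integral>\<^sup>+ s\<in>{0..}. tau_inv \<psi> (distrib_fun \<Omega> u s) \<partial>lborel)"

definition Lpsi1 :: "(real \<Rightarrow> real) \<Rightarrow> (real^'n) set \<Rightarrow> (real^'n \<Rightarrow> 'v::real_normed_vector) set" where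
  "Lpsi1 \<psi> \<Omega> = {h. h \<in> borel_measurable (lebesgue_on \<Omega>) \<and>
      (\<forall>C. compact C \<and> C \<subseteq> \<Omega> \<longrightarrow> set_integrable lebesgue C (\<lambda>x. norm (h x))) \<and>
      Lpsi1_enorm \<psi> \<Omega> (\<lambda>x. norm (h x)) < \<infinity>}"

definition Lpsi1_norm :: "(real \<Rightarrow> real) \<Rightarrow> (real^'n) set \<Rightarrow> (real^'n \<Rightarrow> 'v::real_normed_vector) \<Rightarrow> real" where
  "Lpsi1_norm \<psi> \<Omega> h = enn2real (Lpsi1_enorm \<psi> \<Omega> (\<lambda>x. norm (h x)))"

definition opP :: "('k \<Rightarrow> 'v \<Rightarrow> 'v::real_normed_vector) \<Rightarrow> nat \<Rightarrow> (nat \<Rightarrow> 'a \<Rightarrow> 'a)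
     \<Rightarrow> (nat \<Rightarrow> 'a \<Rightarrow> 'k) \<Rightarrow> ('a \<Rightarrow> 'v) \<Rightarrow> 'a \<Rightarrow> 'v" where
  "opP smul N f g \<phi> x = (\<Sum>n\<in>{1..N}. smul (g n x) (\<phi> (f n x)))"

definition solves_eq :: "('k \<Rightarrow> 'v \<Rightarrow> 'v::real_normed_vector) \<Rightarrow> nat \<Rightarrow> (real^'n) set
     \<Rightarrow> (nat \<Rightarrow> real^'n \<Rightarrow> real^'n) \<Rightarrow> (nat \<Rightarrow> real^'n \<Rightarrow> 'k) \<Rightarrow> (real^'n \<Rightarrow> 'v) \<Rightarrow> (real^'n \<Rightarrow> 'v) \<Rightarrow> bool" where
  "solves_eq smul N \<Omega> f g h0 \<phi> \<longleftrightarrow>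
     (AE x in lebesgue_on \<Omega>. \<phi> x = opP smul N f g \<phi> x + h0 x)"

end

theory Submission
  imports Defs
begin

text \<open>The functional \<open>\<integral> \<tau>\<^sup>-\<^sup>1(\<mu>\<^sub>h(s)) ds\<close> is in general only a quasi-norm, because \<open>\<tau>\<^sup>-\<^sup>1\<close> is
  quasiconcave but need not be concave, so the estimate of the tails cannot be obtained by summing norms.
  Instead, let \<open>Q u = \<Sum>\<^sub>n |g\<^sub>n| (u \<circ> f\<^sub>n)\<close>. The bound \<open>|g\<^sub>n| \<le> \<alpha>/N\<close> makes \<open>Q\<close> an \<open>\<alpha>\<close>-contraction for the
  supremum norm, and \<open>|g\<^sub>n| \<le> \<alpha> |J|/(K L)\<close> makes it an \<open>\<alpha>\<close>-contraction for the \<open>L\<^sup>1\<close> norm.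
  Splitting \<open>u = min u r + (u - r)\<^sup>+\<close> shows that \<open>\<Sum>\<^sub>i\<^sub>\<ge>\<^sub>j Q\<^sup>i u\<close> is majorized by \<open>\<alpha>\<^sup>j/(1 - \<alpha>) u\<close> in the sense of
  Hardy, Littlewood and Polya, and majorization costs at most a factor 2 in the quasi-norm.

  The \<open>L\<^sup>1\<close> bound is an area inequality for approximately differentiable maps: up to a set where the Jacobian
  vanishes, the domain is covered by countably many sets on which the map is close to an invertible linear map
  with Lipschitz inverse, and Lipschitz maps distort Lebesgue measure by at most the power of the constant.\<close>

section \<open>Area inequality for approximately differentiable maps\<close>

text \<open>The constants \<open>K\<close> and \<open>L\<close> are multiplicities. Once the nearly
  linear pieces of one map are disjoint, almost every point lies in at most \<open>K\<close> of
  their images, and almost every point lies in the ranges of at most \<open>L\<close> maps; the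
  denominator \<open>K L\<close> absorbs both counts. The Jacobian is defined through a choice, so
  on each piece it is replaced by the determinant of one fixed matrix. The resulting distortion is a
  factor \<eta> > 1 that is sent to 1 at the end.

  Quasiconcavity compares values of the inverse of \<open>tau\<close> only at ordered arguments.
  Majorization is therefore applied to the maximum of \<open>u\<close> and the normalized tail, and
  the second copy of \<open>u\<close> in this maximum is the origin of the factor 2. For j \<ge> 1
  it is absorbed by 2 \<alpha>^j \<le> (2 \<alpha>)^j.

  With no triangle inequality at hand, the solution is built as the pointwise sum of the series
  wherever a scalar majorant is finite, and uniqueness rests on the integrals of the excesses (v -
  r)^+, which are finite for every r > 0 and shrink by the factor \<alpha>.\<close>

text \<open>The library proves the next result only for index types of class wellorder;
  the order is needed there to compute the determinant of a shear.\<close>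

lemma measure_linear_image_finite:
  fixes f :: "real^'n \<Rightarrow> real^'n"
  assumes "linear f" "S \<in> lmeasurable"
  shows "f ` S \<in> lmeasurable \<and> measure lebesgue (f ` S) = \<bar>det (matrix f)\<bar> * measure lebesgue S"
proof -
  let ?P = "\<lambda>f::real^'n \<Rightarrow> real^'n. \<forall>S\<in>lmeasurable.
    f ` S \<in> lmeasurable \<and> measure lebesgue (f ` S) = \<bar>det (matrix f)\<bar> * measure lebesgue S"
  have boxes: "?P h" if "linear h" "\<bar>det (matrix h)\<bar> = 1"
    and "\<And>a b. measure lebesgue (h ` cbox a b) = measure lebesgue (cbox a b)" for h
  proof
    fix S :: "(real^'n) set" assume "S \<in> lmeasurable"
    then show "h ` S \<in> lmeasurable \<and> measure lebesgue (h ` S) = \<bar>det (matrix h)\<bar> * measure lebesgue S"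
      using measure_linear_sufficient[OF that(1), of S 1] that(2,3) by simp
  qed
  have "?P f"
  proof (rule induct_linear_elementary[OF \<open>linear f\<close>])
    fix f g :: "real^'n \<Rightarrow> real^'n"
    assume fg: "linear f" "linear g" "?P f" "?P g"
    show "?P (f \<circ> g)"
      using fg(3,4) matrix_compose[OF fg(2,1)] 
      by (simp only: image_comp[symmetric] det_mul abs_mult) simp
  next
    fix f :: "real^'n \<Rightarrow> real^'n" and i
    assume f: "linear f" "\<And>x. f x $ i = 0"
    then have "\<not> surj f"
      by (metis one_neq_zero surjE vec_component)
    then have "\<not> inj f" 
      using f(1) linear_injective_imp_surjective by blast
    then have "det (matrix f) = 0" "negligible (f ` S)" for S
      using f(1) det_nz_iff_inj negligible_linear_singular_image by blast+
    then show "?P f"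
      by (simp add: negligible_imp_measurable negligible_imp_measure0)
  next
    fix c :: "'n \<Rightarrow> real"
    show "?P (\<lambda>x. \<chi> i. c i * x $ i)"
      by (simp add: measurable_stretch measure_stretch axis_def matrix_def det_diagonal)
  next
    fix m n :: 'n assume "m \<noteq> n"
    let ?h = "\<lambda>x::real^'n. \<chi> i. x $ Transposition.transpose m n i"
    show "?P ?h"
    proof (rule boxes)
      show "linear ?h" by (rule linearI) (simp_all add: vec_eq_iff)
      have "matrix ?h = (\<chi> i. mat 1 $ Transposition.transpose m n i)"
        by (simp add: vec_eq_iff matrix_def mat_def axis_def) 
      then show "\<bar>det (matrix ?h)\<bar> = 1"
        by (simp add: det_permute_rows permutes_swap_id sign_swap_id abs_mult)
      fix a b :: "real^'n"
      have eq: "?h ` cbox a b = cbox (?h a) (?h b)"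
      proof
        show "cbox (?h a) (?h b) \<subseteq> ?h ` cbox a b"
        proof
          fix y assume "y \<in> cbox (?h a) (?h b)"
          then have y: "a $ Transposition.transpose m n i \<le> y $ i \<and> y $ i \<le> b $ Transposition.transpose m n i" for i
            by (simp add: mem_box_cart)
          have "?h y \<in> cbox a b" 
            using y[of "Transposition.transpose m n _"] by (simp add: mem_box_cart)
          moreover have "y = ?h (?h y)" by (simp add: vec_eq_iff)
          ultimately show "y \<in> ?h ` cbox a b" by blast
        qed
      qed (auto simp: mem_box_cart)
      show "measure lebesgue (?h ` cbox a b) = measure lebesgue (cbox a b)"
      proof (cases "cbox a b = {}")
        case False
        then have "cbox (?h a) (?h b) \<noteq> {}" using eq by auto
        then show ?thesis 
          using prod.permute[OF permutes_swap_id[of m UNIV n], where g = "\<lambda>i. b $ i - a $ i"] False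
          by (simp add: eq content_cbox_cart o_def)
      qed simp
    qed
  next
    fix m n :: 'n assume "m \<noteq> n"
    let ?h = "\<lambda>x::real^'n. \<chi> i. if i = m then x $ m + x $ n else x $ i"
    show "?P ?h"
    proof (rule boxes)
      show lin: "linear ?h" by (rule linearI) (auto simp: vec_eq_iff algebra_simps)
      have "matrix ?h = (\<chi> k. if k = m then row m (mat 1) + 1 *s row n (mat 1) else row k (mat 1))"
        by (auto simp: vec_eq_iff matrix_def mat_def axis_def row_def)
      then show "\<bar>det (matrix ?h)\<bar> = 1"
        by (simp only: det_row_operation[OF \<open>m \<noteq> n\<close>] det_I abs_one)
      fix a b :: "real^'n"
      \<comment> \<open>The shift makes the \<open>n\<close>-th coordinate of the box start at 0,
        because the volume of a sheared box is available for boxes with nonnegative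
        \<open>n\<close>-th lower bound.\<close>
      define t :: "real^'n" where "t = (\<chi> i. if i = n then - a $ n else 0)"
      have "?h x = - ?h t + ?h (t + x)" for x
        using linear_add[OF lin, of t x] by (simp add: add.assoc[symmetric])
      then have "?h ` cbox a b = (+) (- ?h t) ` ?h ` (+) t ` cbox a b"
        unfolding image_comp o_def by (rule image_cong[OF refl])
      then have "measure lebesgue (?h ` cbox a b) = measure lebesgue (?h ` (+) t ` cbox a b)"
        by (metis (no_types, lifting) measure_translation)
      also have "\<dots> = measure lebesgue (?h ` cbox (t + a) (t + b))"
        by (simp add: cbox_translation)
      also have "\<dots> = measure lebesgue (cbox (t + a) (t + b))"
      proof (cases "cbox (t + a) (t + b) = {}")
        case False
        then show ?thesis
          using measure_shear_interval[OF \<open>m \<noteq> n\<close> False] by (simp add: t_def)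
      qed simp
      also have "\<dots> = measure lebesgue ((+) t ` cbox a b)"
        by (simp add: cbox_translation)
      also have "\<dots> = measure lebesgue (cbox a b)"
        by (rule measure_translation)
      finally show "measure lebesgue (?h ` cbox a b) = measure lebesgue (cbox a b)" .
    qed
  qed
  then show ?thesis using assms(2) by blast
qed

text \<open>\<open>T\<close> maps the unit ball into the ball of radius \<open>c\<close>; compare
  the volumes.\<close>

lemma abs_det_le_of_norm_le:
  fixes T :: "real^'n \<Rightarrow> real^'n"
  assumes T: "linear T" and c: "c \<ge> 0" and le: "\<And>v. norm (T v) \<le> c * norm v"
  shows "\<bar>det (matrix T)\<bar> \<le> c ^ CARD('n)"
proof -
  have sub: "T ` cball 0 1 \<subseteq> cball 0 c"
  proof clarsimp
    fix v :: "real^'n" assume "norm v \<le> 1"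
    then show "norm (T v) \<le> c" using le[of v] c by (meson mult_left_le order_trans)
  qed
  note lin = measure_linear_image_finite[OF T lmeasurable_cball[of 0 1]]
  then have "\<bar>det (matrix T)\<bar> * measure lebesgue (cball 0 1 :: (real^'n) set) = measure lebesgue (T ` cball 0 1)"
    by simp
  also have "\<dots> \<le> measure lebesgue (cball 0 c :: (real^'n) set)"
    using sub lin by (intro measure_mono_fmeasurable) (auto intro: fmeasurableD)
  also have "\<dots> = c ^ CARD('n) * measure lebesgue (cball 0 1 :: (real^'n) set)"
    using c by (simp add: content_cball)
  finally have "\<bar>det (matrix T)\<bar> * measure lebesgue (cball 0 1 :: (real^'n) set)
     \<le> c ^ CARD('n) * measure lebesgue (cball 0 1 :: (real^'n) set)" .
  moreover have "measure lebesgue (cball 0 1 :: (real^'n) set) > 0"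
    by (simp add: content_cball)
  ultimately show ?thesis by (meson mult_le_cancel_right_pos)
qed

section \<open>Lebesgue measure of Lipschitz images\<close>

text \<open>A continuous map that preserves null sets preserves Lebesgue measurability, and a
  Lipschitz map has both properties.\<close>

lemma lipschitz_image_sets_lebesgue:
  fixes k :: "'a::euclidean_space \<Rightarrow> 'a"
  assumes "T \<in> sets lebesgue"
    and lip: "\<And>x y. x \<in> T \<Longrightarrow> y \<in> T \<Longrightarrow> norm (k x - k y) \<le> c * norm (x - y)"
  shows "k ` T \<in> sets lebesgue"
proof (rule sets_lebesgue_continuous_image [OF assms(1)])
  have "norm (k x - k y) \<le> (\<bar>c\<bar> + 1) * norm (x - y)" if "x \<in> T" "y \<in> T" for x y
    using lip[OF that] by (rule order_trans) (auto intro!: mult_right_mono)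
  then have "(\<bar>c\<bar> + 1)-lipschitz_on T k"
    by (auto simp: lipschitz_on_def dist_norm)
  then show "continuous_on T k"
    by (rule lipschitz_on_continuous_on)
  show "negligible (k ` S)" if "negligible S" "S \<subseteq> T" for S
  proof (rule negligible_locally_Lipschitz_image [OF _ that(1)])
    show "\<exists>U B. open U \<and> x \<in> U \<and> (\<forall>y\<in>S \<inter> U. norm (k y - k x) \<le> B * norm (y - x))"
      if "x \<in> S" for x
      using that \<open>S \<subseteq> T\<close> lip by (intro exI[of _ UNIV] exI[of _ c]) auto
  qed simp
qed auto

text \<open>The sharp constant comes from a Vitali cover by balls centred in \<open>T\<close>: the
  part of \<open>T\<close> in a ball of radius r is sent into the ball of radius c r around the
  image of the centre. Balls go to balls, so only the ratio of their volumes enters.\<close>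

lemma emeasure_lipschitz_image:
  fixes k :: "'a::euclidean_space \<Rightarrow> 'a"
  assumes T: "T \<in> sets lebesgue" and c: "c > 0"
    and lip: "\<And>x y. x \<in> T \<Longrightarrow> y \<in> T \<Longrightarrow> norm (k x - k y) \<le> c * norm (x - y)"
  shows "emeasure lebesgue (k ` T) \<le> ennreal (c ^ DIM('a)) * emeasure lebesgue T"
proof -
  have main: "emeasure lebesgue (k ` T) \<le> ennreal (c ^ DIM('a)) * (emeasure lebesgue T + ennreal e)"
    if "e > 0" for e
  proof -
    obtain U where U: "open U" "T \<subseteq> U" "U - T \<in> lmeasurable" "emeasure lebesgue (U - T) < ennreal e"
      using sets_lebesgue_outer_open[OF T \<open>e > 0\<close>] by metis
    \<comment> \<open>All balls stay inside an open \<open>U\<close> that exceeds \<open>T\<close>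
      by less than \<open>e\<close>, so a disjoint subfamily has total measure at most that of
      \<open>T\<close> plus \<open>e\<close>.\<close>
    define I where "I = {(x, r). x \<in> T \<and> 0 < r \<and> ball x r \<subseteq> U}"
    have cov: "\<exists>i. i \<in> I \<and> x \<in> ball (fst i) (snd i) \<and> snd i < d" if "x \<in> T" "d > 0" for x d
    proof -
      obtain s where s: "s > 0" "ball x s \<subseteq> U"
        using U(1,2) \<open>x \<in> T\<close> openE[of U x] by blast
      have "ball x (min s (d/2)) \<subseteq> U" using s by auto
      then show ?thesis
        using that s by (intro exI[of _ "(x, min s (d/2))"]) (auto simp: I_def)
    qed
    obtain C where C: "countable C" "C \<subseteq> I"
      "pairwise (\<lambda>i j. disjnt (ball (fst i) (snd i)) (ball (fst j) (snd j))) C"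
      "negligible (T - (\<Union>i\<in>C. ball (fst i) (snd i)))"
      by (rule Vitali_covering_theorem_balls[of T I fst snd]) (use cov in blast)+
    define idx where "idx = to_nat_on C"
    have inj: "inj_on idx C" unfolding idx_def by (rule inj_on_to_nat_on[OF C(1)])
    \<comment> \<open>By injectivity of \<open>idx\<close> each union contains at most one ball;
      numbers that index no ball give the empty set.\<close>
    define A where "A n = (\<Union>i\<in>{i\<in>C. idx i = n}. ball (fst i) (snd i))" for n
    define B where "B n = (\<Union>i\<in>{i\<in>C. idx i = n}. ball (k (fst i)) (c * snd i))" for n
    have AB: "emeasure lebesgue (B n) \<le> ennreal (c ^ DIM('a)) * emeasure lebesgue (A n)" for n
    proof (cases "\<exists>i\<in>C. idx i = n")
      case True
      then obtain i where i: "i \<in> C" "idx i = n" by auto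
      then have "{i\<in>C. idx i = n} = {i}" using inj by (auto dest: inj_onD)
      moreover have "snd i > 0" using i C(2) by (auto simp: I_def)
      ultimately show ?thesis using c
        by (simp add: A_def B_def emeasure_ball ennreal_mult[symmetric] power_mult_distrib mult_ac)
    next
      case False
      then have "B n = {}" by (auto simp: B_def)
      then show ?thesis by simp
    qed
    have disj: "disjoint_family A"
      using C(3) unfolding disjoint_family_on_def A_def pairwise_def disjnt_def by fastforce
    have "ball (fst i) (snd i) \<subseteq> U" if "i \<in> C" for i
      using subsetD[OF C(2) that] by (cases i) (simp add: I_def)
    then have AU: "(\<Union>n. A n) \<subseteq> U" unfolding A_def by blast
    have AM: "range A \<subseteq> sets lebesgue" "range B \<subseteq> sets lebesgue" 
      by (auto simp: A_def B_def intro!: sets.countable_UN' countable_subset[OF _ C(1)])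
    let ?Z = "T - (\<Union>i\<in>C. ball (fst i) (snd i))"
    have negZ: "negligible (k ` ?Z)"
    proof (rule negligible_locally_Lipschitz_image [OF _ C(4)])
      show "\<exists>U B. open U \<and> x \<in> U \<and> (\<forall>y\<in>?Z \<inter> U. norm (k y - k x) \<le> B * norm (y - x))"
        if "x \<in> ?Z" for x
        using that lip by (intro exI[of _ UNIV] exI[of _ c]) auto
    qed simp
    have "k ` T \<subseteq> k ` ?Z \<union> (\<Union>n. B n)"
    proof
      fix y assume "y \<in> k ` T"
      then obtain x where x: "x \<in> T" "y = k x" by auto
      show "y \<in> k ` ?Z \<union> (\<Union>n. B n)"
      proof (cases "x \<in> ?Z")
        case False
        then obtain i where i: "i \<in> C" "x \<in> ball (fst i) (snd i)" using x by auto
        then have "fst i \<in> T" using C(2) by (auto simp: I_def)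
        then have "norm (k (fst i) - k x) \<le> c * norm (fst i - x)" using x lip by auto
        also have "\<dots> < c * snd i" using i c by (auto simp: dist_norm)
        finally show ?thesis using i x by (auto simp: B_def dist_norm)
      qed (use x in auto)
    qed
    then have "emeasure lebesgue (k ` T) \<le> emeasure lebesgue (k ` ?Z \<union> (\<Union>n. B n))"
      using AM negZ by (intro emeasure_mono) (auto simp: negligible_imp_sets)
    also have "\<dots> \<le> emeasure lebesgue (k ` ?Z) + emeasure lebesgue (\<Union>n. B n)"
      using AM negZ by (intro emeasure_subadditive) (auto simp: negligible_imp_sets)
    also have "emeasure lebesgue (k ` ?Z) = 0"
      using negZ by (simp add: negligible_iff_null_sets null_setsD1)
    also have "emeasure lebesgue (\<Union>n. B n) \<le> (\<Sum>n. emeasure lebesgue (B n))"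
      using AM by (intro emeasure_subadditive_countably)
    also have "\<dots> \<le> (\<Sum>n. ennreal (c ^ DIM('a)) * emeasure lebesgue (A n))"
      by (intro suminf_le AB) auto
    also have "\<dots> = ennreal (c ^ DIM('a)) * emeasure lebesgue (\<Union>n. A n)"
      using suminf_emeasure[OF AM(1) disj] by simp
    also have "\<dots> \<le> ennreal (c ^ DIM('a)) * emeasure lebesgue (T \<union> (U - T))"
      using AU U T by (intro mult_left_mono emeasure_mono) (auto intro: fmeasurableD)
    also have "\<dots> \<le> ennreal (c ^ DIM('a)) * (emeasure lebesgue T + emeasure lebesgue (U - T))"
      using U T by (intro mult_left_mono emeasure_subadditive) (auto intro: fmeasurableD)
    also have "\<dots> \<le> ennreal (c ^ DIM('a)) * (emeasure lebesgue T + ennreal e)"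
      using U by (intro mult_left_mono add_left_mono) auto
    finally show ?thesis by simp
  qed
  show ?thesis
  proof (rule ennreal_le_epsilon)
    fix e :: real assume "e > 0"
    define e' where "e' = e / c ^ DIM('a)"
    have "e' > 0" using \<open>e > 0\<close> c by (simp add: e'_def)
    have "ennreal (c ^ DIM('a)) * ennreal e' = ennreal e"
      using c \<open>e > 0\<close> by (simp add: e'_def ennreal_mult[symmetric])
    then show "emeasure lebesgue (k ` T) \<le> ennreal (c ^ DIM('a)) * emeasure lebesgue T + ennreal e"
      using main[OF \<open>e' > 0\<close>] by (simp add: distrib_left)
  qed
qed

section \<open>Decomposition into nearly linear pieces\<close>

text \<open>The ball of radius r/2 around the midpoint lies in both balls and has 2^-n of their
  volume, n being the dimension. Each of \<open>G\<close> and \<open>H\<close> misses less than half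
  of that amount, so together they cannot miss the whole small ball.\<close>

lemma common_point_of_dense_sets:
  fixes x y :: "real^'n"
  assumes "x \<noteq> y" and r: "r = norm (x - y)"
    and G: "G \<in> sets lebesgue" "H \<in> sets lebesgue"
    and dG: "measure lebesgue (G \<inter> ball x r) > (1 - (1/2) ^ Suc CARD('n)) * measure lebesgue (ball x r)"
    and dH: "measure lebesgue (H \<inter> ball y r) > (1 - (1/2) ^ Suc CARD('n)) * measure lebesgue (ball y r)"
  obtains z where "z \<in> G" "z \<in> H" "norm (z - x) < r" "norm (z - y) < r"
proof -
  have "r > 0" using assms by simp
  define c where "c = midpoint x y"
  have cx: "ball c (r/2) \<subseteq> ball x r" and cy: "ball c (r/2) \<subseteq> ball y r"
    using dist_midpoint[of x y] by (auto simp: ball_subset_ball_iff c_def r dist_norm)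
  have vol: "measure lebesgue (ball c (r/2)) = (1/2) ^ CARD('n) * measure lebesgue (ball x r)"
    "measure lebesgue (ball y r) = measure lebesgue (ball x r)"
    using \<open>r > 0\<close> by (simp_all add: content_ball power_divide)
  have bad: "measure lebesgue (ball w r - X) < (1/2) ^ Suc CARD('n) * measure lebesgue (ball w r)"
    if "X \<in> sets lebesgue"
      "measure lebesgue (X \<inter> ball w r) > (1 - (1/2) ^ Suc CARD('n)) * measure lebesgue (ball w r)" for w X
  proof -
    have "measure lebesgue (ball w r - X) = measure lebesgue (ball w r - X \<inter> ball w r)"
      by (rule arg_cong[where f = "measure lebesgue"]) auto
    also have "\<dots> = measure lebesgue (ball w r) - measure lebesgue (X \<inter> ball w r)"
      using that(1) by (intro measurable_measure_Diff) (auto intro: sets.Int)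
    finally show ?thesis using that(2) by (simp add: algebra_simps)
  qed
  have "\<exists>z \<in> ball c (r/2). z \<in> G \<and> z \<in> H"
  proof (rule ccontr)
    assume "\<not> ?thesis"
    then have "ball c (r/2) \<subseteq> (ball x r - G) \<union> (ball y r - H)" using cx cy by blast
    then have "measure lebesgue (ball c (r/2)) \<le> measure lebesgue ((ball x r - G) \<union> (ball y r - H))"
      using G by (intro measure_mono_fmeasurable) (auto intro!: fmeasurable.Un fmeasurable_Diff)
    also have "\<dots> \<le> measure lebesgue (ball x r - G) + measure lebesgue (ball y r - H)"
      using G by (intro measure_Un_le) auto
    also have "\<dots> < (1/2) ^ Suc CARD('n) * measure lebesgue (ball x r) + (1/2) ^ Suc CARD('n) * measure lebesgue (ball y r)"
      using bad[OF G(1) dG] bad[OF G(2) dH] by linarith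
    also have "\<dots> = (1/2) ^ CARD('n) * measure lebesgue (ball x r)" by (simp add: vol)
    finally show False using vol by simp
  qed
  then obtain z where "z \<in> ball c (r/2)" "z \<in> G" "z \<in> H" by auto
  moreover from this have "z \<in> ball x r" "z \<in> ball y r" using cx cy by blast+
  ultimately show ?thesis using that[of z] by (simp add: dist_norm norm_minus_commute)
qed

lemma sets_lebesgue_linear_approximation_set:
  fixes F :: "real^'n \<Rightarrow> real^'n"
  assumes "\<Omega> \<in> sets lebesgue" and F: "F \<in> borel_measurable (lebesgue_on \<Omega>)" and A: "linear A"
  shows "{y \<in> \<Omega> - {x}. norm (F y - F x - A (y - x)) / norm (y - x) < e} \<in> sets lebesgue"
proof -
  have [measurable]: "A \<in> borel_measurable borel"
    using A by (intro borel_measurable_continuous_onI linear_continuous_on) (simp add: linear_conv_bounded_linear)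
  have [measurable]: "(\<lambda>y. y) \<in> borel_measurable (lebesgue_on \<Omega>)"
    using id_borel_measurable_lebesgue_on[of \<Omega>] by (simp add: id_def)
  have "{y \<in> space (lebesgue_on \<Omega>). norm (F y - F x - A (y - x)) / norm (y - x) < e} \<in> sets (lebesgue_on \<Omega>)"
    using F by measurable
  then have *: "{y \<in> space (lebesgue_on \<Omega>). norm (F y - F x - A (y - x)) / norm (y - x) < e} \<in> sets lebesgue"
    using assms(1) by (simp add: sets_restrict_space_iff)
  have eq: "{y \<in> \<Omega> - {x}. norm (F y - F x - A (y - x)) / norm (y - x) < e}
    = {y \<in> space (lebesgue_on \<Omega>). norm (F y - F x - A (y - x)) / norm (y - x) < e} - {x}"
    by auto
  show ?thesis unfolding eq using * by (rule sets.Diff) simp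
qed

text \<open>The pieces need not be measurable; measurability of the approximate differential is never needed,
  because \<open>measurable_enlargement_nearly_linear\<close> repairs this afterwards. Two density points \<open>x\<close>, \<open>y\<close>
  at distance \<open>r\<close> share a good point in the ball of radius \<open>r/2\<close> around their midpoint.\<close>

lemma countable_cover_nearly_linear:
  fixes F :: "real^'n \<Rightarrow> real^'n"
  assumes \<Omega>: "\<Omega> \<in> sets lebesgue" and F: "F \<in> borel_measurable (lebesgue_on \<Omega>)"
    and \<epsilon>: "0 < \<epsilon>" "\<epsilon> \<le> 1"
  obtains \<D> where "countable \<D>" "{x \<in> \<Omega>. approx_jacobian F \<Omega> x \<noteq> 0} \<subseteq> \<Union>\<D>"
    "\<And>D. D \<in> \<D> \<Longrightarrow> D \<subseteq> \<Omega> \<and> bounded D \<and> (\<exists>B k. linear B \<and> k > 0 \<and>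
       (\<forall>v. norm v \<le> k * norm (B v)) \<and>
       (\<forall>x\<in>D. \<forall>y\<in>D. norm (F y - F x - B (y - x)) \<le> 4 * \<epsilon> / k * norm (y - x)) \<and>
       (\<forall>x\<in>D. \<bar>approx_jacobian F \<Omega> x\<bar> \<le> (1 + \<epsilon>) ^ CARD('n) * \<bar>det (matrix B)\<bar>))"
proof -
  define A where "A x = (SOME A. approx_differential F \<Omega> A x)" for x
  define G where "G x e = {y \<in> \<Omega> - {x}. norm (F y - F x - A x (y - x)) / norm (y - x) < e}" for x e
  define X where "X = {x \<in> \<Omega>. approx_jacobian F \<Omega> x \<noteq> 0}"
  have AX: "approx_differential F \<Omega> (A x) x" "approx_jacobian F \<Omega> x = det (matrix (A x))"
    "linear (A x)" "inj (A x)" if "x \<in> X" for x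
  proof -
    have ex: "\<exists>A. approx_differential F \<Omega> A x"
      using that by (auto simp: X_def approx_jacobian_def split: if_splits)
    then show ad: "approx_differential F \<Omega> (A x) x" unfolding A_def by (rule someI_ex)
    show jac: "approx_jacobian F \<Omega> x = det (matrix (A x))"
      using ex by (simp add: approx_jacobian_def A_def)
    show "linear (A x)" using ad by (simp add: approx_differential_def)
    then show "inj (A x)" using that jac det_nz_iff_inj by (auto simp: X_def)
  qed
  have Gmeas: "G x e \<in> sets lebesgue" if "x \<in> X" for x e
    unfolding G_def using \<Omega> F AX(3)[OF that] by (rule sets_lebesgue_linear_approximation_set)
  \<comment> \<open>Each parameter makes one quantity uniform on a piece: \<open>M\<close>
    approximates the differential, \<open>Suc k\<close> bounds the inverse of \<open>M\<close>,
    \<open>1 / Suc m\<close> is the scale below which good points are dense, and \<open>c\<close>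
    confines the piece so that any two of its points are closer than this scale.\<close>
  define D where "D M k m c = {x \<in> X. x \<in> ball c (1 / (2 * real (Suc m))) \<and>
      (\<forall>v. norm v \<le> real (Suc k) * norm (M *v v)) \<and>
      (\<forall>v. norm (A x v - M *v v) \<le> \<epsilon> / real (Suc k) * norm v) \<and>
      (\<forall>r. 0 < r \<longrightarrow> r < 1 / real (Suc m) \<longrightarrow> measure lebesgue (G x (\<epsilon> / real (Suc k)) \<inter> ball x r) >
         (1 - (1/2) ^ Suc CARD('n)) * measure lebesgue (ball x r))}" for M :: "real^'n^'n" and k m :: nat and c
  obtain Q :: "(real^'n) set" where Q: "countable Q" "\<And>X. open X \<Longrightarrow> X \<noteq> {} \<Longrightarrow> \<exists>d\<in>Q. d \<in> X"
    using countable_dense_exists by metis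
  define R where "R = {M :: real^'n^'n. \<forall>i j. M $ i $ j \<in> \<rat>}"
  have R: "countable R"
    using countable_vector [OF countable_vector, of "\<lambda>i j. \<rat>"] by (simp add: countable_rat R_def)
  define \<D> where "\<D> = (\<lambda>(M, k, m, c). D M k m c) ` (R \<times> UNIV \<times> UNIV \<times> Q)"
  show thesis
  proof (rule that[of \<D>])
    show "countable \<D>" using Q(1) R by (auto simp: \<D>_def)
    have "x \<in> \<Union>\<D>" if x: "x \<in> X" for x
    proof -
      obtain \<beta> where \<beta>: "\<beta> > 0" "\<And>v. norm (A x v) \<ge> \<beta> * norm v"
        using linear_inj_bounded_below_pos[OF AX(3)[OF x] AX(4)[OF x]] by (metis mult.commute)
      \<comment> \<open>The factor 2 leaves room for exchanging \<open>A x\<close> for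
        \<open>M\<close>: an error of \<epsilon> / k with \<epsilon> \<le> 1 is at most half of the
        lower bound \<beta>.\<close>
      obtain k :: nat where k: "2 / \<beta> < real (Suc k)" 
      proof -
        obtain k :: nat where "2 / \<beta> < real k" using reals_Archimedean2 by blast
        then show ?thesis using that[of k] by simp
      qed
      have k0: "\<epsilon> / real (Suc k) > 0" using \<epsilon> by simp
      obtain M where M: "M \<in> R" "onorm (\<lambda>v. (matrix (A x) - M) *v v) < \<epsilon> / real (Suc k)"
        by (rule matrix_rational_approximation[OF k0, of "matrix (A x)"]) (auto simp: R_def)
      have AM: "norm (A x v - M *v v) \<le> \<epsilon> / real (Suc k) * norm v" for v
      proof -
        have "norm ((matrix (A x) - M) *v v) \<le> onorm (\<lambda>v. (matrix (A x) - M) *v v) * norm v"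
          by (intro onorm) (simp add: matrix_vector_mul_bounded_linear)
        also have "\<dots> \<le> \<epsilon> / real (Suc k) * norm v"
          using M(2) by (intro mult_right_mono) auto
        finally show ?thesis
          using AX(3)[OF x] by (simp add: matrix_vector_mult_diff_rdistrib matrix_works)
      qed
      have Mlow: "norm v \<le> real (Suc k) * norm (M *v v)" for v
      proof -
        have "2 \<le> \<beta> * real (Suc k)" using k \<beta>(1) by (simp add: field_simps)
        then have "2 * norm v \<le> \<beta> * real (Suc k) * norm v" by (intro mult_right_mono) auto
        also have "\<dots> = real (Suc k) * (\<beta> * norm v)" by simp
        also have "\<dots> \<le> real (Suc k) * norm (A x v)" using \<beta>(2) by (intro mult_left_mono) auto
        also have "\<dots> \<le> real (Suc k) * (norm (A x v - M *v v) + norm (M *v v))"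
          by (intro mult_left_mono) (auto intro: norm_triangle_sub order_trans[OF norm_triangle_sub[of _ "M *v v"]])
        also have "\<dots> \<le> real (Suc k) * (\<epsilon> / real (Suc k) * norm v + norm (M *v v))"
          using AM[of v] by (intro mult_left_mono) auto
        also have "\<dots> = \<epsilon> * norm v + real (Suc k) * norm (M *v v)" by (simp add: distrib_left)
        also have "\<dots> \<le> norm v + real (Suc k) * norm (M *v v)"
          using \<epsilon> by (simp add: mult_left_le_one_le)
        finally show ?thesis by simp
      qed
      have "((\<lambda>r. measure lebesgue (G x (\<epsilon> / real (Suc k)) \<inter> ball x r) / measure lebesgue (ball x r)) \<longlongrightarrow> 1) (at_right 0)"
        using AX(1)[OF x] k0 unfolding approx_differential_def density_point_def G_def by blast
      then have "\<forall>\<^sub>F r in at_right 0. measure lebesgue (G x (\<epsilon> / real (Suc k)) \<inter> ball x r) / measure lebesgue (ball x r) 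
          > 1 - (1/2) ^ Suc CARD('n)"
        by (rule order_tendstoD) simp
      then obtain b where b: "b > 0" "\<And>r. 0 < r \<Longrightarrow> r < b \<Longrightarrow> 
          measure lebesgue (G x (\<epsilon> / real (Suc k)) \<inter> ball x r) / measure lebesgue (ball x r) > 1 - (1/2) ^ Suc CARD('n)"
        unfolding eventually_at_right_field by blast
      obtain m :: nat where m: "1 / real (Suc m) < b" by (rule nat_approx_posE[OF b(1)])
      obtain c where c: "c \<in> Q" "c \<in> ball x (1 / (2 * real (Suc m)))"
        using Q(2)[of "ball x (1 / (2 * real (Suc m)))"] by auto
      have "measure lebesgue (G x (\<epsilon> / real (Suc k)) \<inter> ball x r) >
         (1 - (1/2) ^ Suc CARD('n)) * measure lebesgue (ball x r)" if "0 < r" "r < 1 / real (Suc m)" for r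
        using b(2)[of r] that m content_ball_pos[of r x] by (simp add: pos_less_divide_eq)
      then have "x \<in> D M k m c"
        unfolding D_def using x c(2) Mlow AM by (auto simp: dist_commute)
      then show ?thesis using M(1) c(1) by (force simp: \<D>_def)
    qed
    then show "{x \<in> \<Omega>. approx_jacobian F \<Omega> x \<noteq> 0} \<subseteq> \<Union>\<D>" unfolding X_def by blast
    fix E assume "E \<in> \<D>"
    then obtain M k m c where E: "E = D M k m c" by (auto simp: \<D>_def)
    show "E \<subseteq> \<Omega> \<and> bounded E \<and> (\<exists>B k. linear B \<and> k > 0 \<and> (\<forall>v. norm v \<le> k * norm (B v)) \<and>
       (\<forall>x\<in>E. \<forall>y\<in>E. norm (F y - F x - B (y - x)) \<le> 4 * \<epsilon> / k * norm (y - x)) \<and>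
       (\<forall>x\<in>E. \<bar>approx_jacobian F \<Omega> x\<bar> \<le> (1 + \<epsilon>) ^ CARD('n) * \<bar>det (matrix B)\<bar>))"
    proof (cases "E = {}")
      case True
      then show ?thesis
        by (intro conjI exI[of _ "\<lambda>v. v"] exI[of _ "1::real"]) (simp_all add: linear_ident)
    next
      case False
      let ?k = "real (Suc k)"
      let ?B = "\<lambda>v. M *v v"
      have EX: "x \<in> X" "x \<in> ball c (1 / (2 * real (Suc m)))" and Mlow: "norm v \<le> ?k * norm (?B v)"
        and AM: "norm (A x v - ?B v) \<le> \<epsilon> / ?k * norm v" 
        and dens: "0 < r \<Longrightarrow> r < 1 / real (Suc m) \<Longrightarrow> measure lebesgue (G x (\<epsilon> / ?k) \<inter> ball x r) >
           (1 - (1/2) ^ Suc CARD('n)) * measure lebesgue (ball x r)" if "x \<in> E" for x v r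
        using that unfolding E D_def by blast+
      \<comment> \<open>One share of \<epsilon> / k comes from approximate differentiability at
        \<open>x\<close>, the other from replacing \<open>A x\<close> by \<open>M\<close>.\<close>
      have near: "norm (F z - F x - ?B (z - x)) \<le> 2 * \<epsilon> / ?k * norm (z - x)" 
        if "x \<in> E" "z \<in> G x (\<epsilon> / ?k)" for x z
      proof -
        have zx: "norm (z - x) > 0" "norm (F z - F x - A x (z - x)) / norm (z - x) < \<epsilon> / ?k"
          using that(2) by (auto simp: G_def)
        then have "norm (F z - F x - A x (z - x)) \<le> \<epsilon> / ?k * norm (z - x)"
          by (simp only: pos_divide_less_eq less_imp_le)
        moreover have "norm (F z - F x - ?B (z - x)) \<le> norm (F z - F x - A x (z - x)) + norm (A x (z - x) - ?B (z - x))"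
          by norm
        moreover have "2 * \<epsilon> / ?k * norm (z - x) = \<epsilon> / ?k * norm (z - x) + \<epsilon> / ?k * norm (z - x)" by simp
        ultimately show ?thesis using AM[OF that(1), of "z - x"] by linarith
      qed
      have lip: "norm (F y - F x - ?B (y - x)) \<le> 4 * \<epsilon> / ?k * norm (y - x)" if xy: "x \<in> E" "y \<in> E" for x y
      proof (cases "x = y")
        case False
        define r where "r = norm (x - y)"
        have r: "0 < r" using False by (simp add: r_def)
        have "r \<le> dist c x + dist c y" by (simp add: r_def dist_norm[symmetric] dist_triangle3)
        moreover have "dist c x < 1 / (2 * real (Suc m))" "dist c y < 1 / (2 * real (Suc m))"
          using EX(2)[OF xy(1)] EX(2)[OF xy(2)] by (simp_all only: mem_ball)
        ultimately have "r < 1 / (2 * real (Suc m)) + 1 / (2 * real (Suc m))"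
          by (meson add_strict_mono le_less_trans)
        then have r2: "r < 1 / real (Suc m)" by (simp add: field_simps)
        obtain z where z: "z \<in> G x (\<epsilon> / ?k)" "z \<in> G y (\<epsilon> / ?k)" "norm (z - x) < r" "norm (z - y) < r"
          by (rule common_point_of_dense_sets[OF False r_def Gmeas[OF EX(1)[OF xy(1)]] Gmeas[OF EX(1)[OF xy(2)]]
            dens[OF xy(1) r r2] dens[OF xy(2) r r2]])
        \<comment> \<open>The expansions at \<open>x\<close> and at \<open>y\<close> are compared at
          the common good point \<open>z\<close>. As \<open>z\<close> is closer than
          \<open>r\<close> to both, the constant merely doubles.\<close>
        have split: "F y - F x - ?B (y - x) = (F z - F x - ?B (z - x)) - (F z - F y - ?B (z - y))"
          by (simp add: matrix_vector_mult_diff_distrib)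
        have "norm (F y - F x - ?B (y - x)) \<le> norm (F z - F x - ?B (z - x)) + norm (F z - F y - ?B (z - y))"
          unfolding split by (rule norm_triangle_ineq4)
        also have "\<dots> \<le> 2 * \<epsilon> / ?k * norm (z - x) + 2 * \<epsilon> / ?k * norm (z - y)"
          by (intro add_mono near xy z)
        also have "\<dots> \<le> 2 * \<epsilon> / ?k * r + 2 * \<epsilon> / ?k * r"
          using z \<epsilon> by (intro add_mono mult_left_mono) auto
        also have "\<dots> = 4 * \<epsilon> / ?k * norm (y - x)" by (simp add: r_def norm_minus_commute[of x y])
        finally show ?thesis .
      qed simp
      have linB: "linear ?B" by simp
      have invB: "invertible M"
      proof -
        obtain x where "x \<in> E" using False by auto
        have "v = 0" if "?B v = 0" for v
          using Mlow[OF \<open>x \<in> E\<close>, of v] that by simp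
        then have "inj ?B" using linear_injective_0[OF linB] by blast
        then show ?thesis by (simp add: invertible_left_inverse matrix_left_invertible_injective)
      qed
      have jac: "\<bar>approx_jacobian F \<Omega> x\<bar> \<le> (1 + \<epsilon>) ^ CARD('n) * \<bar>det (matrix ?B)\<bar>" if x: "x \<in> E" for x
      proof -
        note A = AX(2)[OF EX(1)[OF x]] AX(3)[OF EX(1)[OF x]]
        obtain M' where MM: "M ** M' = mat 1" using invB unfolding invertible_def by blast
        \<comment> \<open>The inverse of \<open>M\<close> after the differential at
          \<open>x\<close>. It differs from the identity by at most \<epsilon> in norm, so its
          determinant is at most (1 + \<epsilon>)^n, and multiplying by the determinant of
          \<open>M\<close> recovers the Jacobian.\<close>
        define T where "T v = M' *v (A x v)" for v
        have "T = (*v) M' \<circ> A x" by (auto simp: T_def)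
        then have linT: "linear T" using linear_compose[OF A(2) matrix_vector_mul_linear] by simp
        have BT: "?B (T v) = A x v" for v
          by (simp add: T_def matrix_vector_mul_assoc MM)
        have normT: "norm (T v) \<le> (1 + \<epsilon>) * norm v" for v
        proof -
          have "norm (T v - v) \<le> ?k * norm (?B (T v - v))" by (rule Mlow[OF x])
          also have "\<dots> = ?k * norm (A x v - ?B v)" by (simp add: matrix_vector_mult_diff_distrib BT)
          also have "\<dots> \<le> ?k * (\<epsilon> / ?k * norm v)" using AM[OF x] by (intro mult_left_mono) auto
          also have "\<dots> = \<epsilon> * norm v" by simp
          finally have "norm (T v - v) \<le> \<epsilon> * norm v" .
          moreover have "norm (T v) \<le> norm v + norm (T v - v)" by (rule norm_triangle_sub)
          ultimately show ?thesis by (simp add: algebra_simps)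
        qed
        have "\<bar>det (matrix T)\<bar> \<le> (1 + \<epsilon>) ^ CARD('n)"
          using abs_det_le_of_norm_le[OF linT _ normT] \<epsilon> by simp
        moreover have "matrix (A x) = M ** matrix T"
          using matrix_compose[OF linT linB] BT by (simp add: o_def)
        ultimately show ?thesis
          by (simp add: A(1) det_mul abs_mult mult.commute mult_left_mono)
      qed
      have "E \<subseteq> ball c (1 / (2 * real (Suc m)))" using EX(2) by blast
      then have "bounded E" by (rule bounded_subset[OF bounded_ball])
      moreover have "E \<subseteq> \<Omega>" using EX(1) by (auto simp: X_def)
      moreover obtain x where "x \<in> E" using False by auto
      moreover have "0 < ?k" by simp
      ultimately show ?thesis
        using linB Mlow lip jac by (intro conjI exI[of _ ?B] exI[of _ ?k] ballI allI)
    qed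
  qed
qed

text \<open>Extend the restriction of \<open>F\<close> to \<open>D\<close> continuously to the closure of \<open>D\<close> and take the set where \<open>F\<close>
  agrees with the extension.\<close>

lemma measurable_enlargement_nearly_linear:
  fixes F B :: "real^'n \<Rightarrow> real^'n"
  assumes \<Omega>: "\<Omega> \<in> sets lebesgue" and F: "F \<in> borel_measurable (lebesgue_on \<Omega>)"
    and D: "D \<subseteq> \<Omega>" and B: "linear B"
    and near: "\<And>x y. x \<in> D \<Longrightarrow> y \<in> D \<Longrightarrow> norm (F y - F x - B (y - x)) \<le> e * norm (y - x)"
  obtains E where "E \<in> sets lebesgue" "D \<subseteq> E" "E \<subseteq> \<Omega>" "E \<subseteq> closure D"
    "\<And>x y. x \<in> E \<Longrightarrow> y \<in> E \<Longrightarrow> norm (F y - F x - B (y - x)) \<le> e * norm (y - x)"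
proof -
  have bB: "bounded_linear B" using B by (simp add: linear_conv_bounded_linear)
  have lip: "norm (F y - F x) \<le> (\<bar>e\<bar> + onorm B) * norm (y - x)" if "x \<in> D" "y \<in> D" for x y
  proof -
    have "norm (F y - F x) \<le> norm (F y - F x - B (y - x)) + norm (B (y - x))"
      by norm
    also have "\<dots> \<le> e * norm (y - x) + onorm B * norm (y - x)"
      by (intro add_mono near that onorm[OF bB])
    also have "\<dots> \<le> \<bar>e\<bar> * norm (y - x) + onorm B * norm (y - x)"
      by (intro add_mono mult_right_mono) auto
    finally show ?thesis by (simp add: distrib_right)
  qed
  have "(\<bar>e\<bar> + onorm B)-lipschitz_on D F"
    using lip onorm_pos_le[OF bB] by (auto simp: lipschitz_on_def dist_norm)
  then have uc: "uniformly_continuous_on D F" by (rule lipschitz_on_uniformly_continuous)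
  obtain G where G: "uniformly_continuous_on (closure D) G" "\<And>x. x \<in> D \<Longrightarrow> F x = G x"
    by (rule uniformly_continuous_on_extension_on_closure[OF uc]) blast
  have cG: "continuous_on (closure D) G" using G(1) by (rule uniformly_continuous_imp_continuous)
  have cB: "continuous_on X B" for X using bB by (rule linear_continuous_on)
  \<comment> \<open>The inequality is a closed condition on pairs of points, so it passes from pairs
    in \<open>D\<close> to pairs in the closure once \<open>F\<close> is replaced by its continuous
    extension \<open>G\<close>.\<close>
  have cl: "norm (G y - G x - B (y - x)) - e * norm (y - x) \<le> 0" if "x \<in> closure D" "y \<in> closure D" for x y
  proof -
    let ?h = "\<lambda>p. norm (G (snd p) - G (fst p) - B (snd p - fst p)) - e * norm (snd p - fst p)"
    have cG1: "continuous_on (closure D \<times> closure D) (\<lambda>p. G (fst p))" 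
      by (rule continuous_on_compose2[OF cG continuous_on_fst[OF continuous_on_id]]) auto
    have cG2: "continuous_on (closure D \<times> closure D) (\<lambda>p. G (snd p))" 
      by (rule continuous_on_compose2[OF cG continuous_on_snd[OF continuous_on_id]]) auto
    have cB2: "continuous_on (closure D \<times> closure D) (\<lambda>p. B (snd p - fst p))" 
      by (rule continuous_on_compose2[OF cB[of UNIV]]) (auto intro!: continuous_intros)
    have "continuous_on (closure (D \<times> D)) ?h"
      unfolding closure_Times by (intro continuous_intros cG1 cG2 cB2)
    moreover have "(x, y) \<in> closure (D \<times> D)" using that by (simp add: closure_Times)
    moreover have "?h p \<le> 0" if "p \<in> D \<times> D" for p
      using near[of "fst p" "snd p"] G(2) that by (auto simp: mem_Times_iff)
    ultimately have "?h (x, y) \<le> 0"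
      by (rule continuous_le_on_closure)
    then show ?thesis by simp
  qed
  let ?C = "closure D \<inter> \<Omega>"
  have C: "?C \<in> sets lebesgue" using \<Omega> by (intro sets.Int) auto
  have [measurable]: "G \<in> borel_measurable (lebesgue_on ?C)"
    using continuous_on_subset[OF cG] C by (intro continuous_imp_measurable_on_sets_lebesgue) auto
  have [measurable]: "F \<in> borel_measurable (lebesgue_on ?C)"
    using F by (rule measurable_restrict_mono) auto
  define E where "E = {x \<in> space (lebesgue_on ?C). F x = G x}"
  have "E \<in> sets (lebesgue_on ?C)" unfolding E_def by measurable
  then have EM: "E \<in> sets lebesgue" using C by (simp add: sets_restrict_space_iff)
  have Ex: "x \<in> closure D \<and> F x = G x \<and> x \<in> \<Omega>" if "x \<in> E" for x using that by (simp add: E_def)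
  show thesis
  proof (rule that[OF EM])
    show "D \<subseteq> E" using D closure_subset[of D] G(2) by (auto simp: E_def)
    show "E \<subseteq> \<Omega>" "E \<subseteq> closure D" using Ex by blast+
    show "norm (F y - F x - B (y - x)) \<le> e * norm (y - x)" if "x \<in> E" "y \<in> E" for x y
      using cl[of x y] Ex[OF that(1)] Ex[OF that(2)] by simp
  qed
qed

text \<open>\<open>near\<close> and the lower bound on \<open>B\<close> give |B(y - x)| \<le> |F y -
  F x| + \<epsilon> |B(y - x)|. Hence \<open>B\<close> after an inverse of \<open>F\<close> is
  Lipschitz with constant 1/(1 - \<epsilon>) on the image of \<open>S\<close>, and it covers the
  image of \<open>S\<close> under \<open>B\<close>, whose measure is known exactly.\<close>

lemma nearly_linear_image_measure:
  fixes F B :: "real^'n \<Rightarrow> real^'n"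
  assumes S: "S \<in> lmeasurable" and B: "linear B" and k: "k > 0" "\<And>v. norm v \<le> k * norm (B v)"
    and \<epsilon>: "0 \<le> \<epsilon>" "\<epsilon> < 1"
    and near: "\<And>x y. x \<in> S \<Longrightarrow> y \<in> S \<Longrightarrow> norm (F y - F x - B (y - x)) \<le> \<epsilon> / k * norm (y - x)"
  shows "F ` S \<in> sets lebesgue \<and>
    ennreal \<bar>det (matrix B)\<bar> * emeasure lebesgue S \<le> ennreal ((1 / (1 - \<epsilon>)) ^ CARD('n)) * emeasure lebesgue (F ` S)"
proof
  have bB: "bounded_linear B" using B by (simp add: linear_conv_bounded_linear)
  have "norm (F y - F x) \<le> (\<epsilon> / k + onorm B) * norm (y - x)" if "x \<in> S" "y \<in> S" for x y
  proof -
    have "norm (F y - F x) \<le> norm (F y - F x - B (y - x)) + norm (B (y - x))"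
      by norm
    also have "\<dots> \<le> \<epsilon> / k * norm (y - x) + onorm B * norm (y - x)"
      by (intro add_mono near that onorm[OF bB])
    finally show ?thesis by (simp add: distrib_right)
  qed
  then show FS: "F ` S \<in> sets lebesgue"
    using S by (intro lipschitz_image_sets_lebesgue[of S F "\<epsilon> / k + onorm B"]) (auto intro: fmeasurableD)
  have low: "norm (B y - B x) \<le> 1 / (1 - \<epsilon>) * norm (F y - F x)" if "x \<in> S" "y \<in> S" for x y
  proof -
    have "norm (B (y - x)) \<le> norm (F y - F x) + norm (F y - F x - B (y - x))"
      by norm
    also have "norm (F y - F x - B (y - x)) \<le> \<epsilon> / k * norm (y - x)" by (intro near that)
    also have "\<epsilon> / k * norm (y - x) \<le> \<epsilon> / k * (k * norm (B (y - x)))"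
      using \<epsilon> k by (intro mult_left_mono) auto
    also have "\<dots> = \<epsilon> * norm (B (y - x))" using k by simp
    finally have "(1 - \<epsilon>) * norm (B (y - x)) \<le> norm (F y - F x)" by (simp add: algebra_simps)
    then show ?thesis using \<epsilon> by (simp add: linear_diff[OF B] field_simps)
  qed
  \<comment> \<open>The preimage picked by \<open>inv_into\<close> is arbitrary, but by
    \<open>low\<close> points with the same value under \<open>F\<close> have the same value under
    \<open>B\<close>.\<close>
  define \<kappa> where "\<kappa> w = B (inv_into S F w)" for w
  have inv: "inv_into S F w \<in> S" "F (inv_into S F w) = w" if "w \<in> F ` S" for w
    using that by (auto intro: inv_into_into f_inv_into_f)
  have "B ` S \<subseteq> \<kappa> ` (F ` S)"
  proof
    fix z assume "z \<in> B ` S"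
    then obtain x where x: "x \<in> S" "z = B x" by auto
    have "norm (B (inv_into S F (F x)) - B x) \<le> 1 / (1 - \<epsilon>) * norm (F (inv_into S F (F x)) - F x)"
      using x inv[of "F x"] by (intro low) auto
    then have "\<kappa> (F x) = z" using x inv[of "F x"] by (simp add: \<kappa>_def)
    then show "z \<in> \<kappa> ` (F ` S)" using x by blast
  qed
  moreover have klip: "norm (\<kappa> w - \<kappa> w') \<le> 1 / (1 - \<epsilon>) * norm (w - w')" if "w \<in> F ` S" "w' \<in> F ` S" for w w'
    unfolding \<kappa>_def using low[OF inv(1)[OF that(2)] inv(1)[OF that(1)]] inv(2) that by simp
  ultimately have "emeasure lebesgue (B ` S) \<le> emeasure lebesgue (\<kappa> ` (F ` S))"
    using FS by (intro emeasure_mono lipschitz_image_sets_lebesgue[of "F ` S" \<kappa> "1 / (1 - \<epsilon>)"]) auto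
  also have "\<dots> \<le> ennreal ((1 / (1 - \<epsilon>)) ^ DIM(real^'n)) * emeasure lebesgue (F ` S)"
    using FS \<epsilon> klip by (intro emeasure_lipschitz_image) auto
  also have "emeasure lebesgue (B ` S) = ennreal \<bar>det (matrix B)\<bar> * emeasure lebesgue S"
    using measure_linear_image_finite[OF B S] S by (simp add: emeasure_eq_measure2 ennreal_mult)
  finally show "ennreal \<bar>det (matrix B)\<bar> * emeasure lebesgue S
      \<le> ennreal ((1 / (1 - \<epsilon>)) ^ CARD('n)) * emeasure lebesgue (F ` S)"
    by simp
qed

text \<open>\<open>w\<close> stands for the norm of a coefficient. On \<open>A i\<close> the
  Jacobian, which is defined through a choice, is traded for the single number
  \<open>\<delta> i\<close>, the determinant of the linear model; the factors in \<epsilon> measure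
  the two directions of this exchange.\<close>

lemma jacobian_pieces:
  fixes F :: "real^'n \<Rightarrow> real^'n" and w :: "real^'n \<Rightarrow> real"
  assumes \<Omega>: "\<Omega> \<in> sets lebesgue" and F: "F \<in> borel_measurable (lebesgue_on \<Omega>)"
    and w: "w \<in> borel_measurable (lebesgue_on \<Omega>)" and c: "c \<ge> 0"
    and bnd: "AE x in lebesgue_on \<Omega>. w x \<le> c * \<bar>approx_jacobian F \<Omega> x\<bar>"
    and \<epsilon>: "0 < \<epsilon>" "\<epsilon> \<le> 1/8"
  obtains A :: "nat \<Rightarrow> (real^'n) set" and \<delta> :: "nat \<Rightarrow> real"
  where "\<forall>i. A i \<in> sets lebesgue \<and> A i \<subseteq> \<Omega> \<and> \<delta> i \<ge> 0"
    "AE x in lebesgue_on \<Omega>. x \<notin> (\<Union>i. A i) \<longrightarrow> w x \<le> 0"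
    "\<forall>i. \<forall>x\<in>A i. w x \<le> c * (1 + \<epsilon>) ^ CARD('n) * \<delta> i"
    "\<forall>i S. S \<in> sets lebesgue \<longrightarrow> S \<subseteq> A i \<longrightarrow> F ` S \<in> sets lebesgue \<and>
       ennreal (\<delta> i) * emeasure lebesgue S \<le> ennreal ((1 / (1 - 4 * \<epsilon>)) ^ CARD('n)) * emeasure lebesgue (F ` S)"
proof -
  have e1: "\<epsilon> \<le> 1" using \<epsilon> by simp
  obtain \<D> where \<D>: "countable \<D>" "{x \<in> \<Omega>. approx_jacobian F \<Omega> x \<noteq> 0} \<subseteq> \<Union>\<D>"
    and pieces: "\<And>D. D \<in> \<D> \<Longrightarrow> D \<subseteq> \<Omega> \<and> bounded D \<and> (\<exists>B k. linear B \<and> k > 0 \<and>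
       (\<forall>v. norm v \<le> k * norm (B v)) \<and>
       (\<forall>x\<in>D. \<forall>y\<in>D. norm (F y - F x - B (y - x)) \<le> 4 * \<epsilon> / k * norm (y - x)) \<and>
       (\<forall>x\<in>D. \<bar>approx_jacobian F \<Omega> x\<bar> \<le> (1 + \<epsilon>) ^ CARD('n) * \<bar>det (matrix B)\<bar>))"
    by (rule countable_cover_nearly_linear[OF \<Omega> F \<epsilon>(1) e1]) blast
  define P where "P D E d \<longleftrightarrow> E \<in> sets lebesgue \<and> E \<subseteq> \<Omega> \<and> d \<ge> 0 \<and>
      {x \<in> D. w x \<le> c * \<bar>approx_jacobian F \<Omega> x\<bar>} \<subseteq> E \<and>
      (\<forall>x\<in>E. w x \<le> c * (1 + \<epsilon>) ^ CARD('n) * d) \<and>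
      (\<forall>S. S \<in> sets lebesgue \<longrightarrow> S \<subseteq> E \<longrightarrow> F ` S \<in> sets lebesgue \<and>
        ennreal d * emeasure lebesgue S \<le> ennreal ((1 / (1 - 4 * \<epsilon>)) ^ CARD('n)) * emeasure lebesgue (F ` S))" for D E d
  have ex: "\<exists>E d. P D E d" if D: "D \<in> insert {} \<D>" for D
  proof (cases "D = {}")
    case True
    then show ?thesis by (intro exI[of _ "{}"] exI[of _ "0::real"]) (simp add: P_def)
  next
    case False
    then have D: "D \<in> \<D>" using D by simp
    obtain B k where B: "linear B" "k > 0" "\<And>v. norm v \<le> k * norm (B v)"
       "\<And>x y. x \<in> D \<Longrightarrow> y \<in> D \<Longrightarrow> norm (F y - F x - B (y - x)) \<le> 4 * \<epsilon> / k * norm (y - x)"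
       "\<And>x. x \<in> D \<Longrightarrow> \<bar>approx_jacobian F \<Omega> x\<bar> \<le> (1 + \<epsilon>) ^ CARD('n) * \<bar>det (matrix B)\<bar>"
      using pieces[OF D] by blast
    have Ds: "D \<subseteq> \<Omega>" "bounded D" using pieces[OF D] by auto
    obtain E where E: "E \<in> sets lebesgue" "D \<subseteq> E" "E \<subseteq> \<Omega>" "E \<subseteq> closure D"
      "\<And>x y. x \<in> E \<Longrightarrow> y \<in> E \<Longrightarrow> norm (F y - F x - B (y - x)) \<le> 4 * \<epsilon> / k * norm (y - x)"
      by (rule measurable_enlargement_nearly_linear[OF \<Omega> F Ds(1) B(1) B(4)]) blast+
    have bE: "bounded E" using E(4) Ds(2) by (meson bounded_closure bounded_subset)
    define d where "d = \<bar>det (matrix B)\<bar>"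
    \<comment> \<open>Intersecting with this measurable set makes the bound on \<open>w\<close>
      valid at every point of the piece and keeps all points of \<open>D\<close> where the Jacobian
      bound holds.\<close>
    define W where "W = {x \<in> space (lebesgue_on \<Omega>). w x \<le> c * (1 + \<epsilon>) ^ CARD('n) * d}"
    have "W \<in> sets (lebesgue_on \<Omega>)" unfolding W_def using w by measurable
    then have W: "W \<in> sets lebesgue" using \<Omega> by (simp add: sets_restrict_space_iff)
    have "P D (E \<inter> W) d"
      unfolding P_def
    proof (intro conjI ballI allI impI)
      show "E \<inter> W \<in> sets lebesgue" using E(1) W by (rule sets.Int)
      show "E \<inter> W \<subseteq> \<Omega>" using E by auto
      show "{x \<in> D. w x \<le> c * \<bar>approx_jacobian F \<Omega> x\<bar>} \<subseteq> E \<inter> W"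
      proof
        fix x assume x: "x \<in> {x \<in> D. w x \<le> c * \<bar>approx_jacobian F \<Omega> x\<bar>}"
        then have "w x \<le> c * \<bar>approx_jacobian F \<Omega> x\<bar>" by simp
        also have "\<dots> \<le> c * ((1 + \<epsilon>) ^ CARD('n) * d)"
          using B(5)[of x] x c by (intro mult_left_mono) (auto simp: d_def)
        finally show "x \<in> E \<inter> W" using x E Ds by (auto simp: W_def mult.assoc)
      qed
      show "0 \<le> d" by (simp add: d_def)
      show "w x \<le> c * (1 + \<epsilon>) ^ CARD('n) * d" if "x \<in> E \<inter> W" for x using that by (simp add: W_def)
      fix S assume S: "S \<in> sets lebesgue" "S \<subseteq> E \<inter> W"
      have "bounded S" using S(2) bE by (meson bounded_subset Int_lower1)
      then have Sl: "S \<in> lmeasurable" using S(1) by (simp add: bounded_set_imp_lmeasurable)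
      have near: "norm (F y - F x - B (y - x)) \<le> 4 * \<epsilon> / k * norm (y - x)" if "x \<in> S" "y \<in> S" for x y
        using that S(2) by (intro E(5)) auto
      have "0 \<le> 4 * \<epsilon>" "4 * \<epsilon> < 1" using \<epsilon> by auto
      from nearly_linear_image_measure[OF Sl B(1-3) this near]
      show "F ` S \<in> sets lebesgue" 
        "ennreal d * emeasure lebesgue S \<le> ennreal ((1 / (1 - 4 * \<epsilon>)) ^ CARD('n)) * emeasure lebesgue (F ` S)"
        by (auto simp: d_def)
    qed
    then show ?thesis by blast
  qed
  \<comment> \<open>The empty set keeps the enumerated family nonempty.\<close>
  define X where "X i = from_nat_into (insert {} \<D>) i" for i :: nat
  have X: "X i \<in> insert {} \<D>" for i unfolding X_def by (rule from_nat_into) simp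
  have UX: "(\<Union>i. X i) = \<Union>\<D>"
  proof -
    have "range X = insert {} \<D>"
      unfolding X_def using \<D>(1) by (intro range_from_nat_into) auto
    then show ?thesis by simp
  qed
  have "\<forall>i. \<exists>E d. P (X i) E d" using ex[OF X] by blast
  then obtain A \<delta> where P: "\<And>i. P (X i) (A i) (\<delta> i)" by metis
  show thesis
  proof (rule that[of A \<delta>])
    show "\<forall>i. A i \<in> sets lebesgue \<and> A i \<subseteq> \<Omega> \<and> \<delta> i \<ge> 0"
      "\<forall>i. \<forall>x\<in>A i. w x \<le> c * (1 + \<epsilon>) ^ CARD('n) * \<delta> i"
      "\<forall>i S. S \<in> sets lebesgue \<longrightarrow> S \<subseteq> A i \<longrightarrow> F ` S \<in> sets lebesgue \<and>
       ennreal (\<delta> i) * emeasure lebesgue S \<le> ennreal ((1 / (1 - 4 * \<epsilon>)) ^ CARD('n)) * emeasure lebesgue (F ` S)"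
      using P unfolding P_def by blast+
    show "AE x in lebesgue_on \<Omega>. x \<notin> (\<Union>i. A i) \<longrightarrow> w x \<le> 0"
      using bnd AE_space
    proof eventually_elim
      case (elim x)
      show ?case
      proof
        assume nA: "x \<notin> (\<Union>i. A i)"
        have "x \<notin> X i" for i using P[of i] nA elim(1) unfolding P_def by blast
        then have "x \<notin> \<Union>\<D>" unfolding UX[symmetric] by blast
        then have "approx_jacobian F \<Omega> x = 0" using \<D>(2) elim(2) by auto
        then show "w x \<le> 0" using elim(1) by simp
      qed
    qed
  qed
qed

section \<open>Integral inequality with multiplicity\<close>

text \<open>The inequality on sets compares two measures: \<open>d\<close> times the image under
  \<open>F\<close> of the restriction to \<open>S\<close>, and \<open>q\<close> times the
  restriction to the image of \<open>S\<close>. Integrate \<open>u\<close> against both.\<close>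

lemma nn_integral_pullback_le:
  assumes F: "F \<in> measurable M M" and S: "S \<in> sets M" "F ` S \<in> sets M"
    and le: "\<And>B. B \<in> sets M \<Longrightarrow> d * emeasure M (S \<inter> F -` B) \<le> q * emeasure M (F ` S \<inter> B)"
    and u: "u \<in> borel_measurable M"
  shows "d * (\<integral>\<^sup>+x. u (F x) * indicator S x \<partial>M) \<le> q * (\<integral>\<^sup>+y. u y * indicator (F ` S) y \<partial>M)"
proof -
  note [measurable] = F S u
  define N1 where "N1 = scale_measure d (distr (density M (indicator S)) M F)"
  define N2 where "N2 = scale_measure q (density M (indicator (F ` S)))"
  have "N1 \<le> N2"
  proof (subst le_measure, simp add: N1_def N2_def, intro ballI)
    fix B assume "B \<in> sets N1"
    then have B[measurable]: "B \<in> sets M" by (simp add: N1_def)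
    have "emeasure N1 B = d * emeasure M (S \<inter> F -` B)"
      using sets.sets_into_space[OF S(1)]
      by (simp add: N1_def emeasure_distr emeasure_density indicator_inter_arith[symmetric] Int_absorb2 Int_assoc)
        (simp add: Int_commute Int_left_commute Int_absorb1 flip: Int_assoc)
    also have "\<dots> \<le> q * emeasure M (F ` S \<inter> B)" by (rule le[OF B])
    also have "\<dots> = emeasure N2 B"
      by (simp add: N2_def emeasure_density indicator_inter_arith[symmetric])
    finally show "emeasure N1 B \<le> emeasure N2 B" .
  qed
  then have "(\<integral>\<^sup>+y. u y \<partial>N1) \<le> (\<integral>\<^sup>+y. u y \<partial>N2)"
    by (intro nn_integral_mono_measure) (simp_all add: N1_def N2_def)
  then show ?thesis
    by (simp add: N1_def N2_def nn_integral_scale_measure nn_integral_distr nn_integral_density mult.commute)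
qed

text \<open>Preimages of \<open>y\<close> chosen in different pieces are distinct because the pieces
  are disjoint, so at most \<open>K\<close> pieces can hit \<open>y\<close>.\<close>

lemma suminf_indicator_image_le:
  fixes F :: "'a \<Rightarrow> 'b"
  assumes disj: "disjoint_family S" and fin: "finite {x \<in> \<Omega>. F x = y}" "card {x \<in> \<Omega>. F x = y} \<le> K"
    and sub: "\<And>i. S i \<subseteq> \<Omega>"
  shows "(\<Sum>i::nat. indicator (F ` S i) y :: ennreal) \<le> of_nat K * indicator (\<Union>i. F ` S i) y"
proof -
  define I where "I = {i. y \<in> F ` S i}"
  define p where "p i = (SOME x. x \<in> S i \<and> F x = y)" for i
  have p: "p i \<in> S i" "F (p i) = y" if "i \<in> I" for i
  proof -
    have "\<exists>x. x \<in> S i \<and> F x = y" using that by (auto simp: I_def)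
    then have "p i \<in> S i \<and> F (p i) = y" unfolding p_def by (rule someI_ex)
    then show "p i \<in> S i" "F (p i) = y" by auto
  qed
  have inj: "inj_on p I"
  proof (rule inj_onI)
    fix i j assume ij: "i \<in> I" "j \<in> I" "p i = p j"
    then have "p i \<in> S i \<inter> S j" using p(1)[OF ij(1)] p(1)[OF ij(2)] by simp
    then show "i = j" using disj by (auto simp: disjoint_family_on_def)
  qed
  have im: "p ` I \<subseteq> {x \<in> \<Omega>. F x = y}" using p sub by blast
  have I: "finite I" "card I \<le> K"
    using inj im fin(1) by (auto intro: inj_on_finite) (metis card_inj_on_le fin(2) le_trans)
  have "(\<Sum>i. indicator (F ` S i) y :: ennreal) = (\<Sum>i\<in>I. indicator (F ` S i) y)"
    using I(1) by (intro suminf_finite) (auto simp: I_def indicator_def)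
  also have "\<dots> = of_nat (card I)" by (simp add: I_def indicator_def)
  also have "\<dots> \<le> of_nat K * indicator (\<Union>i. F ` S i) y"
  proof (cases "I = {}")
    case False
    then have "y \<in> (\<Union>i. F ` S i)" by (auto simp: I_def)
    then show ?thesis using I(2) by (simp add: of_nat_mono)
  qed simp
  finally show ?thesis .
qed

text \<open>Summing over disjoint pieces, the images overlap at most \<open>K\<close> times almost
  everywhere. \<open>T\<close> is the union of these images: a measurable part of the range, kept in
  the bound so that overlaps between different maps can be counted later.\<close>

lemma nn_integral_jacobian_bound:
  fixes F :: "real^'n \<Rightarrow> real^'n" and w :: "real^'n \<Rightarrow> real"
  assumes \<Omega>: "\<Omega> \<in> sets lebesgue" and F: "F \<in> borel_measurable (lebesgue_on \<Omega>)"
    and FM: "F \<in> measurable (lebesgue_on \<Omega>) (lebesgue_on \<Omega>)"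
    and w: "w \<in> borel_measurable (lebesgue_on \<Omega>)" and c: "c \<ge> 0"
    and bnd: "AE x in lebesgue_on \<Omega>. w x \<le> c * \<bar>approx_jacobian F \<Omega> x\<bar>"
    and mult: "{y \<in> \<Omega>. infinite (F -` {y} \<inter> \<Omega>) \<or> card (F -` {y} \<inter> \<Omega>) > K} \<in> null_sets lebesgue"
    and \<eta>: "\<eta> > 1"
  obtains T where "T \<in> sets lebesgue" "T \<subseteq> F ` \<Omega>"
    "\<And>u. u \<in> borel_measurable (lebesgue_on \<Omega>) \<Longrightarrow>
       (\<integral>\<^sup>+x. ennreal (w x) * u (F x) \<partial>lebesgue_on \<Omega>)
         \<le> ennreal (\<eta> * c * real K) * (\<integral>\<^sup>+y. u y * indicator T y \<partial>lebesgue_on \<Omega>)"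
proof -
  let ?M = "lebesgue_on \<Omega>"
  \<comment> \<open>The combined distortion of the pieces tends to 1 with \<epsilon>, hence
    eventually drops below \<eta>.\<close>
  have "((\<lambda>\<epsilon>. ((1 + \<epsilon>) * (1 / (1 - 4 * \<epsilon>))) ^ CARD('n)) \<longlongrightarrow> ((1 + 0) * (1 / (1 - 4 * 0))) ^ CARD('n)) (at_right (0::real))"
    by (intro tendsto_intros) auto
  then have "\<forall>\<^sub>F \<epsilon> in at_right (0::real). ((1 + \<epsilon>) * (1 / (1 - 4 * \<epsilon>))) ^ CARD('n) < \<eta>"
    by (rule order_tendstoD) (use \<eta> in simp)
  moreover have "\<forall>\<^sub>F \<epsilon> in at_right (0::real). 0 < \<epsilon> \<and> \<epsilon> < 1/8"
    by (auto simp: eventually_at_right_field intro!: exI[of _ "1/8"])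
  ultimately have "\<forall>\<^sub>F \<epsilon> in at_right (0::real). ((1 + \<epsilon>) * (1 / (1 - 4 * \<epsilon>))) ^ CARD('n) < \<eta> \<and> 0 < \<epsilon> \<and> \<epsilon> < 1/8"
    by eventually_elim auto
  then obtain \<epsilon> :: real where \<epsilon>: "((1 + \<epsilon>) * (1 / (1 - 4 * \<epsilon>))) ^ CARD('n) < \<eta>" "0 < \<epsilon>" "\<epsilon> < 1/8"
    by (metis (mono_tags, lifting) eventually_happens trivial_limit_at_right_real)
  have e8: "\<epsilon> \<le> 1/8" using \<epsilon> by simp
  define a where "a = (1 + \<epsilon>) ^ CARD('n)"
  define q where "q = (1 / (1 - 4 * \<epsilon>)) ^ CARD('n)"
  have aq: "a \<ge> 0" "q \<ge> 0" "a * q \<le> \<eta>"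
    using \<epsilon> by (auto simp: a_def q_def power_mult_distrib[symmetric])
  obtain A :: "nat \<Rightarrow> (real^'n) set" and \<delta> :: "nat \<Rightarrow> real" where A': "\<forall>i. A i \<in> sets lebesgue \<and> A i \<subseteq> \<Omega> \<and> \<delta> i \<ge> 0"
    and Aw0: "AE x in ?M. x \<notin> (\<Union>i. A i) \<longrightarrow> w x \<le> 0"
    and Aw: "\<forall>i. \<forall>x\<in>A i. w x \<le> c * a * \<delta> i"
    and AS: "\<forall>i S. S \<in> sets lebesgue \<longrightarrow> S \<subseteq> A i \<longrightarrow> F ` S \<in> sets lebesgue \<and>
       ennreal (\<delta> i) * emeasure lebesgue S \<le> ennreal q * emeasure lebesgue (F ` S)"
    by (rule jacobian_pieces[OF \<Omega> F w c bnd \<epsilon>(2) e8, folded a_def q_def])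
  have A: "A i \<in> sets lebesgue" "A i \<subseteq> \<Omega>" "\<delta> i \<ge> 0" for i using A' by blast+
  \<comment> \<open>After this, overlaps of the images are due to \<open>F\<close> alone and not to
    the cover.\<close>
  define S where "S = disjointed A"
  have SA: "S i \<subseteq> A i" for i by (simp add: S_def disjointed_subset)
  have SM: "S i \<in> sets lebesgue" for i
    unfolding S_def using A(1) sets.range_disjointed_sets[of A lebesgue] by (auto simp: image_subset_iff)
  have S\<Omega>: "S i \<subseteq> \<Omega>" for i using SA A(2) by blast
  have US: "(\<Union>i. S i) = (\<Union>i. A i)" by (simp add: S_def UN_disjointed_eq)
  have disj: "disjoint_family S" by (simp add: S_def disjoint_family_disjointed)
  have F\<Omega>: "F ` \<Omega> \<subseteq> \<Omega>" using measurable_space[OF FM] by auto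
  have FS: "F ` S i \<in> sets lebesgue" for i using AS SM SA by blast
  have "F ` S i \<subseteq> \<Omega>" for i using S\<Omega>[of i] F\<Omega> by blast
  then have SMo: "S i \<in> sets ?M" "F ` S i \<in> sets ?M" for i
    using SM FS S\<Omega> \<Omega> by (simp_all add: sets_restrict_space_iff)
  define T where "T = (\<Union>i. F ` S i)"
  show thesis
  proof (rule that[of T])
    show "T \<in> sets lebesgue" unfolding T_def using FS by blast
    show "T \<subseteq> F ` \<Omega>" using S\<Omega> by (auto simp: T_def)
    fix u :: "real^'n \<Rightarrow> ennreal" assume u[measurable]: "u \<in> borel_measurable ?M"
    note [measurable] = FM w SMo
    have piece: "ennreal (\<delta> i) * (\<integral>\<^sup>+x. u (F x) * indicator (S i) x \<partial>?M)
        \<le> ennreal q * (\<integral>\<^sup>+y. u y * indicator (F ` S i) y \<partial>?M)" for i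
    proof (rule nn_integral_pullback_le[OF FM SMo _ u])
      fix B assume B: "B \<in> sets ?M"
      have BO: "B \<in> sets lebesgue" "B \<subseteq> \<Omega>" using B \<Omega> by (auto simp: sets_restrict_space_iff)
      have "F -` B \<inter> space ?M \<in> sets ?M" using FM B by (rule measurable_sets)
      then have "S i \<inter> F -` B \<inter> \<Omega> \<in> sets lebesgue" 
        using SM[of i] \<Omega> by (simp add: sets_restrict_space_iff Int_assoc sets.Int)
      then have m: "S i \<inter> F -` B \<in> sets lebesgue" using S\<Omega>[of i] by (simp add: Int_absorb2 le_infI1)
      have sub: "F ` (S i \<inter> F -` B) \<subseteq> F ` S i \<inter> B" by auto
      have "ennreal (\<delta> i) * emeasure lebesgue (S i \<inter> F -` B) \<le> ennreal q * emeasure lebesgue (F ` (S i \<inter> F -` B))"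
        using AS m SA[of i] by (meson Int_lower1 order_trans)
      also have "\<dots> \<le> ennreal q * emeasure lebesgue (F ` S i \<inter> B)"
        using sub FS BO by (intro mult_left_mono emeasure_mono sets.Int) auto
      finally show "ennreal (\<delta> i) * emeasure ?M (S i \<inter> F -` B) \<le> ennreal q * emeasure ?M (F ` S i \<inter> B)"
        using S\<Omega>[of i] BO(2) \<Omega> by (subst (1 2) emeasure_restrict_space) auto
    qed
    have "(\<integral>\<^sup>+x. ennreal (w x) * u (F x) \<partial>?M)
        \<le> (\<integral>\<^sup>+x. (\<Sum>i. ennreal (c * a) * (ennreal (\<delta> i) * (u (F x) * indicator (S i) x))) \<partial>?M)"
    proof (rule nn_integral_mono_AE, use Aw0 in eventually_elim)
      case (elim x)
      show ?case
      proof (cases "x \<in> (\<Union>i. A i)")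
        case False
        then have "ennreal (w x) = 0" using elim by (simp add: ennreal_neg)
        then show ?thesis by simp
      next
        case True
        then obtain i where i: "x \<in> S i" unfolding US[symmetric] by blast
        then have "ennreal (w x) \<le> ennreal (c * a * \<delta> i)" using Aw SA by (intro ennreal_leI) blast
        also have "\<dots> = ennreal (c * a) * ennreal (\<delta> i)" using c aq A(3) by (intro ennreal_mult) auto
        finally have "ennreal (w x) * u (F x) \<le> ennreal (c * a) * ennreal (\<delta> i) * u (F x)"
          by (rule mult_right_mono) simp
        also have "\<dots> = ennreal (c * a) * (ennreal (\<delta> i) * (u (F x) * indicator (S i) x))"
          using i by (simp add: mult.assoc)
        also have "\<dots> \<le> (\<Sum>i. ennreal (c * a) * (ennreal (\<delta> i) * (u (F x) * indicator (S i) x)))"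
          using sum_le_suminf[of "\<lambda>i. ennreal (c * a) * (ennreal (\<delta> i) * (u (F x) * indicator (S i) x))" "{i}"] by simp
        finally show ?thesis .
      qed
    qed
    also have "\<dots> = (\<Sum>i. ennreal (c * a) * (ennreal (\<delta> i) * (\<integral>\<^sup>+x. u (F x) * indicator (S i) x \<partial>?M)))"
      by (subst nn_integral_suminf) (auto simp: nn_integral_cmult)
    also have "\<dots> \<le> (\<Sum>i. ennreal (c * a) * (ennreal q * (\<integral>\<^sup>+y. u y * indicator (F ` S i) y \<partial>?M)))"
      by (intro suminf_le mult_left_mono piece) auto
    also have "\<dots> = ennreal (c * a) * (ennreal q * (\<integral>\<^sup>+y. u y * (\<Sum>i. indicator (F ` S i) y) \<partial>?M))"
      by (simp add: nn_integral_suminf[symmetric])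
    also have "\<dots> \<le> ennreal (c * a) * (ennreal q * (\<integral>\<^sup>+y. of_nat K * (u y * indicator T y) \<partial>?M))"
    proof (intro mult_left_mono nn_integral_mono_AE)
      have "AE y in ?M. y \<notin> {y \<in> \<Omega>. infinite (F -` {y} \<inter> \<Omega>) \<or> card (F -` {y} \<inter> \<Omega>) > K}"
        using mult \<Omega> by (intro AE_not_in) (auto simp: null_sets_restrict_space)
      then show "AE y in ?M. u y * (\<Sum>i. indicator (F ` S i) y) \<le> of_nat K * (u y * indicator T y)"
        using AE_space
      proof eventually_elim
        case (elim y)
        have eq: "F -` {y} \<inter> \<Omega> = {x \<in> \<Omega>. F x = y}" by auto
        have "(\<Sum>i. indicator (F ` S i) y :: ennreal) \<le> of_nat K * indicator T y"
          unfolding T_def using elim eq S\<Omega> by (intro suminf_indicator_image_le[OF disj, of \<Omega>]) auto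
        then have "u y * (\<Sum>i. indicator (F ` S i) y) \<le> u y * (of_nat K * indicator T y)"
          by (rule mult_left_mono) simp
        then show ?case by (simp add: ac_simps)
      qed
    qed auto
    also have "\<dots> = ennreal (c * a) * (ennreal q * (of_nat K * (\<integral>\<^sup>+y. u y * indicator T y \<partial>?M)))"
      unfolding T_def by (subst nn_integral_cmult) auto
    also have "\<dots> = ennreal (c * a * q * real K) * (\<integral>\<^sup>+y. u y * indicator T y \<partial>?M)"
      using c aq by (simp add: ennreal_mult mult.assoc ennreal_of_nat_eq_real_of_nat)
    also have "\<dots> \<le> ennreal (\<eta> * c * real K) * (\<integral>\<^sup>+y. u y * indicator T y \<partial>?M)"
    proof (rule mult_right_mono[OF ennreal_leI])
      have "c * (a * q) \<le> c * \<eta>" using aq c by (intro mult_left_mono)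
      then show "c * a * q * real K \<le> \<eta> * c * real K" by (intro mult_right_mono) (simp_all add: mult_ac)
    qed simp
    finally show "(\<integral>\<^sup>+x. ennreal (w x) * u (F x) \<partial>?M) \<le> ennreal (\<eta> * c * real K) * (\<integral>\<^sup>+y. u y * indicator T y \<partial>?M)" .
  qed
qed

section \<open>Quasiconcave functions of the distribution function\<close>

text \<open>Convexity on the segment from 0 together with \<psi>(0) = 0: the quotient \<psi>(t)/t is
  nondecreasing.\<close>

lemma admissible_psi_convexD:
  assumes "admissible_psi \<psi>" "0 < p" "p \<le> q"
  shows "q * \<psi> p \<le> p * \<psi> q"
proof -
  have cv: "convex_on {0..} \<psi>" "\<psi> 0 = 0"
    using assms(1) by (auto simp: admissible_psi_def young_function_real_def)
  have "\<psi> ((1 - p / q) *\<^sub>R 0 + (p / q) *\<^sub>R q) \<le> (1 - p / q) * \<psi> 0 + (p / q) * \<psi> q"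
    using assms by (intro convex_onD[OF cv(1)]) auto
  then have "\<psi> p \<le> p / q * \<psi> q" using assms cv(2) by simp
  then show ?thesis using assms by (simp add: field_simps)
qed

lemma admissible_psi_surj:
  assumes "admissible_psi \<psi>" "0 < z"
  obtains x where "x > 0" "\<psi> x = z"
proof -
  have cv: "convex_on {0..} \<psi>" "(\<psi> \<longlongrightarrow> 0) (at_right 0)" "filterlim \<psi> at_top at_top"
    using assms(1) unfolding admissible_psi_def young_function_real_def by blast+
  have "\<forall>\<^sub>F x in at_right 0. \<psi> x < z" using order_tendstoD(2)[OF cv(2) assms(2)] .
  then obtain b where b: "b > 0" "\<And>x. 0 < x \<Longrightarrow> x < b \<Longrightarrow> \<psi> x < z"
    unfolding eventually_at_right_field by blast
  define lo where "lo = b / 2"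
  have lo: "lo > 0" "\<psi> lo < z" using b by (auto simp: lo_def)
  have "\<forall>\<^sub>F x in at_top. z \<le> \<psi> x" using cv(3) by (simp add: filterlim_at_top)
  then obtain c where c: "\<And>x. x \<ge> c \<Longrightarrow> z \<le> \<psi> x" unfolding eventually_at_top_linorder by blast
  define hi where "hi = max c lo"
  have "continuous_on {0<..} \<psi>"
    by (rule convex_on_continuous[OF open_greaterThan convex_on_subset[OF cv(1)]]) auto
  then have "continuous_on {lo..hi} \<psi>" by (rule continuous_on_subset) (use lo in auto)
  then obtain x where "lo \<le> x" "x \<le> hi" "\<psi> x = z"
    using IVT'[of \<psi> lo z hi] lo c[of hi] by (metis hi_def less_imp_le max.cobounded1 max.cobounded2)
  then show ?thesis using lo that[of x] by linarith
qed

lemma tau_strict_mono: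
  assumes "admissible_psi \<psi>" "0 \<le> s" "s < t"
  shows "tau \<psi> s < tau \<psi> t"
proof -
  have sm: "strict_mono_on {0..} \<psi>" "\<psi> 0 = 0"
    using assms(1) by (auto simp: admissible_psi_def young_function_real_def)
  have pos: "\<psi> x > 0" if "x > 0" for x using strict_mono_onD[OF sm(1), of 0 x] sm(2) that by simp
  show ?thesis
  proof (cases "s = 0")
    case True
    then show ?thesis using assms pos[of "1/t"] by (simp add: tau_def)
  next
    case False
    have "\<psi> (1/t) < \<psi> (1/s)" using assms False by (intro strict_mono_onD[OF sm(1)]) (auto simp: field_simps)
    then show ?thesis using assms False pos[of "1/t"] pos[of "1/s"] by (simp add: tau_def frac_less2)
  qed
qed

lemma tau_inv_real:
  assumes "admissible_psi \<psi>" "0 \<le> y"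
  obtains t where "t \<ge> 0" "tau \<psi> t = y" "tau_inv \<psi> (ennreal y) = ennreal t"
proof -
  have "\<exists>t\<ge>0. tau \<psi> t = y"
  proof (cases "y = 0")
    case False
    then have y: "1 / y > 0" using assms(2) by simp
    obtain x where "x > 0" "\<psi> x = 1 / y" by (rule admissible_psi_surj[OF assms(1) y])
    then show ?thesis using False by (intro exI[of _ "1/x"]) (auto simp: tau_def)
  qed (auto simp: tau_def intro: exI[of _ 0])
  then obtain t where t: "t \<ge> 0" "tau \<psi> t = y" by blast
  have "(THE t. t \<ge> 0 \<and> tau \<psi> t = y) = t"
  proof (rule the_equality)
    fix s assume s: "0 \<le> s \<and> tau \<psi> s = y"
    show "s = t"
      using tau_strict_mono[OF assms(1), of s t] tau_strict_mono[OF assms(1), of t s] s t by linarith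
  qed (use t in simp)
  then have "tau_inv \<psi> (ennreal y) = ennreal t" using assms(2) by (simp add: tau_inv_def)
  then show ?thesis using t that by blast
qed

text \<open>Inserting reciprocals into the monotonicity of \<psi>(t)/t shows that
  \<open>tau \<psi> t / t\<close> is nondecreasing; for the inverse function the quotient by the
  argument is then nonincreasing, which is quasiconcavity.\<close>

lemma tau_ratio_mono:
  assumes "admissible_psi \<psi>" "0 \<le> s" "s \<le> t"
  shows "t * tau \<psi> s \<le> s * tau \<psi> t"
proof (cases "s = 0")
  case False
  then have st: "s > 0" "t > 0" using assms by auto
  have pos: "\<psi> x > 0" if "x > 0" for x
  proof -
    have "strict_mono_on {0..} \<psi>" "\<psi> 0 = 0"
      using assms(1) by (auto simp: admissible_psi_def young_function_real_def)
    then show ?thesis using strict_mono_onD[of "{0..}" \<psi> 0 x] that by simp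
  qed
  have "1/s * \<psi> (1/t) \<le> 1/t * \<psi> (1/s)"
    using assms st by (intro admissible_psi_convexD) (auto simp: field_simps)
  then have "t * \<psi> (1/t) \<le> s * \<psi> (1/s)" using st by (simp add: field_simps)
  then show ?thesis using st pos[of "1/t"] pos[of "1/s"] by (simp add: tau_def field_simps)
qed (simp add: tau_def)

text \<open>\<open>Phi_quasi\<close> says that \<open>\<Phi> a / a\<close> is nonincreasing,
  multiplied out so that it keeps its meaning at 0 and \<open>top\<close>.\<close>

locale quasiconcave =
  fixes \<Phi> :: "ennreal \<Rightarrow> ennreal"
  assumes Phi_mono: "a \<le> b \<Longrightarrow> \<Phi> a \<le> \<Phi> b"
    and Phi_quasi: "a \<le> b \<Longrightarrow> \<Phi> b * a \<le> \<Phi> a * b"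
    and Phi_zero [simp]: "\<Phi> 0 = 0"
    and Phi_top [simp]: "\<Phi> top = top"
    and Phi_pos: "0 < a \<Longrightarrow> 0 < \<Phi> a"
    and Phi_finite: "a < top \<Longrightarrow> \<Phi> a < top"

lemma quasiconcave_tau_inv:
  assumes psi: "admissible_psi \<psi>"
  shows "quasiconcave (tau_inv \<psi>)"
proof
  have tau0: "tau \<psi> 0 = 0" by (simp add: tau_def)
  have le: "s \<le> t" if "tau \<psi> s \<le> tau \<psi> t" "0 \<le> s" "0 \<le> t" for s t
    using tau_strict_mono[OF psi, of t s] that by linarith
  show tau_top: "tau_inv \<psi> top = top" by (simp add: tau_inv_def)
  show zero: "tau_inv \<psi> 0 = 0"
  proof -
    obtain t where t: "t \<ge> 0" "tau \<psi> t = 0" "tau_inv \<psi> (ennreal 0) = ennreal t"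
      by (rule tau_inv_real[OF psi order_refl])
    then have "t = 0" using le[of t 0] tau0 by simp
    then show ?thesis using t by simp
  qed
  show fin: "tau_inv \<psi> a < top" if "a < top" for a
  proof (cases a)
    case (real r)
    show ?thesis unfolding real by (rule tau_inv_real[OF psi real(1)]) simp
  qed (use that in simp)
  show pos: "0 < tau_inv \<psi> a" if "0 < a" for a
  proof (cases a)
    case (real r)
    then have "r > 0" using that by auto
    obtain t where t: "t \<ge> 0" "tau \<psi> t = r" "tau_inv \<psi> (ennreal r) = ennreal t"
      by (rule tau_inv_real[OF psi real(1)])
    then have "t \<noteq> 0" using tau0 \<open>r > 0\<close> by auto
    then show ?thesis using t real by simp
  qed (simp add: tau_top)
  fix a b :: ennreal assume ab: "a \<le> b"
  have *: "tau_inv \<psi> a \<le> tau_inv \<psi> b \<and> tau_inv \<psi> b * a \<le> tau_inv \<psi> a * b"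
  proof (cases "b = top")
    case True
    show ?thesis
    proof (cases "a = 0")
      case False
      then have "tau_inv \<psi> a \<noteq> 0" using pos[of a] by (auto simp: zero_less_iff_neq_zero)
      then show ?thesis using True tau_top by (simp add: ennreal_mult_top)
    qed (simp add: zero)
  next
    case False
    then obtain y where y: "y \<ge> 0" "b = ennreal y" by (cases b) auto
    then obtain x where x: "x \<ge> 0" "a = ennreal x" using ab by (cases a) (auto simp: top_unique)
    obtain s where s: "s \<ge> 0" "tau \<psi> s = x" "tau_inv \<psi> (ennreal x) = ennreal s"
      by (rule tau_inv_real[OF psi x(1)])
    obtain t where t: "t \<ge> 0" "tau \<psi> t = y" "tau_inv \<psi> (ennreal y) = ennreal t"
      by (rule tau_inv_real[OF psi y(1)])
    have "x \<le> y" using ab x y by simp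
    then have st: "s \<le> t" using le[of s t] s(1,2) t(1,2) by simp
    then have "t * x \<le> s * y" using tau_ratio_mono[OF psi s(1) st] s t by simp
    then show ?thesis
      using st x(1) y(1) s(1) t(1) unfolding x(2) y(2) s(3) t(3) by (simp add: ennreal_mult[symmetric])
  qed
  then show "tau_inv \<psi> a \<le> tau_inv \<psi> b" "tau_inv \<psi> b * a \<le> tau_inv \<psi> a * b" by auto
qed

section \<open>Layer-cake formulas and monotone weights\<close>

text \<open>Values in \<open>ennreal\<close> let the functional be applied to a series before its
  convergence is known. The indicator removes negative levels, which \<open>ennreal\<close> would
  collapse to 0.\<close>

definition qnorm :: "(ennreal \<Rightarrow> ennreal) \<Rightarrow> 'a measure \<Rightarrow> ('a \<Rightarrow> ennreal) \<Rightarrow> ennreal" where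
  "qnorm \<Phi> M v = (\<integral>\<^sup>+ s\<in>{0..}. \<Phi> (emeasure M {x \<in> space M. ennreal s < v x}) \<partial>lborel)"

lemma borel_measurable_antimono_ennreal:
  fixes f :: "real \<Rightarrow> ennreal"
  assumes "antimono f"
  shows "f \<in> borel_measurable borel"
proof (rule borel_measurableI_greater)
  fix y
  have "is_interval {x. y < f x}"
    unfolding is_interval_1 using antimonoD[OF assms] by (auto intro: less_le_trans)
  then show "{x \<in> space borel. y < f x} \<in> sets borel"
    using real_interval_borel_measurable by simp
qed

lemma antimono_distribution:
  assumes [measurable]: "v \<in> borel_measurable M"
  shows "antimono (\<lambda>s. emeasure M {x \<in> space M. ennreal s < v x})"
proof (rule antimonoI)
  fix s t :: real assume "s \<le> t"
  then have "ennreal s \<le> ennreal t" by (rule ennreal_leI)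
  then show "emeasure M {x \<in> space M. ennreal t < v x} \<le> emeasure M {x \<in> space M. ennreal s < v x}"
    by (intro emeasure_mono) (auto intro: le_less_trans)
qed

lemma measurable_distribution [measurable]:
  assumes "v \<in> borel_measurable M"
  shows "(\<lambda>s. emeasure M {x \<in> space M. ennreal s < v x}) \<in> borel_measurable borel"
  by (rule borel_measurable_antimono_ennreal[OF antimono_distribution[OF assms]])

lemma emeasure_lborel_below:
  assumes "r \<ge> 0"
  shows "emeasure lborel {s. r \<le> s \<and> ennreal s < b} = b - ennreal r"
proof (cases b)
  case (real t)
  have "{s. r \<le> s \<and> ennreal s < b} = {r..<t}"
    using assms real by (auto simp: ennreal_less_iff)
  then have "emeasure lborel {s. r \<le> s \<and> ennreal s < b} = ennreal (t - r)"
    by (cases "r \<le> t") (simp_all only: emeasure_lborel_Ico, simp add: ennreal_neg)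
  then show ?thesis using real assms by (simp add: ennreal_minus)
next
  case top
  have "{s. r \<le> s \<and> ennreal s < b} = {r..}" by (auto simp: top)
  moreover have "emeasure lborel {r..} = top"
  proof (rule ccontr)
    assume "emeasure lborel {r..} \<noteq> top"
    then obtain k where k: "k \<ge> 0" "emeasure lborel {r..} = ennreal k" by (cases "emeasure lborel {r..}") auto
    have "emeasure lborel {r..r + (k + 1)} \<le> emeasure lborel {r..}" by (intro emeasure_mono) auto
    then show False using k by simp
  qed
  ultimately show ?thesis by (simp add: top)
qed

text \<open>By Tonelli: for fixed \<open>x\<close> the levels from \<open>r\<close> up to
  \<open>v x\<close> have length \<open>v x - ennreal r\<close>. Subtraction in
  \<open>ennreal\<close> is truncated at 0, so this is the excess of \<open>v\<close> over
  \<open>r\<close>.\<close>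

lemma layer_cake:
  assumes M: "sigma_finite_measure M" and v[measurable]: "v \<in> borel_measurable M" and r: "r \<ge> 0"
  shows "(\<integral>\<^sup>+ s\<in>{r..}. emeasure M {x \<in> space M. ennreal s < v x} \<partial>lborel) = (\<integral>\<^sup>+x. (v x - ennreal r) \<partial>M)"
proof -
  interpret M: sigma_finite_measure M by fact
  interpret P: pair_sigma_finite lborel M ..
  have "(\<integral>\<^sup>+ s\<in>{r..}. emeasure M {x \<in> space M. ennreal s < v x} \<partial>lborel)
      = (\<integral>\<^sup>+ s. \<integral>\<^sup>+x. indicator {r..} s * indicator {x \<in> space M. ennreal s < v x} x \<partial>M \<partial>lborel)"
    by (intro nn_integral_cong) (simp add: nn_integral_cmult mult.commute)
  also have "\<dots> = (\<integral>\<^sup>+ s. \<integral>\<^sup>+x. (if r \<le> s \<and> ennreal s < v x then 1 else 0) \<partial>M \<partial>lborel)"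
    by (intro nn_integral_cong) (auto simp: indicator_def)
  also have "\<dots> = (\<integral>\<^sup>+x. \<integral>\<^sup>+ s. (if r \<le> s \<and> ennreal s < v x then 1 else 0) \<partial>lborel \<partial>M)"
    by (rule P.Fubini'[symmetric]) measurable
  also have "\<dots> = (\<integral>\<^sup>+x. \<integral>\<^sup>+ s. indicator {s. r \<le> s \<and> ennreal s < v x} s \<partial>lborel \<partial>M)"
    by (intro nn_integral_cong) (auto simp: indicator_def)
  also have "\<dots> = (\<integral>\<^sup>+x. (v x - ennreal r) \<partial>M)"
    by (intro nn_integral_cong) (simp add: emeasure_lborel_below[OF r])
  finally show ?thesis .
qed

text \<open>A nonempty upward closed set of nonnegative reals is a half line with or without its
  endpoint, and a single point is null.\<close>

lemma nn_integral_up_closed_le: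
  fixes U :: "real set"
  assumes [measurable]: "X \<in> borel_measurable borel" "Y \<in> borel_measurable borel"
    and tails: "\<And>r. r \<ge> 0 \<Longrightarrow> (\<integral>\<^sup>+ s\<in>{r..}. X s \<partial>lborel) \<le> C * (\<integral>\<^sup>+ s\<in>{r..}. Y s \<partial>lborel)"
    and U: "U \<subseteq> {0..}" and up: "\<And>s t. s \<in> U \<Longrightarrow> s \<le> t \<Longrightarrow> t \<in> U"
  shows "(\<integral>\<^sup>+ s\<in>U. X s \<partial>lborel) \<le> C * (\<integral>\<^sup>+ s\<in>U. Y s \<partial>lborel)"
proof (cases "U = {}")
  case False
  define r where "r = Inf U"
  have bdd: "bdd_below U" using U by (meson atLeast_iff bdd_below_def subset_eq)
  have r0: "r \<ge> 0" unfolding r_def using False U by (intro cInf_greatest) auto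
  have sub: "U \<subseteq> {r..}" unfolding r_def using bdd by (auto intro: cInf_lower)
  have sup: "t \<in> U" if "r < t" for t
    using that cInf_lessD[OF False, of t] up unfolding r_def by fastforce
  have eq: "(\<integral>\<^sup>+ s\<in>U. Z s \<partial>lborel) = (\<integral>\<^sup>+ s\<in>{r..}. Z s \<partial>lborel)" for Z :: "real \<Rightarrow> ennreal"
  proof (rule nn_integral_cong_AE)
    have "AE s in lborel. s \<noteq> r" by (rule AE_lborel_singleton)
    then show "AE s in lborel. Z s * indicator U s = Z s * indicator {r..} s"
      by eventually_elim (use sub sup in \<open>force simp: indicator_def\<close>)
  qed
  show ?thesis unfolding eq by (rule tails[OF r0])
qed simp

text \<open>A nondecreasing weight is a superposition of the indicators of its superlevel sets.
  These are upward closed, so the tail inequalities can be integrated over the height of the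
  weight.\<close>

lemma nn_integral_mono_weight_le:
  fixes p :: "real \<Rightarrow> ennreal"
  assumes [measurable]: "X \<in> borel_measurable borel" "Y \<in> borel_measurable borel" "p \<in> borel_measurable borel"
    and tails: "\<And>r. r \<ge> 0 \<Longrightarrow> (\<integral>\<^sup>+ s\<in>{r..}. X s \<partial>lborel) \<le> C * (\<integral>\<^sup>+ s\<in>{r..}. Y s \<partial>lborel)"
    and p: "\<And>s t. 0 \<le> s \<Longrightarrow> s \<le> t \<Longrightarrow> p s \<le> p t"
  shows "(\<integral>\<^sup>+ s\<in>{0..}. p s * X s \<partial>lborel) \<le> C * (\<integral>\<^sup>+ s\<in>{0..}. p s * Y s \<partial>lborel)"
proof -
  define U where "U t = {s. 0 \<le> s \<and> ennreal t < p s}" for t :: real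
  have U[measurable]: "U t \<in> sets borel" for t unfolding U_def by measurable
  have layer: "(\<integral>\<^sup>+ s\<in>{0..}. p s * Z s \<partial>lborel) = (\<integral>\<^sup>+ t\<in>{0..}. (\<integral>\<^sup>+ s\<in>U t. Z s \<partial>lborel) \<partial>lborel)"
    if [measurable]: "Z \<in> borel_measurable borel" for Z :: "real \<Rightarrow> ennreal"
  proof -
    have "(\<integral>\<^sup>+ s\<in>{0..}. p s * Z s \<partial>lborel)
        = (\<integral>\<^sup>+ s. (\<integral>\<^sup>+ t. indicator {t. 0 \<le> t \<and> ennreal t < p s} t \<partial>lborel) * (Z s * indicator {0..} s) \<partial>lborel)"
      using emeasure_lborel_below[of 0] by (intro nn_integral_cong) (simp add: mult.assoc)
    also have "\<dots> = (\<integral>\<^sup>+ s. \<integral>\<^sup>+ t. (if 0 \<le> t \<and> 0 \<le> s \<and> ennreal t < p s then Z s else 0) \<partial>lborel \<partial>lborel)"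
    proof (rule nn_integral_cong)
      fix s
      have "(\<integral>\<^sup>+ t. indicator {t. 0 \<le> t \<and> ennreal t < p s} t \<partial>lborel) * (Z s * indicator {0..} s)
          = (\<integral>\<^sup>+ t. indicator {t. 0 \<le> t \<and> ennreal t < p s} t * (Z s * indicator {0..} s) \<partial>lborel)"
        by (rule nn_integral_multc[symmetric]) measurable
      also have "\<dots> = (\<integral>\<^sup>+ t. (if 0 \<le> t \<and> 0 \<le> s \<and> ennreal t < p s then Z s else 0) \<partial>lborel)"
        by (rule nn_integral_cong) (auto simp: indicator_def)
      finally show "(\<integral>\<^sup>+ t. indicator {t. 0 \<le> t \<and> ennreal t < p s} t \<partial>lborel) * (Z s * indicator {0..} s)
          = (\<integral>\<^sup>+ t. (if 0 \<le> t \<and> 0 \<le> s \<and> ennreal t < p s then Z s else 0) \<partial>lborel)" .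
    qed
    also have "\<dots> = (\<integral>\<^sup>+ t. \<integral>\<^sup>+ s. (if 0 \<le> t \<and> 0 \<le> s \<and> ennreal t < p s then Z s else 0) \<partial>lborel \<partial>lborel)"
      by (rule lborel_pair.Fubini'[symmetric]) measurable
    also have "\<dots> = (\<integral>\<^sup>+ t\<in>{0..}. (\<integral>\<^sup>+ s\<in>U t. Z s \<partial>lborel) \<partial>lborel)"
    proof (rule nn_integral_cong)
      fix t :: real
      show "(\<integral>\<^sup>+ s. (if 0 \<le> t \<and> 0 \<le> s \<and> ennreal t < p s then Z s else 0) \<partial>lborel)
          = (\<integral>\<^sup>+ s\<in>U t. Z s \<partial>lborel) * indicator {0..} t"
      proof (cases "0 \<le> t")
        case True
        then show ?thesis by (simp, intro nn_integral_cong) (simp add: U_def indicator_def)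
      qed simp
    qed
    finally show ?thesis .
  qed
  have mY: "(\<lambda>t. \<integral>\<^sup>+ s\<in>U t. Y s \<partial>lborel) \<in> borel_measurable borel"
    unfolding U_def indicator_def by measurable
  have "(\<integral>\<^sup>+ t\<in>{0..}. (\<integral>\<^sup>+ s\<in>U t. X s \<partial>lborel) \<partial>lborel)
      \<le> (\<integral>\<^sup>+ t\<in>{0..}. (C * (\<integral>\<^sup>+ s\<in>U t. Y s \<partial>lborel)) \<partial>lborel)"
  proof (intro nn_integral_mono mult_right_mono)
    fix t
    show "(\<integral>\<^sup>+ s\<in>U t. X s \<partial>lborel) \<le> C * (\<integral>\<^sup>+ s\<in>U t. Y s \<partial>lborel)"
    proof (rule nn_integral_up_closed_le[OF _ _ tails])
      show "a \<in> U t \<Longrightarrow> a \<le> b \<Longrightarrow> b \<in> U t" for a b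
        unfolding U_def using p[of a b] by (auto intro: less_le_trans)
    qed (auto simp: U_def)
  qed simp
  also have "\<dots> = C * (\<integral>\<^sup>+ t\<in>{0..}. (\<integral>\<^sup>+ s\<in>U t. Y s \<partial>lborel) \<partial>lborel)"
    using mY by (simp add: nn_integral_cmult mult.assoc)
  finally show ?thesis by (simp add: layer)
qed

section \<open>Finiteness and majorization for the functional\<close>

context quasiconcave
begin

text \<open>Measurability comes from monotonicity: \<open>\<Phi>\<close> after a decreasing
  distribution function is again decreasing.\<close>

lemma measurable_Phi_distribution [measurable]:
  assumes "v \<in> borel_measurable M"
  shows "(\<lambda>s. \<Phi> (emeasure M {x \<in> space M. ennreal s < v x})) \<in> borel_measurable borel"
proof (rule borel_measurable_antimono_ennreal, rule antimonoI)
  fix s t :: real assume "s \<le> t"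
  then show "\<Phi> (emeasure M {x \<in> space M. ennreal t < v x}) \<le> \<Phi> (emeasure M {x \<in> space M. ennreal s < v x})"
    by (intro Phi_mono antimonoD[OF antimono_distribution[OF assms]])
qed

text \<open>If the distribution function is infinite at \<open>s\<close>, it is infinite at all
  lower levels, and the functional integrates \<open>top\<close> over an interval of positive
  length.\<close>

lemma distribution_finite:
  assumes u: "u \<in> borel_measurable M" and fin: "qnorm \<Phi> M u < top" and s: "s > 0"
  shows "emeasure M {x \<in> space M. ennreal s < u x} < top"
proof (rule ccontr)
  let ?a = "\<lambda>s. emeasure M {x \<in> space M. ennreal s < u x}"
  assume "\<not> ?thesis"
  then have top_s: "?a s = top" using less_top by blast
  have "top = (\<integral>\<^sup>+ r. top * indicator {0..s} r \<partial>lborel)"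
    using s by (subst nn_integral_cmult_indicator) (simp_all add: ennreal_top_mult)
  also have "\<dots> \<le> qnorm \<Phi> M u"
    unfolding qnorm_def
  proof (rule nn_integral_mono)
    fix r
    have "?a r = top" if "r \<le> s"
      using antimonoD[OF antimono_distribution[OF u] that] top_s by (simp add: top_unique)
    then show "top * indicator {0..s} r \<le> \<Phi> (?a r) * indicator {0..} r"
      by (auto simp: indicator_def)
  qed
  finally show False using fin by (simp add: top_unique)
qed

text \<open>Above level \<open>r\<close> quasiconcavity gives
  \<open>\<Phi> (?a r) * ?a s \<le> ?a r * \<Phi> (?a s)\<close>, so the distribution function is
  controlled by the integrand of the functional. Every function of finite functional is thus bounded
  by a constant plus an integrable function.\<close>

lemma tail_integral_finite:
  assumes M: "sigma_finite_measure M" and u[measurable]: "u \<in> borel_measurable M"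
    and fin: "qnorm \<Phi> M u < top" and r: "r > 0"
  shows "(\<integral>\<^sup>+x. (u x - ennreal r) \<partial>M) < top"
proof -
  let ?a = "\<lambda>s. emeasure M {x \<in> space M. ennreal s < u x}"
  have anti: "?a t \<le> ?a s" if "s \<le> t" for s t
    using antimonoD[OF antimono_distribution[OF u] that] .
  have afin: "?a r < top" by (rule distribution_finite[OF u fin r])
  have cake: "(\<integral>\<^sup>+x. (u x - ennreal r) \<partial>M) = (\<integral>\<^sup>+ s\<in>{r..}. ?a s \<partial>lborel)"
    using layer_cake[OF M u, of r] r by simp
  have "\<Phi> (?a r) * (\<integral>\<^sup>+ s\<in>{r..}. ?a s \<partial>lborel) = (\<integral>\<^sup>+ s. \<Phi> (?a r) * (?a s * indicator {r..} s) \<partial>lborel)"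
    by (rule nn_integral_cmult[symmetric]) measurable
  also have "\<dots> \<le> (\<integral>\<^sup>+ s. ?a r * (\<Phi> (?a s) * indicator {0..} s) \<partial>lborel)"
  proof (rule nn_integral_mono)
    fix s
    show "\<Phi> (?a r) * (?a s * indicator {r..} s) \<le> ?a r * (\<Phi> (?a s) * indicator {0..} s)"
    proof (cases "r \<le> s")
      case True
      then show ?thesis using Phi_quasi[OF anti[OF True]] r by (simp add: mult.commute)
    qed simp
  qed
  also have "\<dots> = ?a r * qnorm \<Phi> M u"
    unfolding qnorm_def by (rule nn_integral_cmult) measurable
  also have "\<dots> < top" using afin fin by (simp add: ennreal_mult_less_top)
  finally have le: "\<Phi> (?a r) * (\<integral>\<^sup>+ s\<in>{r..}. ?a s \<partial>lborel) < top" .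
  show ?thesis
  proof (cases "?a r = 0")
    case True
    then have "(\<integral>\<^sup>+ s\<in>{r..}. ?a s \<partial>lborel) = (\<integral>\<^sup>+ s. 0 \<partial>(lborel :: real measure))"
      using anti[of r] by (intro nn_integral_cong) (auto simp: indicator_def)
    then show ?thesis using cake by simp
  next
    case False
    then have "\<Phi> (?a r) \<noteq> 0" using Phi_pos[of "?a r"] by (auto simp: zero_less_iff_neq_zero)
    then show ?thesis using le cake by (auto simp: ennreal_mult_less_top)
  qed
qed

lemma qnorm_mono:
  assumes "w \<in> borel_measurable M" "\<And>x. x \<in> space M \<Longrightarrow> v x \<le> w x"
  shows "qnorm \<Phi> M v \<le> qnorm \<Phi> M w"
  unfolding qnorm_def using assms
  by (intro nn_integral_mono mult_right_mono Phi_mono emeasure_mono) (auto intro: less_le_trans)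

lemma qnorm_cmult:
  assumes v[measurable]: "v \<in> borel_measurable M" and c: "c > 0"
  shows "qnorm \<Phi> M (\<lambda>x. ennreal c * v x) = ennreal c * qnorm \<Phi> M v"
proof -
  have "qnorm \<Phi> M (\<lambda>x. ennreal c * v x)
      = ennreal \<bar>c\<bar> * (\<integral>\<^sup>+ s. \<Phi> (emeasure M {x \<in> space M. ennreal (0 + c * s) < ennreal c * v x}) * indicator {0..} (0 + c * s) \<partial>lborel)"
    unfolding qnorm_def using c by (intro nn_integral_real_affine) auto
  also have "(\<integral>\<^sup>+ s. \<Phi> (emeasure M {x \<in> space M. ennreal (0 + c * s) < ennreal c * v x}) * indicator {0..} (0 + c * s) \<partial>lborel)
      = qnorm \<Phi> M v"
    unfolding qnorm_def
  proof (rule nn_integral_cong)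
    fix s :: real
    show "\<Phi> (emeasure M {x \<in> space M. ennreal (0 + c * s) < ennreal c * v x}) * indicator {0..} (0 + c * s)
        = \<Phi> (emeasure M {x \<in> space M. ennreal s < v x}) * indicator {0..} s"
    proof (cases "s \<ge> 0")
      case True
      have "ennreal (c * s) < ennreal c * y \<longleftrightarrow> ennreal s < y" for y
        by (cases y) (use c True in \<open>auto simp: ennreal_mult[symmetric] ennreal_less_iff ennreal_mult_top\<close>)
      then show ?thesis using c True by simp
    next
      case False
      then have "\<not> 0 \<le> c * s" using c by (simp add: zero_le_mult_iff)
      then show ?thesis using False by simp
    qed
  qed
  finally show ?thesis using c by simp
qed

text \<open>Hardy--Littlewood--Polya majorization controls the functional although \<open>\<Phi>\<close> need not be
  concave: by quasiconcavity \<open>\<Phi> b \<le> (\<Phi> a / a) * b\<close> for \<open>a \<le> b\<close>, and the weight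
  \<open>\<Phi> a / a\<close> increases with the level.\<close>

lemma qnorm_le_of_majorization:
  assumes M: "sigma_finite_measure M"
    and u[measurable]: "u \<in> borel_measurable M" and z[measurable]: "z \<in> borel_measurable M"
    and uz: "\<And>x. x \<in> space M \<Longrightarrow> u x \<le> z x" and C: "C \<noteq> 0"
    and maj: "\<And>r. r \<ge> 0 \<Longrightarrow> (\<integral>\<^sup>+x. (z x - ennreal r) \<partial>M) \<le> C * (\<integral>\<^sup>+x. (u x - ennreal r) \<partial>M)"
  shows "qnorm \<Phi> M z \<le> C * qnorm \<Phi> M u"
proof (cases "qnorm \<Phi> M u = top")
  case True
  then show ?thesis using C by (simp add: ennreal_mult_top)
next
  case False
  then have fin: "qnorm \<Phi> M u < top" by (simp add: less_top)
  let ?a = "\<lambda>s. emeasure M {x \<in> space M. ennreal s < u x}"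
  let ?b = "\<lambda>s. emeasure M {x \<in> space M. ennreal s < z x}"
  have anti: "?a t \<le> ?a s" if "s \<le> t" for s t
    using antimonoD[OF antimono_distribution[OF u] that] .
  have ab: "?a s \<le> ?b s" for s using uz by (intro emeasure_mono) (auto intro: less_le_trans)
  \<comment> \<open>The value \<open>top\<close> where the distribution of \<open>u\<close> vanishes
    keeps \<open>p\<close> nondecreasing, and the product with 0 remains 0. Where the distribution
    is infinite, division in \<open>ennreal\<close> makes \<open>p\<close> equal to 0, which is
    harmless because this can happen only at levels \<le> 0.\<close>
  define p where "p s = (if ?a s = 0 then top else \<Phi> (?a s) / ?a s)" for s
  have pmono: "p s \<le> p t" if "s \<le> t" for s t
  proof (cases "?a t = 0")
    case False
    then have as: "?a s \<noteq> 0" using anti[OF that] by auto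
    show ?thesis
    proof (cases "?a s = top")
      case True
      then show ?thesis using as by (simp add: p_def)
    next
      case fs: False
      then have ft: "?a t \<noteq> top" using anti[OF that] by (auto simp: top_unique)
      have "\<Phi> (?a s) / ?a s = (\<Phi> (?a s) * ?a t) / ?a t / ?a s"
        using False ft by (simp add: ennreal_mult_divide_eq)
      also have "\<dots> \<le> (\<Phi> (?a t) * ?a s) / ?a t / ?a s"
        by (intro divide_right_mono_ennreal Phi_quasi anti that)
      also have "\<dots> = \<Phi> (?a t) / ?a t * ?a s / ?a s"
        by (simp add: divide_ennreal_def mult_ac)
      also have "\<dots> = \<Phi> (?a t) / ?a t"
        using as fs by (rule ennreal_mult_divide_eq)
      finally show ?thesis using as False by (simp add: p_def)
    qed
  qed (simp add: p_def)
  have pm[measurable]: "p \<in> borel_measurable borel"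
    unfolding p_def by measurable
  have pb: "\<Phi> (?b s) \<le> p s * ?b s" if "s > 0" for s
  proof (cases "?a s = 0")
    case True
    then show ?thesis by (cases "?b s = 0") (auto simp: p_def ennreal_top_mult)
  next
    case False
    have fs: "?a s \<noteq> top" using distribution_finite[OF u fin that] by simp
    have "\<Phi> (?b s) = \<Phi> (?b s) * ?a s / ?a s" using False fs by (simp add: ennreal_mult_divide_eq)
    also have "\<dots> \<le> \<Phi> (?a s) * ?b s / ?a s" by (intro divide_right_mono_ennreal Phi_quasi ab)
    also have "\<dots> = p s * ?b s" using False by (simp add: p_def divide_ennreal_def mult_ac)
    finally show ?thesis .
  qed
  have pa: "p s * ?a s \<le> \<Phi> (?a s)" for s
  proof -
    consider "?a s = 0" | "?a s = top" | "?a s \<noteq> 0" "?a s \<noteq> top" by blast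
    then show ?thesis
    proof cases
      case 3
      then show ?thesis by (simp add: p_def ennreal_divide_times less_top ennreal_divide_self)
    qed (simp_all add: p_def)
  qed
  have "qnorm \<Phi> M z \<le> (\<integral>\<^sup>+ s\<in>{0..}. p s * ?b s \<partial>lborel)"
    unfolding qnorm_def
  proof (rule nn_integral_mono_AE)
    \<comment> \<open>Level 0 is left out because the distribution of \<open>u\<close> may be
      infinite there.\<close>
    have "AE s in lborel. s \<noteq> (0::real)" by (rule AE_lborel_singleton)
    then show "AE s in lborel. \<Phi> (?b s) * indicator {0..} s \<le> p s * ?b s * indicator {0..} s"
      by eventually_elim (use pb in \<open>auto simp: indicator_def\<close>)
  qed
  also have "\<dots> \<le> C * (\<integral>\<^sup>+ s\<in>{0..}. p s * ?a s \<partial>lborel)"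
  proof (rule nn_integral_mono_weight_le)
    show "(\<integral>\<^sup>+ s\<in>{r..}. ?b s \<partial>lborel) \<le> C * (\<integral>\<^sup>+ s\<in>{r..}. ?a s \<partial>lborel)" if "r \<ge> 0" for r
      using maj[OF that] by (simp add: layer_cake[OF M u that] layer_cake[OF M z that])
  qed (auto intro: pmono)
  also have "\<dots> \<le> C * qnorm \<Phi> M u"
    unfolding qnorm_def by (intro mult_left_mono nn_integral_mono mult_right_mono pa) auto
  finally show ?thesis .
qed

end

section \<open>Weighted composition operators\<close>

lemma ennreal_le_add_diff: "a \<le> r + (a - r)" for a r :: ennreal
  by (metis add_diff_inverse_ennreal diff_add_self_ennreal le_add_same_cancel1 le_cases zero_le add.commute)

text \<open>The scalar operator that dominates the vector-valued one, with \<open>W n\<close> in the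
  role of the norm of \<open>g n\<close>. \<open>W_sup\<close> is the contraction in the supremum
  norm and \<open>W_int\<close> the one in L^1.\<close>

locale weighted_composition = sigma_finite_measure M for M :: "'a measure" +
  fixes I :: "nat set" and f :: "nat \<Rightarrow> 'a \<Rightarrow> 'a" and W :: "nat \<Rightarrow> 'a \<Rightarrow> ennreal" and \<alpha> :: real
  assumes finI: "finite I"
    and f_meas: "n \<in> I \<Longrightarrow> f n \<in> measurable M M"
    and f_null: "n \<in> I \<Longrightarrow> B \<in> null_sets M \<Longrightarrow> f n -` B \<inter> space M \<in> null_sets M"
    and W_meas: "n \<in> I \<Longrightarrow> W n \<in> borel_measurable M"
    and \<alpha>: "0 \<le> \<alpha>" "\<alpha> < 1"
    and W_sup: "AE x in M. (\<Sum>n\<in>I. W n x) \<le> ennreal \<alpha>"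
    and W_int: "u \<in> borel_measurable M \<Longrightarrow>
      (\<integral>\<^sup>+x. (\<Sum>n\<in>I. W n x * u (f n x)) \<partial>M) \<le> ennreal \<alpha> * (\<integral>\<^sup>+x. u x \<partial>M)"
begin

definition Q :: "('a \<Rightarrow> ennreal) \<Rightarrow> 'a \<Rightarrow> ennreal" where
  "Q u x = (\<Sum>n\<in>I. W n x * u (f n x))"

text \<open>Tail of the Neumann series of \<open>Q\<close>.\<close>

definition R :: "nat \<Rightarrow> ('a \<Rightarrow> ennreal) \<Rightarrow> 'a \<Rightarrow> ennreal" where
  "R j u x = (\<Sum>i. (Q ^^ (j + i)) u x)"

text \<open>The tail of the geometric series of \<alpha> from \<open>j\<close> on, which bounds
  \<open>R j\<close> both on constants and in L^1.\<close>

definition d :: "nat \<Rightarrow> real" where "d j = \<alpha> ^ j / (1 - \<alpha>)"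

lemma Q_measurable [measurable]: "u \<in> borel_measurable M \<Longrightarrow> Q u \<in> borel_measurable M"
  unfolding Q_def using f_meas W_meas
  by (intro borel_measurable_sum borel_measurable_times_ennreal) (auto intro: measurable_compose)

lemma Qpow_measurable [measurable]: "u \<in> borel_measurable M \<Longrightarrow> (Q ^^ i) u \<in> borel_measurable M"
  by (induction i) (auto intro: Q_measurable)

lemma R_measurable [measurable]: "u \<in> borel_measurable M \<Longrightarrow> R j u \<in> borel_measurable M"
  unfolding R_def by measurable

text \<open>\<open>f_null\<close> pulls exceptional sets back to null sets; this makes
  \<open>Q\<close> compatible with inequalities that hold almost everywhere.\<close>

lemma AE_compose:
  assumes "AE x in M. P x"
  shows "AE x in M. \<forall>n\<in>I. P (f n x)"
proof (rule AE_finite_allI[OF finI])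
  fix n assume n: "n \<in> I"
  obtain B where B: "{x \<in> space M. \<not> P x} \<subseteq> B" "B \<in> null_sets M"
    using assms by (auto elim!: AE_E)
  show "AE x in M. P (f n x)"
  proof (rule AE_I')
    show "f n -` B \<inter> space M \<in> null_sets M" by (rule f_null[OF n B(2)])
    show "{x \<in> space M. \<not> P (f n x)} \<subseteq> f n -` B \<inter> space M"
      using B(1) measurable_space[OF f_meas[OF n]] by blast
  qed
qed

lemma Q_AE_mono:
  assumes "AE x in M. u x \<le> v x"
  shows "AE x in M. Q u x \<le> Q v x"
  using AE_compose[OF assms]
  by eventually_elim (auto simp: Q_def intro!: sum_mono mult_left_mono)

lemma Q_add: "Q (\<lambda>x. u x + v x) x = Q u x + Q v x"
  by (simp add: Q_def distrib_left sum.distrib)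

lemma Q_const_le: "AE x in M. Q (\<lambda>_. c) x \<le> ennreal \<alpha> * c"
  using W_sup
proof eventually_elim
  case (elim x)
  have "Q (\<lambda>_. c) x = (\<Sum>n\<in>I. W n x) * c" by (simp add: Q_def sum_distrib_right)
  then show ?case using elim by (simp add: mult_right_mono)
qed

text \<open>Start from u \<le> r + (u - r)^+. Each application of \<open>Q\<close> multiplies the
  constant by at most \<alpha>, while the excess is carried along unchanged under the powers of
  \<open>Q\<close>.\<close>

lemma Qpow_split:
  shows "AE x in M. (Q ^^ i) u x \<le> ennreal (\<alpha> ^ i) * r + (Q ^^ i) (\<lambda>x. u x - r) x"
proof (induction i)
  case 0
  show ?case by (simp add: ennreal_le_add_diff)
next
  case (Suc i)
  show ?case
    using Q_AE_mono[OF Suc.IH] Q_const_le[of "ennreal (\<alpha> ^ i) * r"]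
  proof eventually_elim
    case (elim x)
    have "(Q ^^ Suc i) u x \<le> Q (\<lambda>_. ennreal (\<alpha> ^ i) * r) x + (Q ^^ Suc i) (\<lambda>x. u x - r) x"
      using elim(1) by (simp add: Q_add)
    also have "\<dots> \<le> ennreal \<alpha> * (ennreal (\<alpha> ^ i) * r) + (Q ^^ Suc i) (\<lambda>x. u x - r) x"
      using elim(2) by (intro add_right_mono)
    also have "ennreal \<alpha> * (ennreal (\<alpha> ^ i) * r) = ennreal (\<alpha> ^ Suc i) * r"
      using \<alpha> by (simp add: ennreal_mult mult.assoc)
    finally show ?case .
  qed
qed

lemma Qpow_integral_le:
  assumes "u \<in> borel_measurable M"
  shows "(\<integral>\<^sup>+x. (Q ^^ i) u x \<partial>M) \<le> ennreal (\<alpha> ^ i) * (\<integral>\<^sup>+x. u x \<partial>M)"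
proof (induction i)
  case (Suc i)
  have "(\<integral>\<^sup>+x. (Q ^^ Suc i) u x \<partial>M) \<le> ennreal \<alpha> * (\<integral>\<^sup>+x. (Q ^^ i) u x \<partial>M)"
    using W_int[OF Qpow_measurable[OF assms, of i]] by (simp add: Q_def)
  also have "\<dots> \<le> ennreal \<alpha> * (ennreal (\<alpha> ^ i) * (\<integral>\<^sup>+x. u x \<partial>M))"
    by (intro mult_left_mono Suc.IH) simp
  finally show ?case using \<alpha> by (simp add: ennreal_mult mult.assoc)
qed simp

lemma d_pos: "0 \<le> d j" using \<alpha> by (simp add: d_def)

lemma suminf_geometric: "(\<Sum>i. ennreal (\<alpha> ^ (j + i))) = ennreal (d j)"
proof -
  have "(\<lambda>i. \<alpha> ^ j * \<alpha> ^ i) sums (\<alpha> ^ j * (1 / (1 - \<alpha>)))"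
    using \<alpha> by (intro sums_mult geometric_sums) simp
  then have "(\<lambda>i. \<alpha> ^ (j + i)) sums d j" by (simp add: d_def power_add)
  then show ?thesis using \<alpha> by (intro sums_unique[symmetric] sums_ennreal[THEN iffD2]) (auto simp: d_pos)
qed

lemma R_split: "AE x in M. R j u x \<le> ennreal (d j) * r + R j (\<lambda>x. u x - r) x"
proof -
  have "AE x in M. \<forall>i. (Q ^^ (j + i)) u x \<le> ennreal (\<alpha> ^ (j + i)) * r + (Q ^^ (j + i)) (\<lambda>x. u x - r) x"
    unfolding AE_all_countable using Qpow_split by blast
  then show ?thesis
  proof eventually_elim
    case (elim x)
    have "R j u x \<le> (\<Sum>i. ennreal (\<alpha> ^ (j + i)) * r + (Q ^^ (j + i)) (\<lambda>x. u x - r) x)"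
      unfolding R_def using elim by (intro suminf_le) auto
    also have "\<dots> = (\<Sum>i. ennreal (\<alpha> ^ (j + i)) * r) + R j (\<lambda>x. u x - r) x"
      unfolding R_def by (rule suminf_add[symmetric]) auto
    finally show ?case by (simp add: suminf_geometric)
  qed
qed

lemma R_integral_le:
  assumes [measurable]: "u \<in> borel_measurable M"
  shows "(\<integral>\<^sup>+x. R j u x \<partial>M) \<le> ennreal (d j) * (\<integral>\<^sup>+x. u x \<partial>M)"
proof -
  have "(\<integral>\<^sup>+x. R j u x \<partial>M) = (\<Sum>i. \<integral>\<^sup>+x. (Q ^^ (j + i)) u x \<partial>M)"
    unfolding R_def by (rule nn_integral_suminf) measurable
  also have "\<dots> \<le> (\<Sum>i. ennreal (\<alpha> ^ (j + i)) * (\<integral>\<^sup>+x. u x \<partial>M))"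
    by (intro suminf_le Qpow_integral_le) auto
  finally show ?thesis by (simp add: suminf_geometric)
qed

text \<open>Cutting at height \<open>d j * r\<close> removes whatever the constant part can
  contribute; what remains is dominated by the tail series of the excess, where the L^1 bound
  applies. In other words, \<open>d j * u\<close> majorizes \<open>R j u\<close>.\<close>

lemma R_majorized:
  assumes [measurable]: "u \<in> borel_measurable M"
  shows "(\<integral>\<^sup>+x. (R j u x - ennreal (d j) * ennreal r) \<partial>M) \<le> ennreal (d j) * (\<integral>\<^sup>+x. (u x - ennreal r) \<partial>M)"
proof -
  have "(\<integral>\<^sup>+x. (R j u x - ennreal (d j) * ennreal r) \<partial>M) \<le> (\<integral>\<^sup>+x. R j (\<lambda>x. u x - ennreal r) x \<partial>M)"
  proof (rule nn_integral_mono_AE)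
    show "AE x in M. R j u x - ennreal (d j) * ennreal r \<le> R j (\<lambda>x. u x - ennreal r) x"
      using R_split[of j u "ennreal r"]
      by eventually_elim (auto simp: ennreal_minus_le_iff ennreal_mult_eq_top_iff)
  qed
  also have "\<dots> \<le> ennreal (d j) * (\<integral>\<^sup>+x. (u x - ennreal r) \<partial>M)"
    by (rule R_integral_le) measurable
  finally show ?thesis .
qed

lemma R_0_split: "R 0 u x = R j u x + (\<Sum>i<j. (Q ^^ i) u x)"
  unfolding R_def using suminf_offset[of "\<lambda>i. (Q ^^ i) u x" j] by (simp add: add.commute)

end

section \<open>Estimates of the tails in the functional\<close>

locale weighted_composition_quasiconcave = weighted_composition M I f W \<alpha> + quasiconcave \<Phi>
  for M :: "'a measure" and I f W \<alpha> and \<Phi> :: "ennreal \<Rightarrow> ennreal"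
begin

text \<open>Here \<open>R 0 u = u + R 1 u\<close>, so only the second summand is charged the factor 2 lost by the lack of
  concavity of \<open>\<Phi>\<close>; this is needed for the case \<open>j = 0\<close> of the final estimate.\<close>

lemma qnorm_R_0_le:
  assumes u[measurable]: "u \<in> borel_measurable M"
  shows "qnorm \<Phi> M (R 0 u) \<le> ennreal ((1 + \<alpha>) / (1 - \<alpha>)) * qnorm \<Phi> M u"
proof -
  \<comment> \<open>Since 1/(1 - \<alpha>) = 1 + \<delta>, the factor \<open>b\<close> normalizes
    \<open>R 0 u\<close> to be majorized by \<open>u\<close>; the last identity is the constant that
    results from the argument below.\<close>
  define b where "b = 1 - \<alpha>"
  define \<delta> where "\<delta> = d 1"
  have b: "b > 0" "0 \<le> \<delta>" "b * (1 + \<delta>) = 1" "b * (1 + \<delta> + \<delta>) = 1 + \<alpha>"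
    using \<alpha> by (auto simp: b_def \<delta>_def d_def field_simps)
  have eb: "ennreal b + ennreal b * ennreal \<delta> = 1"
    using b by (simp add: ennreal_mult[symmetric] ennreal_plus[symmetric] distrib_left del: ennreal_plus)
  \<comment> \<open>The maximum enforces \<open>u \<le> z\<close>, as the majorization lemma
    requires.\<close>
  define z where "z x = max (u x) (ennreal b * R 0 u x)" for x
  have zm[measurable]: "z \<in> borel_measurable M" unfolding z_def by measurable
  have R01: "R 0 u x = u x + R 1 u x" for x using R_0_split[of u x 1] by (simp add: add.commute)
  have "ennreal b * qnorm \<Phi> M (R 0 u) = qnorm \<Phi> M (\<lambda>x. ennreal b * R 0 u x)"
    using b by (intro qnorm_cmult[symmetric]) auto
  also have "\<dots> \<le> qnorm \<Phi> M z" by (intro qnorm_mono) (auto simp: z_def)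
  also have "\<dots> \<le> ennreal (1 + \<alpha>) * qnorm \<Phi> M u"
  proof (rule qnorm_le_of_majorization[OF sigma_finite_measure_axioms u zm])
    show "u x \<le> z x" for x by (simp add: z_def)
    show "ennreal (1 + \<alpha>) \<noteq> 0" using \<alpha> by (simp add: ennreal_eq_0_iff)
    fix r :: real assume r: "r \<ge> 0"
    let ?p = "\<lambda>x. u x - ennreal r"
    let ?q = "\<lambda>x. R 1 u x - ennreal \<delta> * ennreal r"
    have "(\<integral>\<^sup>+x. (z x - ennreal r) \<partial>M) \<le> (\<integral>\<^sup>+x. ennreal b * (?p x + ?q x + ennreal \<delta> * ?p x) \<partial>M)"
    proof (rule nn_integral_mono)
      fix x
      let ?X = "?p x + ?q x + ennreal \<delta> * ?p x"
      have "u x \<le> ennreal r + ?p x" by (rule ennreal_le_add_diff)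
      \<comment> \<open>Splitting 1 into \<open>b + b * \<delta>\<close> gives the bounds for
        \<open>u\<close> and for \<open>b * R 0 u\<close> the common part \<open>b * ?p x\<close>.
        The maximum then costs only one additional term with weight
        \<open>b * \<delta>\<close>.\<close>
      also have "?p x = (ennreal b + ennreal b * ennreal \<delta>) * ?p x" by (simp add: eb)
      also have "\<dots> = ennreal b * (?p x + ennreal \<delta> * ?p x)" by (simp add: algebra_simps)
      also have "\<dots> \<le> ennreal b * ?X" by (intro mult_left_mono) (auto intro: add_right_mono add_increasing2)
      finally have 1: "u x \<le> ennreal r + ennreal b * ?X" by (simp add: add_left_mono)
      have "ennreal b * R 0 u x \<le> ennreal b * ((ennreal r + ?p x) + (ennreal \<delta> * ennreal r + ?q x))"
        unfolding R01 by (intro mult_left_mono add_mono ennreal_le_add_diff) auto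
      also have "\<dots> = (ennreal b + ennreal b * ennreal \<delta>) * ennreal r + ennreal b * (?p x + ?q x)"
        by (simp add: algebra_simps)
      also have "\<dots> \<le> ennreal r + ennreal b * ?X"
        unfolding eb by (rule add_mono[OF _ mult_left_mono]) auto
      finally have 2: "ennreal b * R 0 u x \<le> ennreal r + ennreal b * ?X" .
      show "z x - ennreal r \<le> ennreal b * ?X"
        using 1 2 by (simp add: z_def ennreal_minus_le_iff)
    qed
    also have "\<dots> = ennreal b * ((\<integral>\<^sup>+x. ?p x \<partial>M) + (\<integral>\<^sup>+x. ?q x \<partial>M) + ennreal \<delta> * (\<integral>\<^sup>+x. ?p x \<partial>M))"
      by (simp add: nn_integral_cmult nn_integral_add)
    also have "\<dots> \<le> ennreal b * ((\<integral>\<^sup>+x. ?p x \<partial>M) + ennreal \<delta> * (\<integral>\<^sup>+x. ?p x \<partial>M) + ennreal \<delta> * (\<integral>\<^sup>+x. ?p x \<partial>M))"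
      using R_majorized[OF u, of 1 r] unfolding \<delta>_def by (intro mult_left_mono add_mono) auto
    also have "\<dots> = ennreal b * (1 + ennreal \<delta> + ennreal \<delta>) * (\<integral>\<^sup>+x. ?p x \<partial>M)"
      by (simp add: algebra_simps)
    also have "ennreal b * (1 + ennreal \<delta> + ennreal \<delta>) = ennreal (b * (1 + \<delta> + \<delta>))"
    proof -
      have "ennreal (1 + \<delta> + \<delta>) = ennreal (1 + \<delta>) + ennreal \<delta>" using b(2) by (intro ennreal_plus) auto
      also have "ennreal (1 + \<delta>) = ennreal 1 + ennreal \<delta>" using b(2) by (intro ennreal_plus) auto
      finally show ?thesis using b(1,2) by (simp only: ennreal_mult'' ennreal_1)
    qed
    finally show "(\<integral>\<^sup>+x. (z x - ennreal r) \<partial>M) \<le> ennreal (1 + \<alpha>) * (\<integral>\<^sup>+x. ?p x \<partial>M)"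
      using b(4) by simp
  qed
  finally have le: "ennreal b * qnorm \<Phi> M (R 0 u) \<le> ennreal (1 + \<alpha>) * qnorm \<Phi> M u" .
  have "qnorm \<Phi> M (R 0 u) = ennreal (1 / b) * (ennreal b * qnorm \<Phi> M (R 0 u))"
    using b by (simp add: mult.assoc[symmetric] ennreal_mult[symmetric])
  also have "\<dots> \<le> ennreal (1 / b) * (ennreal (1 + \<alpha>) * qnorm \<Phi> M u)" by (intro mult_left_mono le) simp
  also have "\<dots> = ennreal ((1 + \<alpha>) / (1 - \<alpha>)) * qnorm \<Phi> M u"
  proof -
    have "ennreal (1 / b) * ennreal (1 + \<alpha>) = ennreal (1 / b * (1 + \<alpha>))"
      using b(1) \<alpha> by (intro ennreal_mult[symmetric]) auto
    then show ?thesis by (simp add: mult.assoc[symmetric] b_def)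
  qed
  finally show ?thesis .
qed

text \<open>Divided by \<open>d j\<close>, which is positive as \<alpha> > 0, the tail is majorized
  by \<open>u\<close>. Taking the maximum with \<open>u\<close> adds a second copy of the excess of
  \<open>u\<close>, hence the factor 2.\<close>

lemma qnorm_R_le_double:
  assumes u[measurable]: "u \<in> borel_measurable M" and "\<alpha> > 0"
  shows "qnorm \<Phi> M (R j u) \<le> ennreal (2 * d j) * qnorm \<Phi> M u"
proof -
  have d: "d j > 0" using \<alpha> \<open>\<alpha> > 0\<close> by (simp add: d_def)
  define e where "e = 1 / d j"
  have e: "e > 0" "ennreal e * ennreal (d j) = 1" using d by (auto simp: e_def ennreal_mult[symmetric])
  define z where "z x = max (u x) (ennreal e * R j u x)" for x
  have zm[measurable]: "z \<in> borel_measurable M" unfolding z_def by measurable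
  have "ennreal e * qnorm \<Phi> M (R j u) = qnorm \<Phi> M (\<lambda>x. ennreal e * R j u x)"
    using e by (intro qnorm_cmult[symmetric]) auto
  also have "\<dots> \<le> qnorm \<Phi> M z" by (intro qnorm_mono) (auto simp: z_def)
  also have "\<dots> \<le> 2 * qnorm \<Phi> M u"
  proof (rule qnorm_le_of_majorization[OF sigma_finite_measure_axioms u zm])
    show "u x \<le> z x" for x by (simp add: z_def)
    fix r :: real assume r: "r \<ge> 0"
    let ?p = "\<lambda>x. u x - ennreal r"
    let ?q = "\<lambda>x. R j u x - ennreal (d j) * ennreal r"
    have "(\<integral>\<^sup>+x. (z x - ennreal r) \<partial>M) \<le> (\<integral>\<^sup>+x. ?p x + ennreal e * ?q x \<partial>M)"
    proof (rule nn_integral_mono)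
      fix x
      have "u x \<le> ennreal r + ?p x" by (rule ennreal_le_add_diff)
      also have "\<dots> \<le> ennreal r + (?p x + ennreal e * ?q x)" by (intro add_left_mono) simp
      finally have 1: "u x \<le> ennreal r + (?p x + ennreal e * ?q x)" .
      have "ennreal e * R j u x \<le> ennreal e * (ennreal (d j) * ennreal r + ?q x)"
        by (intro mult_left_mono ennreal_le_add_diff) auto
      also have "\<dots> = ennreal e * ennreal (d j) * ennreal r + ennreal e * ?q x"
        by (simp add: algebra_simps)
      also have "\<dots> \<le> ennreal r + (?p x + ennreal e * ?q x)"
        unfolding e(2) by (intro add_mono) auto
      finally show "z x - ennreal r \<le> ?p x + ennreal e * ?q x"
        using 1 by (simp add: z_def ennreal_minus_le_iff)
    qed
    also have "\<dots> = (\<integral>\<^sup>+x. ?p x \<partial>M) + ennreal e * (\<integral>\<^sup>+x. ?q x \<partial>M)"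
      by (simp add: nn_integral_cmult nn_integral_add)
    also have "\<dots> \<le> (\<integral>\<^sup>+x. ?p x \<partial>M) + ennreal e * (ennreal (d j) * (\<integral>\<^sup>+x. ?p x \<partial>M))"
      by (intro add_left_mono mult_left_mono R_majorized u) auto
    also have "\<dots> = 2 * (\<integral>\<^sup>+x. ?p x \<partial>M)"
      by (simp only: mult.assoc[symmetric] e(2)) (simp add: mult_2)
    finally show "(\<integral>\<^sup>+x. (z x - ennreal r) \<partial>M) \<le> 2 * (\<integral>\<^sup>+x. ?p x \<partial>M)" .
  qed simp
  finally have le: "ennreal e * qnorm \<Phi> M (R j u) \<le> 2 * qnorm \<Phi> M u" .
  have "qnorm \<Phi> M (R j u) = ennreal (d j) * (ennreal e * qnorm \<Phi> M (R j u))"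
    by (simp only: mult.assoc[symmetric] mult.commute[of "ennreal (d j)"] e(2) mult_1)
  also have "\<dots> \<le> ennreal (d j) * (2 * qnorm \<Phi> M u)" by (intro mult_left_mono le) simp
  also have "\<dots> = ennreal (2 * d j) * qnorm \<Phi> M u"
    using d by (simp add: ennreal_mult mult_ac)
  finally show ?thesis .
qed

text \<open>For j \<ge> 1 and \<alpha> > 0 use 2 \<alpha>^j \<le> (2 \<alpha>)^j and 1 - 2 \<alpha>
  \<le> 1 - \<alpha>. For j = 0 the sharper bound suffices because (1 + \<alpha>)(1 - 2 \<alpha>)
  \<le> 1 - \<alpha>. For \<alpha> = 0 and j \<ge> 1 the tail vanishes almost everywhere.\<close>

lemma qnorm_R_le:
  assumes u[measurable]: "u \<in> borel_measurable M" and half: "\<alpha> < 1/2"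
  shows "qnorm \<Phi> M (R j u) \<le> ennreal ((2 * \<alpha>) ^ j / (1 - 2 * \<alpha>)) * qnorm \<Phi> M u"
proof -
  consider "j = 0" | "j > 0" "\<alpha> = 0" | "j > 0" "\<alpha> > 0" using \<alpha> by fastforce
  then show ?thesis
  proof cases
    case 1
    have "(1 + \<alpha>) / (1 - \<alpha>) \<le> 1 / (1 - 2 * \<alpha>)"
      using half \<alpha> by (simp add: field_simps)
    then have "ennreal ((1 + \<alpha>) / (1 - \<alpha>)) * qnorm \<Phi> M u \<le> ennreal (1 / (1 - 2 * \<alpha>)) * qnorm \<Phi> M u"
      by (intro mult_right_mono ennreal_leI) auto
    then show ?thesis using qnorm_R_0_le[OF u] 1 by simp
  next
    case 2
    have "AE x in M. R j u x = 0"
      using W_sup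
    proof eventually_elim
      case (elim x)
      then have "(\<Sum>n\<in>I. W n x) = 0" using 2 by simp
      then have "W n x = 0" if "n \<in> I" for n using finI that by (simp add: sum_eq_0_iff)
      then have "Q v x = 0" for v by (simp add: Q_def)
      moreover have "(Q ^^ (j + i)) u x = Q ((Q ^^ (j + i - 1)) u) x" for i
        using 2 by (cases "j + i") auto
      ultimately show "R j u x = 0" by (simp add: R_def)
    qed
    then have "emeasure M {x \<in> space M. ennreal s < R j u x} = 0" for s
      by (intro emeasure_eq_0_AE) (auto elim: eventually_mono)
    then have "qnorm \<Phi> M (R j u) = 0" by (simp add: qnorm_def)
    then show ?thesis by simp
  next
    case 3
    have "2 * \<alpha> ^ j \<le> (2 * \<alpha>) ^ j"
    proof -
      have "(2::real) ^ 1 \<le> 2 ^ j" using 3 by (intro power_increasing) auto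
      then show ?thesis using \<alpha> by (simp add: power_mult_distrib mult_right_mono)
    qed
    then have "2 * d j \<le> (2 * \<alpha>) ^ j / (1 - 2 * \<alpha>)"
      unfolding d_def using half \<alpha> by (auto intro: frac_le)
    then have "ennreal (2 * d j) * qnorm \<Phi> M u \<le> ennreal ((2 * \<alpha>) ^ j / (1 - 2 * \<alpha>)) * qnorm \<Phi> M u"
      by (intro mult_right_mono ennreal_leI) auto
    then show ?thesis using qnorm_R_le_double[OF u 3(2)] by (rule order_trans[rotated])
  qed
qed

text \<open>The excess of \<open>u\<close> over level 1 is integrable, so its tail series is finite
  almost everywhere; the rest of \<open>u\<close> contributes at most \<open>d j\<close>.\<close>

lemma R_finite_AE:
  assumes u[measurable]: "u \<in> borel_measurable M" and fin: "qnorm \<Phi> M u < top"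
  shows "AE x in M. R j u x < top"
proof -
  have "(\<integral>\<^sup>+x. R j (\<lambda>x. u x - ennreal 1) x \<partial>M) \<le> ennreal (d j) * (\<integral>\<^sup>+x. (u x - ennreal 1) \<partial>M)"
    by (rule R_integral_le) measurable
  also have "\<dots> < top"
    using tail_integral_finite[OF sigma_finite_measure_axioms u fin, of 1]
    by (simp add: ennreal_mult_less_top)
  finally have "AE x in M. R j (\<lambda>x. u x - ennreal 1) x \<noteq> top"
    using nn_integral_PInf_AE[of "R j (\<lambda>x. u x - ennreal 1)" M] by simp
  then show ?thesis
    using R_split[of j u "ennreal 1"]
  proof eventually_elim
    case (elim x)
    note elim(2)
    also have "ennreal (d j) * ennreal 1 + R j (\<lambda>x. u x - ennreal 1) x < top"
      using elim(1) by (simp add: less_top[symmetric] ennreal_mult_less_top)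
    finally show ?case .
  qed
qed

end

section \<open>Uniqueness through subinvariant functions\<close>

context weighted_composition
begin

text \<open>Meant for the norm of the difference of two solutions. As \<open>Q\<close> sends the
  constant r below r, the integral of (v - r)^+ is at most \<alpha> times itself; being finite, it
  is 0 for every r > 0.\<close>

lemma Q_subinvariant_AE_zero:
  assumes v[measurable]: "v \<in> borel_measurable M" and sub: "AE x in M. v x \<le> Q v x"
    and fin: "\<And>r. r > 0 \<Longrightarrow> (\<integral>\<^sup>+x. (v x - ennreal r) \<partial>M) < top"
  shows "AE x in M. v x = 0"
proof -
  have G0: "(\<integral>\<^sup>+x. (v x - ennreal r) \<partial>M) = 0" if r: "r > 0" for r
  proof -
    let ?G = "\<integral>\<^sup>+x. (v x - ennreal r) \<partial>M"
    have "?G \<le> (\<integral>\<^sup>+x. Q (\<lambda>x. v x - ennreal r) x \<partial>M)"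
    proof (rule nn_integral_mono_AE)
      show "AE x in M. v x - ennreal r \<le> Q (\<lambda>x. v x - ennreal r) x"
        using sub Qpow_split[of 1 v "ennreal r"]
      proof eventually_elim
        case (elim x)
        have "v x \<le> ennreal \<alpha> * ennreal r + Q (\<lambda>x. v x - ennreal r) x"
          using elim by (auto intro: order_trans)
        also have "\<dots> \<le> ennreal r + Q (\<lambda>x. v x - ennreal r) x"
          using \<alpha> r by (intro add_right_mono) (simp add: ennreal_mult[symmetric] mult_left_le_one_le)
        finally show ?case by (simp add: ennreal_minus_le_iff)
      qed
    qed
    also have "\<dots> \<le> ennreal \<alpha> * ?G"
      using Qpow_integral_le[of "\<lambda>x. v x - ennreal r" 1] by simp
    finally have le: "?G \<le> ennreal \<alpha> * ?G" .
    obtain k where k: "k \<ge> 0" "?G = ennreal k" using fin[OF r] by (cases ?G) auto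
    then have "k \<le> \<alpha> * k" using le \<alpha> by (simp add: ennreal_mult[symmetric])
    then have "k * (1 - \<alpha>) \<le> 0" by (simp add: algebra_simps)
    then have "k = 0" using \<alpha> k(1) by (simp add: mult_le_0_iff)
    then show ?thesis using k by simp
  qed
  have "AE x in M. \<forall>m. v x - ennreal (1 / real (Suc m)) = 0"
    unfolding AE_all_countable using G0 by (auto simp: nn_integral_0_iff_AE)
  then show ?thesis
  proof eventually_elim
    case (elim x)
    have "v x \<le> ennreal (1 / real (Suc m))" for m
      using elim[rule_format, of m] by (simp add: diff_eq_0_iff_ennreal)
    then have small: "v x \<le> 0 + ennreal e" if "e > 0" for e
    proof -
      obtain m where m: "1 / real (Suc m) < e" by (rule nat_approx_posE[OF \<open>e > 0\<close>])
      have "v x \<le> ennreal (1 / real (Suc m))" by fact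
      also have "\<dots> \<le> ennreal e" using m by (intro ennreal_leI) simp
      finally show ?thesis by simp
    qed
    have "v x \<le> 0" by (rule ennreal_le_epsilon) (rule small)
    then show "v x = 0" by simp
  qed
qed

end

section \<open>Measurability and the elementary solution\<close>

text \<open>The value spaces are only assumed separable through \<^const>\<open>separable_space\<close>, not through the class
  of second countable spaces, so that the library rules for sums and products do not apply.\<close>

lemma borel_measurable_caratheodory:
  fixes v :: "'a \<Rightarrow> 'v::metric_space" and g :: "'a \<Rightarrow> 'k::topological_space"
    and H :: "'k \<Rightarrow> 'v \<Rightarrow> 'c::metric_space"
  assumes sep: "separable_space TYPE('v)"
    and g: "g \<in> borel_measurable M" and v: "v \<in> borel_measurable M"
    and H1: "\<And>y. continuous_on UNIV (\<lambda>c. H c y)" and H2: "\<And>c. continuous_on UNIV (H c)"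
  shows "(\<lambda>x. H (g x) (v x)) \<in> borel_measurable M"
proof -
  obtain D :: "'v set" where D: "countable D" "closure D = UNIV"
    using sep unfolding separable_space_def by blast
  have Dne: "D \<noteq> {}" using D(2) by auto
  define e where "e = from_nat_into D"
  have range: "range e = D" unfolding e_def using Dne D(1) by (rule range_from_nat_into)
  \<comment> \<open>\<open>e (idx m x)\<close> takes countably many values and is within 1/(m + 1)
    of \<open>v x\<close>. The composites with these approximations are measurable, and continuity
    of \<open>H\<close> in its second argument passes to the limit.\<close>
  define idx where "idx m x = (LEAST i. dist (v x) (e i) < 1 / real (Suc m))" for m x
  have idx: "dist (v x) (e (idx m x)) < 1 / real (Suc m)" for m x
  proof -
    have "v x \<in> closure D" using D(2) by simp
    then obtain y where y: "y \<in> D" "dist y (v x) < 1 / real (Suc m)"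
      unfolding closure_approachable by (meson of_nat_0_less_iff zero_less_Suc zero_less_divide_1_iff)
    then obtain i where "y = e i" using range by auto
    then have "dist (v x) (e i) < 1 / real (Suc m)" using y by (simp add: dist_commute)
    then show ?thesis unfolding idx_def by (rule LeastI)
  qed
  have idxm: "idx m \<in> measurable M (count_space UNIV)" for m
    unfolding idx_def
  proof (rule measurable_Least)
    fix i
    have "v -` ball (e i) (1 / real (Suc m)) \<inter> space M \<in> sets M"
      using v by (rule measurable_sets) simp
    moreover have "v -` ball (e i) (1 / real (Suc m)) \<inter> space M = {x \<in> space M. dist (v x) (e i) < 1 / real (Suc m)}"
      by (auto simp: dist_commute)
    ultimately show "Measurable.pred M (\<lambda>x. dist (v x) (e i) < 1 / real (Suc m))"
      by (simp add: pred_def)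
  qed
  show ?thesis
  proof (rule borel_measurable_LIMSEQ_metric)
    show "(\<lambda>x. H (g x) (e (idx m x))) \<in> borel_measurable M" for m
    proof (rule measurable_compose_countable[OF _ idxm])
      show "(\<lambda>x. H (g x) (e i)) \<in> borel_measurable M" for i
        using measurable_compose[OF g borel_measurable_continuous_onI[OF H1]] .
    qed
    fix x
    have "(\<lambda>m. e (idx m x)) \<longlonglongrightarrow> v x"
    proof (rule metric_LIMSEQ_I)
      fix r :: real assume "r > 0"
      then obtain n where n: "1 / real (Suc n) < r" by (rule nat_approx_posE)
      have "dist (e (idx m x)) (v x) < r" if "m \<ge> n" for m
      proof -
        have "dist (e (idx m x)) (v x) < 1 / real (Suc m)" using idx[of x m] by (simp add: dist_commute)
        also have "\<dots> \<le> 1 / real (Suc n)" using that by (simp add: frac_le)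
        finally show ?thesis using n by simp
      qed
      then show "\<exists>n. \<forall>m\<ge>n. dist (e (idx m x)) (v x) < r" by blast
    qed
    moreover have "isCont (H (g x)) (v x)" using H2 by (simp add: continuous_on_eq_continuous_at)
    ultimately show "(\<lambda>m. H (g x) (e (idx m x))) \<longlonglongrightarrow> H (g x) (v x)"
      by (rule isCont_tendsto_compose[rotated])
  qed
qed

lemma borel_measurable_norm_normed:
  fixes v :: "'a \<Rightarrow> 'v::real_normed_vector"
  assumes "v \<in> borel_measurable M"
  shows "(\<lambda>x. norm (v x)) \<in> borel_measurable M"
  using assms by (rule measurable_compose) (intro borel_measurable_continuous_onI continuous_intros)

lemma borel_measurable_add_separable:
  fixes v w :: "'a \<Rightarrow> 'v::real_normed_vector"
  assumes "separable_space TYPE('v)" "v \<in> borel_measurable M" "w \<in> borel_measurable M"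
  shows "(\<lambda>x. v x + w x) \<in> borel_measurable M"
  by (rule borel_measurable_caratheodory[OF assms, of "(+)"]) (intro continuous_intros)+

lemma borel_measurable_diff_separable:
  fixes v w :: "'a \<Rightarrow> 'v::real_normed_vector"
  assumes "separable_space TYPE('v)" "v \<in> borel_measurable M" "w \<in> borel_measurable M"
  shows "(\<lambda>x. v x - w x) \<in> borel_measurable M"
  by (rule borel_measurable_caratheodory[OF assms, of "(-)"]) (intro continuous_intros)+

lemma borel_measurable_sum_separable:
  fixes v :: "'i \<Rightarrow> 'a \<Rightarrow> 'v::real_normed_vector"
  assumes "separable_space TYPE('v)" "\<And>i. i \<in> S \<Longrightarrow> v i \<in> borel_measurable M"
  shows "(\<lambda>x. \<Sum>i\<in>S. v i x) \<in> borel_measurable M"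
  using assms(2)
proof (induction S rule: infinite_finite_induct)
  case (insert i S)
  then have "(\<lambda>x. v i x + (\<Sum>i\<in>S. v i x)) \<in> borel_measurable M"
    by (intro borel_measurable_add_separable[OF assms(1)]) auto
  then show ?case using insert by simp
qed simp_all

section \<open>From hypothesis (H) to the abstract operator\<close>

text \<open>A Lebesgue set is a Borel set up to a null set: measurability of \<open>f\<close> treats
  the Borel part and \<open>null\<close> the remainder.\<close>

lemma measurable_lebesgue_on_self:
  fixes f :: "'a::euclidean_space \<Rightarrow> 'a"
  assumes \<Omega>: "\<Omega> \<in> sets lebesgue" and f: "f \<in> borel_measurable (lebesgue_on \<Omega>)" and im: "f ` \<Omega> \<subseteq> \<Omega>"
    and null: "\<And>B. B \<in> null_sets lebesgue \<Longrightarrow> f -` B \<inter> \<Omega> \<in> null_sets lebesgue"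
  shows "f \<in> measurable (lebesgue_on \<Omega>) (lebesgue_on \<Omega>)"
proof (rule measurableI)
  show "f x \<in> space (lebesgue_on \<Omega>)" if "x \<in> space (lebesgue_on \<Omega>)" for x using that im by auto
  fix B assume "B \<in> sets (lebesgue_on \<Omega>)"
  then have B: "B \<in> sets lebesgue" "B \<subseteq> \<Omega>" using \<Omega> by (auto simp: sets_restrict_space_iff)
  have "\<forall>U. negligible U \<and> U \<subseteq> \<Omega> \<longrightarrow> {x \<in> \<Omega>. f x \<in> U} \<in> sets lebesgue"
  proof (intro allI impI)
    fix U assume "negligible U \<and> U \<subseteq> \<Omega>"
    then have "f -` U \<inter> \<Omega> \<in> null_sets lebesgue" by (intro null) (simp add: negligible_iff_null_sets)
    moreover have "f -` U \<inter> \<Omega> = {x \<in> \<Omega>. f x \<in> U}" by auto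
    ultimately show "{x \<in> \<Omega>. f x \<in> U} \<in> sets lebesgue" by auto
  qed
  then have "{x \<in> \<Omega>. f x \<in> B} \<in> sets lebesgue"
    using double_lebesgue_sets[OF \<Omega> \<Omega> im] f B by blast
  moreover have "f -` B \<inter> space (lebesgue_on \<Omega>) = {x \<in> \<Omega>. f x \<in> B}" by auto
  ultimately show "f -` B \<inter> space (lebesgue_on \<Omega>) \<in> sets (lebesgue_on \<Omega>)"
    using \<Omega> by (auto simp: sets_restrict_space_iff)
qed

lemma sigma_finite_lebesgue_on:
  assumes "\<Omega> \<in> sets lebesgue"
  shows "sigma_finite_measure (lebesgue_on \<Omega> :: 'a::euclidean_space measure)"
proof (rule sigma_finite_measure_restrict_space[OF _ assms])
  show "sigma_finite_measure (lebesgue :: 'a measure)"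
  proof
    let ?A = "range (\<lambda>n::nat. ball 0 (real n) :: 'a set)"
    have "emeasure lebesgue (ball (0::'a) r) < \<infinity>" for r
      using emeasure_lborel_ball_finite[of "0::'a" r] by simp
    then have "\<forall>a\<in>?A. emeasure lebesgue a \<noteq> \<infinity>" by (auto simp: less_top[symmetric])
    moreover have "\<Union>?A = space lebesgue"
      using reals_Archimedean2 by auto
    ultimately show "\<exists>A::'a set set. countable A \<and> A \<subseteq> sets lebesgue \<and> \<Union>A = space lebesgue \<and> (\<forall>a\<in>A. emeasure lebesgue a \<noteq> \<infinity>)"
      by (intro exI[of _ ?A]) auto
  qed
qed

text \<open>By maximality every intersection of more than \<open>L\<close> ranges is null, and there
  are only finitely many such intersections.\<close>

lemma AE_card_images_le_constL:
  fixes f :: "nat \<Rightarrow> real^'n \<Rightarrow> real^'n"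
  assumes \<Omega>: "\<Omega> \<in> sets lebesgue" and T: "\<And>n. n \<in> {1..N} \<Longrightarrow> T n \<subseteq> f n ` \<Omega>"
    and L: "constL N \<Omega> f \<ge> 1"
  shows "AE y in lebesgue_on \<Omega>. (\<Sum>n\<in>{1..N}. indicator (T n) y) \<le> (of_nat (constL N \<Omega> f) :: ennreal)"
proof -
  let ?L = "constL N \<Omega> f"
  let ?A = "\<lambda>S. \<Inter>n\<in>S. f n ` \<Omega>"
  have null: "?A S \<in> null_sets lebesgue" if S: "S \<subseteq> {1..N}" "card S > ?L" for S
  proof (rule ccontr)
    assume "?A S \<notin> null_sets lebesgue"
    moreover have "card S \<le> N" using card_mono[OF _ S(1)] by simp
    \<comment> \<open>\<open>L\<close> guarantees that \<open>card S\<close>, which exceeds the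
      constant, is at least 1 and so is among the numbers whose maximum is taken.\<close>
    ultimately have "card S \<le> ?L"
      unfolding constL_def using S L by (intro Max_ge) (auto intro: finite_subset[of _ "{..N}"])
    then show False using S by simp
  qed
  have "AE y in lebesgue. \<forall>S\<in>{S \<in> Pow {1..N}. card S > ?L}. y \<notin> ?A S"
    by (intro AE_finite_allI AE_not_in null) auto
  then have "AE y in lebesgue_on \<Omega>. \<forall>S\<in>{S \<in> Pow {1..N}. card S > ?L}. y \<notin> ?A S"
    using \<Omega> by (subst AE_restrict_space_iff) (auto elim: eventually_mono)
  then show ?thesis
  proof eventually_elim
    case (elim y)
    define S where "S = {n \<in> {1..N}. y \<in> T n}"
    have "y \<in> ?A S" using T by (auto simp: S_def)
    then have "S \<notin> {S \<in> Pow {1..N}. card S > ?L}" using elim by blast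
    moreover have "S \<in> Pow {1..N}" by (auto simp: S_def)
    ultimately have "card S \<le> ?L" by (simp only: mem_Collect_eq not_less) simp
    moreover have "(\<Sum>n\<in>{1..N}. indicator (T n) y :: ennreal) = of_nat (card S)"
    proof -
      have "(\<Sum>n\<in>{1..N}. indicator (T n) y :: ennreal) = (\<Sum>n\<in>{1..N}. if y \<in> T n then 1 else 0)"
        by (intro sum.cong) (auto simp: indicator_def)
      also have "\<dots> = of_nat (card S)" by (simp add: sum.If_cases S_def Int_def)
      finally show ?thesis .
    qed
    ultimately show ?case by (simp add: of_nat_mono)
  qed
qed

lemma Lpsi1_enorm_eq_qnorm:
  fixes h :: "real^'n \<Rightarrow> 'v::real_normed_vector"
  assumes "\<Omega> \<in> sets lebesgue"
  shows "Lpsi1_enorm \<psi> \<Omega> (\<lambda>x. norm (h x)) = qnorm (tau_inv \<psi>) (lebesgue_on \<Omega>) (\<lambda>x. ennreal (norm (h x)))"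
  unfolding Lpsi1_enorm_def qnorm_def
proof (rule nn_integral_cong)
  fix s :: real
  show "tau_inv \<psi> (distrib_fun \<Omega> (\<lambda>x. norm (h x)) s) * indicator {0..} s =
      tau_inv \<psi> (emeasure (lebesgue_on \<Omega>) {x \<in> space (lebesgue_on \<Omega>). ennreal s < ennreal (norm (h x))}) * indicator {0..} s"
  proof (cases "s \<ge> 0")
    case True
    have "{x \<in> space (lebesgue_on \<Omega>). ennreal s < ennreal (norm (h x))} = {x \<in> \<Omega>. \<bar>norm (h x)\<bar> > s}"
      using True by (auto simp: ennreal_less_iff)
    moreover have "emeasure (lebesgue_on \<Omega>) {x \<in> \<Omega>. \<bar>norm (h x)\<bar> > s} = emeasure lebesgue {x \<in> \<Omega>. \<bar>norm (h x)\<bar> > s}"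
      using assms by (intro emeasure_restrict_space) auto
    ultimately show ?thesis by (simp add: distrib_fun_def)
  qed simp
qed

text \<open>|h| is at most 1 plus its excess over 1, and the excess is integrable when the
  functional is finite; this gives integrability on compact sets.\<close>

lemma in_Lpsi1_iff:
  fixes h :: "real^'n \<Rightarrow> 'v::real_normed_vector"
  assumes \<Omega>: "\<Omega> \<in> sets lebesgue" and psi: "admissible_psi \<psi>"
  shows "h \<in> Lpsi1 \<psi> \<Omega> \<longleftrightarrow> h \<in> borel_measurable (lebesgue_on \<Omega>) \<and>
    qnorm (tau_inv \<psi>) (lebesgue_on \<Omega>) (\<lambda>x. ennreal (norm (h x))) < top"
proof -
  interpret quasiconcave "tau_inv \<psi>" by (rule quasiconcave_tau_inv[OF psi])
  have "set_integrable lebesgue C (\<lambda>x. norm (h x))"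
    if h: "h \<in> borel_measurable (lebesgue_on \<Omega>)"
      and fin: "qnorm (tau_inv \<psi>) (lebesgue_on \<Omega>) (\<lambda>x. ennreal (norm (h x))) < top"
      and C: "compact C" "C \<subseteq> \<Omega>" for C
  proof -
    have Cm: "C \<in> sets lebesgue" "emeasure lebesgue C < \<infinity>"
      using lmeasurable_compact[OF C(1)] by (auto simp: fmeasurable_def)
    have nh[measurable]: "(\<lambda>x. norm (h x)) \<in> borel_measurable (lebesgue_on \<Omega>)"
      using h by (rule borel_measurable_norm_normed)
    have tail: "(\<integral>\<^sup>+x. (ennreal (norm (h x)) - ennreal 1) \<partial>lebesgue_on \<Omega>) < top"
      by (rule tail_integral_finite[OF sigma_finite_lebesgue_on[OF \<Omega>] _ fin]) auto
    have mC: "(\<lambda>x. norm (h x)) \<in> borel_measurable (lebesgue_on C)"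
      using nh C(2) by (rule measurable_restrict_mono)
    have "(\<integral>\<^sup>+x. ennreal (norm (h x)) \<partial>lebesgue_on C) \<le> (\<integral>\<^sup>+x. 1 + (ennreal (norm (h x)) - ennreal 1) \<partial>lebesgue_on C)"
      using ennreal_le_add_diff[of _ 1] by (intro nn_integral_mono) simp
    also have "\<dots> = emeasure lebesgue C + (\<integral>\<^sup>+x. (ennreal (norm (h x)) - ennreal 1) \<partial>lebesgue_on C)"
      using mC Cm by (subst nn_integral_add) (auto simp: emeasure_restrict_space)
    also have "(\<integral>\<^sup>+x. (ennreal (norm (h x)) - ennreal 1) \<partial>lebesgue_on C)
        \<le> (\<integral>\<^sup>+x. (ennreal (norm (h x)) - ennreal 1) \<partial>lebesgue_on \<Omega>)"
      using Cm(1) \<Omega> C(2)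
      by (auto simp: nn_integral_restrict_space indicator_def intro!: nn_integral_mono)
    finally have "(\<integral>\<^sup>+x. ennreal (norm (h x)) \<partial>lebesgue_on C) < \<infinity>"
      using tail Cm(2) by (auto simp: le_less_trans)
    then have "integrable (lebesgue_on C) (\<lambda>x. norm (h x))"
      using mC by (intro integrableI_bounded) auto
    then show ?thesis
      unfolding set_integrable_def using Cm(1) by (simp add: integrable_restrict_space)
  qed
  then show ?thesis
    unfolding Lpsi1_def by (auto simp: Lpsi1_enorm_eq_qnorm[OF \<Omega>])
qed

text \<open>Removes the distortion factor left by the nearly linear pieces.\<close>

lemma ennreal_le_of_le_mult:
  fixes x y :: ennreal
  assumes "\<And>\<eta>::real. \<eta> > 1 \<Longrightarrow> x \<le> ennreal \<eta> * y"
  shows "x \<le> y"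
proof (cases y)
  case (real r)
  then have x2: "x \<le> ennreal (2 * r)" using assms[of 2] by (simp add: ennreal_mult)
  then obtain t where t: "t \<ge> 0" "x = ennreal t" by (cases x) (auto simp: top_unique)
  have "t \<le> r"
  proof (rule tendsto_lowerbound)
    have "((\<lambda>\<eta>. \<eta> * r) \<longlongrightarrow> 1 * r) (at_right (1::real))" by (intro tendsto_intros)
    then show "((\<lambda>\<eta>. \<eta> * r) \<longlongrightarrow> r) (at_right (1::real))" by simp
    have "t \<le> \<eta> * r" if "\<eta> > 1" for \<eta>
      using assms[OF that] that real t by (simp add: ennreal_mult[symmetric])
    then show "\<forall>\<^sub>F \<eta> in at_right 1. t \<le> \<eta> * r"
      by (auto simp: eventually_at_filter)
  qed simp
  then show ?thesis using real t by simp
qed simp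

text \<open>The bound \<alpha>/N is summed over \<open>N\<close> terms. In the Jacobian bound the
  factor \<open>K\<close> cancels the preimages of a single map and \<open>L\<close> the overlap of
  the ranges of different maps.\<close>

lemma weighted_composition_hypH:
  fixes f :: "nat \<Rightarrow> real^'n \<Rightarrow> real^'n" and g :: "nat \<Rightarrow> real^'n \<Rightarrow> 'k::{real_normed_field,banach}"
    and h0 :: "real^'n \<Rightarrow> 'v::banach"
  assumes N: "N \<ge> 1" and \<Omega>: "open \<Omega>"
    and maps: "\<forall>n\<in>{1..N}. f n ` \<Omega> \<subseteq> \<Omega>" and K: "K \<ge> 1"
    and H: "hypH N \<Omega> f g h0 K" and L: "L = constL N \<Omega> f"
    and \<alpha>: "0 \<le> \<alpha>" "\<alpha> < 1"
    and gbound: "\<forall>n\<in>{1..N}. AE x in lebesgue_on \<Omega>.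
        norm (g n x) \<le> \<alpha> * min (\<bar>approx_jacobian (f n) \<Omega> x\<bar> / (real K * real L)) (1 / real N)"
  shows "weighted_composition (lebesgue_on \<Omega>) {1..N} f (\<lambda>n x. ennreal (norm (g n x))) \<alpha>"
proof -
  let ?M = "lebesgue_on \<Omega>"
  have \<Omega>L: "\<Omega> \<in> sets lebesgue" using \<Omega> by (simp add: borel_open)
  interpret sigma_finite_measure ?M by (rule sigma_finite_lebesgue_on[OF \<Omega>L])
  have Hn: "f n \<in> borel_measurable ?M"
    "\<And>B. B \<in> null_sets lebesgue \<Longrightarrow> f n -` B \<inter> \<Omega> \<in> null_sets lebesgue"
    "{x \<in> \<Omega>. infinite (f n -` {x} \<inter> \<Omega>) \<or> card (f n -` {x} \<inter> \<Omega>) > K} \<in> null_sets lebesgue"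
    "g n \<in> borel_measurable ?M" if "n \<in> {1..N}" for n
    using H that unfolding hypH_def by blast+
  have fM: "f n \<in> measurable ?M ?M" if "n \<in> {1..N}" for n
    using maps that by (intro measurable_lebesgue_on_self[OF \<Omega>L Hn(1)[OF that]] Hn(2)[OF that]) auto
  have gM: "(\<lambda>x. norm (g n x)) \<in> borel_measurable ?M" if "n \<in> {1..N}" for n
    using Hn(4)[OF that] by (rule borel_measurable_norm_normed)
  show ?thesis
  proof
    show "f n \<in> measurable ?M ?M" if "n \<in> {1..N}" for n by (rule fM[OF that])
    show "(\<lambda>x. ennreal (norm (g n x))) \<in> borel_measurable ?M" if "n \<in> {1..N}" for n
      using gM[OF that] by simp
    show "f n -` B \<inter> space ?M \<in> null_sets ?M" if n: "n \<in> {1..N}" and B: "B \<in> null_sets ?M" for n B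
      using Hn(2)[OF n, of B] B \<Omega>L by (auto simp: null_sets_restrict_space)
    have "AE x in ?M. \<forall>n\<in>{1..N}. norm (g n x) \<le> \<alpha> / real N"
    proof (rule AE_finite_allI)
      fix n assume n: "n \<in> {1..N}"
      show "AE x in ?M. norm (g n x) \<le> \<alpha> / real N"
        using gbound[rule_format, OF n]
      proof eventually_elim
        case (elim x)
        also have "\<alpha> * min (\<bar>approx_jacobian (f n) \<Omega> x\<bar> / (real K * real L)) (1 / real N) \<le> \<alpha> * (1 / real N)"
          using \<alpha> by (intro mult_left_mono) auto
        finally show ?case by simp
      qed
    qed simp
    then show "AE x in ?M. (\<Sum>n\<in>{1..N}. ennreal (norm (g n x))) \<le> ennreal \<alpha>"
    proof eventually_elim
      case (elim x)
      have "(\<Sum>n\<in>{1..N}. norm (g n x)) \<le> (\<Sum>n\<in>{1..N}. \<alpha> / real N)"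
        using elim by (intro sum_mono) auto
      also have "\<dots> = \<alpha>" using N by simp
      finally show ?case by (simp add: sum_ennreal ennreal_leI)
    qed
    fix u :: "real^'n \<Rightarrow> ennreal" assume u: "u \<in> borel_measurable ?M"
    show "(\<integral>\<^sup>+x. (\<Sum>n\<in>{1..N}. ennreal (norm (g n x)) * u (f n x)) \<partial>?M) \<le> ennreal \<alpha> * (\<integral>\<^sup>+x. u x \<partial>?M)"
    proof (cases "\<Omega> = {}")
      case True
      then show ?thesis by (simp add: nn_integral_empty)
    next
      case False
      \<comment> \<open>A nonempty open set is not null and is the preimage of the range of
        \<open>f 1\<close>, so this range is not null. For an empty domain the maximum defining
        \<open>L\<close> would run over the empty set, hence the case distinction.\<close>
      have "L \<ge> 1"
      proof -
        have "f 1 ` \<Omega> \<notin> null_sets lebesgue"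
        proof
          assume "f 1 ` \<Omega> \<in> null_sets lebesgue"
          then have "f 1 -` (f 1 ` \<Omega>) \<inter> \<Omega> \<in> null_sets lebesgue" using Hn(2)[of 1] N by simp
          moreover have "f 1 -` (f 1 ` \<Omega>) \<inter> \<Omega> = \<Omega>" by auto
          ultimately have "negligible \<Omega>" by (simp add: negligible_iff_null_sets)
          then show False using open_not_negligible[OF \<Omega> False] by simp
        qed
        then have "1 \<le> constL N \<Omega> f"
          unfolding constL_def using N
          by (intro Max_ge) (auto intro!: exI[of _ "{1}"] intro: finite_subset[of _ "{..N}"])
        then show ?thesis using L by simp
      qed
      define c where "c = \<alpha> / (real K * real L)"
      have c: "c \<ge> 0" using \<alpha> by (simp add: c_def)
      have cKL: "c * real K * real L = \<alpha>" using K \<open>L \<ge> 1\<close> by (simp add: c_def)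
      have gc: "AE x in ?M. norm (g n x) \<le> c * \<bar>approx_jacobian (f n) \<Omega> x\<bar>" if n: "n \<in> {1..N}" for n
        using gbound[rule_format, OF n]
      proof eventually_elim
        case (elim x)
        also have "\<alpha> * min (\<bar>approx_jacobian (f n) \<Omega> x\<bar> / (real K * real L)) (1 / real N)
            \<le> \<alpha> * (\<bar>approx_jacobian (f n) \<Omega> x\<bar> / (real K * real L))"
          using \<alpha> by (intro mult_left_mono) auto
        finally show ?case by (simp add: c_def)
      qed
      show ?thesis
      proof (rule ennreal_le_of_le_mult)
        fix \<eta> :: real assume \<eta>: "\<eta> > 1"
        define B where "B n T \<longleftrightarrow> T \<in> sets lebesgue \<and> T \<subseteq> f n ` \<Omega> \<and> (\<forall>u\<in>borel_measurable ?M.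
           (\<integral>\<^sup>+x. ennreal (norm (g n x)) * u (f n x) \<partial>?M)
             \<le> ennreal (\<eta> * c * real K) * (\<integral>\<^sup>+y. u y * indicator T y \<partial>?M))" for n T
        have "\<exists>T. B n T" if n: "n \<in> {1..N}" for n
          unfolding B_def
          by (rule nn_integral_jacobian_bound[OF \<Omega>L Hn(1)[OF n] fM[OF n] gM[OF n] c gc[OF n] Hn(3)[OF n] \<eta>]) blast
        then have "\<forall>n\<in>{1..N}. \<exists>T. B n T" by blast
        then obtain T where "\<forall>n\<in>{1..N}. B n (T n)" using bchoice by meson
        then have T: "\<And>n. n \<in> {1..N} \<Longrightarrow> T n \<in> sets lebesgue" "\<And>n. n \<in> {1..N} \<Longrightarrow> T n \<subseteq> f n ` \<Omega>"
          "\<And>n u. n \<in> {1..N} \<Longrightarrow> u \<in> borel_measurable ?M \<Longrightarrow> (\<integral>\<^sup>+x. ennreal (norm (g n x)) * u (f n x) \<partial>?M)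
             \<le> ennreal (\<eta> * c * real K) * (\<integral>\<^sup>+y. u y * indicator (T n) y \<partial>?M)"
          unfolding B_def by blast+
        have TM: "T n \<in> sets ?M" if n: "n \<in> {1..N}" for n
        proof -
          have "f n ` \<Omega> \<subseteq> \<Omega>" using maps n by (rule bspec)
          then have "T n \<subseteq> \<Omega>" using T(2)[OF n] by (rule order_trans[rotated])
          then show ?thesis using T(1)[OF n] \<Omega>L by (simp add: sets_restrict_space_iff)
        qed
        have "(\<integral>\<^sup>+x. (\<Sum>n\<in>{1..N}. ennreal (norm (g n x)) * u (f n x)) \<partial>?M)
            = (\<Sum>n\<in>{1..N}. \<integral>\<^sup>+x. ennreal (norm (g n x)) * u (f n x) \<partial>?M)"
          using gM measurable_compose[OF fM u] by (intro nn_integral_sum) simp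
        also have "\<dots> \<le> (\<Sum>n\<in>{1..N}. ennreal (\<eta> * c * real K) * (\<integral>\<^sup>+y. u y * indicator (T n) y \<partial>?M))"
          by (intro sum_mono T(3) u)
        also have "\<dots> = ennreal (\<eta> * c * real K) * (\<integral>\<^sup>+y. u y * (\<Sum>n\<in>{1..N}. indicator (T n) y) \<partial>?M)"
        proof -
          have "(\<integral>\<^sup>+y. u y * (\<Sum>n\<in>{1..N}. indicator (T n) y) \<partial>?M) = (\<Sum>n\<in>{1..N}. \<integral>\<^sup>+y. u y * indicator (T n) y \<partial>?M)"
            unfolding sum_distrib_left using TM u by (intro nn_integral_sum borel_measurable_times_ennreal) auto
          then show ?thesis by (simp only: sum_distrib_left)
        qed
        also have "\<dots> \<le> ennreal (\<eta> * c * real K) * (\<integral>\<^sup>+y. u y * of_nat L \<partial>?M)"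
        proof (intro mult_left_mono nn_integral_mono_AE)
          have "AE y in ?M. (\<Sum>n\<in>{1..N}. indicator (T n) y) \<le> (of_nat L :: ennreal)"
            using AE_card_images_le_constL[OF \<Omega>L T(2), of N] \<open>L \<ge> 1\<close> L by simp
          then show "AE y in ?M. u y * (\<Sum>n\<in>{1..N}. indicator (T n) y) \<le> u y * of_nat L"
            by eventually_elim (rule mult_left_mono, auto)
        qed simp
        also have "\<dots> = ennreal (\<eta> * c * real K) * (of_nat L * (\<integral>\<^sup>+y. u y \<partial>?M))"
          using nn_integral_multc[OF u, of "of_nat L"] by (simp only: mult.commute[of _ "of_nat L"])
        also have "\<dots> = ennreal (\<eta> * (c * real K * real L)) * (\<integral>\<^sup>+y. u y \<partial>?M)"
          using c \<eta> by (simp add: ennreal_mult mult_ac ennreal_of_nat_eq_real_of_nat)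
        also have "\<dots> = ennreal \<eta> * (ennreal \<alpha> * (\<integral>\<^sup>+y. u y \<partial>?M))"
          unfolding cKL using \<eta> \<alpha> by (simp add: ennreal_mult mult.assoc)
        finally show "(\<integral>\<^sup>+x. (\<Sum>n\<in>{1..N}. ennreal (norm (g n x)) * u (f n x)) \<partial>?M)
            \<le> ennreal \<eta> * (ennreal \<alpha> * (\<integral>\<^sup>+y. u y \<partial>?M))" .
      qed
    qed
  qed (use \<alpha> in auto)
qed

text \<open>\<open>smul\<close> is Lipschitz in each argument separately, which together with
  separability gives measurability of the products.\<close>

lemma opP_borel_measurable:
  fixes smul :: "'k::{real_normed_field,banach} \<Rightarrow> 'v::banach \<Rightarrow> 'v"
  assumes V: "K_banach_space smul" "separable_space TYPE('v)"
    and f: "\<And>n. n \<in> {1..N} \<Longrightarrow> f n \<in> measurable M M"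
    and g: "\<And>n. n \<in> {1..N} \<Longrightarrow> g n \<in> borel_measurable M"
    and h: "h \<in> borel_measurable M"
  shows "opP smul N f g h \<in> borel_measurable M"
proof -
  have add: "smul c (v + w) = smul c v + smul c w" "smul (c + e) v = smul c v + smul e v"
    and nrm: "norm (smul c v) = norm c * norm v" for c e v w
    using V(1) unfolding K_banach_space_def by blast+
  have sub: "smul c v - smul c w = smul c (v - w)" for c v w
    using add(1)[of c "v - w" w] by (simp add: algebra_simps)
  have sub': "smul c v - smul e v = smul (c - e) v" for c e v
    using add(2)[of "c - e" e v] by (simp add: algebra_simps)
  have c1: "continuous_on UNIV (\<lambda>c. smul c y)" for y
    by (rule lipschitz_on_continuous_on[of "norm y"])
      (simp add: lipschitz_on_def dist_norm sub' nrm mult.commute)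
  have c2: "continuous_on UNIV (smul c)" for c
    by (rule lipschitz_on_continuous_on[of "norm c"])
      (simp add: lipschitz_on_def dist_norm sub nrm)
  have "(\<lambda>x. \<Sum>n\<in>{1..N}. smul (g n x) (h (f n x))) \<in> borel_measurable M"
  proof (rule borel_measurable_sum_separable[OF V(2)])
    fix n assume n: "n \<in> {1..N}"
    show "(\<lambda>x. smul (g n x) (h (f n x))) \<in> borel_measurable M"
      using borel_measurable_caratheodory[OF V(2) g[OF n] measurable_compose[OF f[OF n] h], of smul] c1 c2 by blast
  qed
  then show ?thesis by (simp add: opP_def[abs_def])
qed

section \<open>Existence, uniqueness and tail estimate of the elementary solution\<close>

theorem theorem4p8:
  fixes N K L :: nat
    and \<Omega> :: "(real^'n) set"
    and smul :: "'k::{real_normed_field,banach} \<Rightarrow> 'v::banach \<Rightarrow> 'v"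
    and f :: "nat \<Rightarrow> real^'n \<Rightarrow> real^'n"
    and g :: "nat \<Rightarrow> real^'n \<Rightarrow> 'k"
    and h0 :: "real^'n \<Rightarrow> 'v"
    and \<psi> :: "real \<Rightarrow> real"
    and \<alpha> :: real
  assumes N: "N \<ge> 1"
    and \<Omega>: "open \<Omega>"
    and V: "K_banach_space smul" "separable_space TYPE('v)"
    and maps: "\<forall>n\<in>{1..N}. f n ` \<Omega> \<subseteq> \<Omega>"
    and K: "K \<ge> 1"
    and H: "hypH N \<Omega> f g h0 K"
    and L: "L = constL N \<Omega> f"
    and psi: "admissible_psi \<psi>"
    and h0: "h0 \<in> Lpsi1 \<psi> \<Omega>"
    and \<alpha>: "0 \<le> \<alpha>" "\<alpha> < 1/2"
    and gbound: "\<forall>n\<in>{1..N}. AE x in lebesgue_on \<Omega>.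
        norm (g n x) \<le> \<alpha> * min (\<bar>approx_jacobian (f n) \<Omega> x\<bar> / (real K * real L)) (1 / real N)"
  shows "(\<forall>i. (opP smul N f g ^^ i) h0 \<in> Lpsi1 \<psi> \<Omega>) \<and>
    (\<exists>\<phi>\<in>Lpsi1 \<psi> \<Omega>.
      ((\<lambda>m. Lpsi1_norm \<psi> \<Omega> (\<lambda>x. \<phi> x - (\<Sum>i<m. (opP smul N f g ^^ i) h0 x))) \<longlonglongrightarrow> 0) \<and>
      solves_eq smul N \<Omega> f g h0 \<phi> \<and>
      (\<forall>\<phi>'\<in>Lpsi1 \<psi> \<Omega>. solves_eq smul N \<Omega> f g h0 \<phi>' \<longrightarrow> (AE x in lebesgue_on \<Omega>. \<phi>' x = \<phi> x)) \<and>
      (\<forall>j::nat. Lpsi1_norm \<psi> \<Omega> (\<lambda>x. \<phi> x - (\<Sum>i<j. (opP smul N f g ^^ i) h0 x))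
          \<le> (2 * \<alpha>) ^ j / (1 - 2 * \<alpha>) * Lpsi1_norm \<psi> \<Omega> h0))"
proof -
  note One_nat_def [simp del]
  let ?M = "lebesgue_on \<Omega>"
  let ?W = "\<lambda>n x. ennreal (norm (g n x))"
  have \<Omega>L: "\<Omega> \<in> sets lebesgue" using \<Omega> by (simp add: borel_open)
  have \<alpha>1: "\<alpha> < 1" and half: "\<alpha> < 1/2" using \<alpha> by simp_all
  have wc: "weighted_composition ?M {1..N} f ?W \<alpha>"
    by (rule weighted_composition_hypH[OF N \<Omega> maps K H L \<alpha>(1) \<alpha>1 gbound])
  interpret weighted_composition_quasiconcave ?M "{1..N}" f ?W \<alpha> "tau_inv \<psi>"
    using wc quasiconcave_tau_inv[OF psi] by (rule weighted_composition_quasiconcave.intro)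
  have gM: "g n \<in> borel_measurable ?M" if "n \<in> {1..N}" for n
    using H that unfolding hypH_def by blast
  have smul_add: "smul c (v + w) = smul c v + smul c w" and smul_norm: "norm (smul c v) = norm c * norm v" for c v w
    using V(1) unfolding K_banach_space_def by blast+
  have smul_0: "smul 0 v = 0" for v using smul_norm[of 0 v] by simp
  have smul_diff: "smul c (v - w) = smul c v - smul c w" for c v w
    using smul_add[of c "v - w" w] by (simp add: algebra_simps)
  have smul_lin: "bounded_linear (smul c)" for c
  proof (rule bounded_linear_intro)
    have "smul c (r *\<^sub>R v) = r *\<^sub>R smul c v" for r v
    proof -
      have mult: "smul (a * b) v = smul a (smul b v)" and real: "smul (of_real r) w = r *\<^sub>R w" for a b w
        using V(1) unfolding K_banach_space_def by blast+
      have "smul c (r *\<^sub>R v) = smul (c * of_real r) v" by (simp add: mult real)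
      also have "c * of_real r = of_real r * c" by (rule mult.commute)
      finally show ?thesis by (simp only: mult[of _ c]) (use V(1) in \<open>auto simp: K_banach_space_def\<close>)
    qed
    then show "smul c (r *\<^sub>R v) = r *\<^sub>R smul c v" for r v .
    show "norm (smul c v) \<le> norm v * norm c" for v by (simp add: smul_norm mult.commute)
  qed (rule smul_add)
  define P where "P = opP smul N f g"
  define u where "u x = ennreal (norm (h0 x))" for x
  have h0M: "h0 \<in> borel_measurable ?M" and u_fin: "qnorm (tau_inv \<psi>) ?M u < top"
    using h0 in_Lpsi1_iff[OF \<Omega>L psi] by (auto simp: u_def[abs_def])
  have uM[measurable]: "u \<in> borel_measurable ?M"
    unfolding u_def using borel_measurable_norm_normed[OF h0M] by simp
  have norm_P: "ennreal (norm (P h x)) \<le> Q (\<lambda>x. ennreal (norm (h x))) x" for h x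
  proof -
    have "norm (P h x) \<le> (\<Sum>n\<in>{1..N}. norm (g n x) * norm (h (f n x)))"
      unfolding P_def opP_def by (rule sum_norm_le) (simp add: smul_norm)
    then have "ennreal (norm (P h x)) \<le> ennreal (\<Sum>n\<in>{1..N}. norm (g n x) * norm (h (f n x)))"
      by (rule ennreal_leI)
    also have "\<dots> = Q (\<lambda>x. ennreal (norm (h x))) x"
      by (simp add: Q_def sum_ennreal[symmetric] ennreal_mult)
    finally show ?thesis .
  qed
  have Q_mono: "Q v x \<le> Q w x" if "\<And>x. v x \<le> w x" for v w x
    unfolding Q_def by (intro sum_mono mult_left_mono that) simp
  have norm_Ppow: "ennreal (norm ((P ^^ i) h0 x)) \<le> (Q ^^ i) u x" for i x
  proof (induction i arbitrary: x)
    case (Suc i)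
    have "ennreal (norm ((P ^^ Suc i) h0 x)) \<le> Q (\<lambda>x. ennreal (norm ((P ^^ i) h0 x))) x"
      using norm_P by simp
    also have "\<dots> \<le> Q ((Q ^^ i) u) x" by (rule Q_mono) (rule Suc.IH)
    finally show ?case by simp
  qed (simp add: u_def)
  have Ppow_M: "(P ^^ i) h0 \<in> borel_measurable ?M" for i
  proof (induction i)
    case (Suc i)
    then show ?case using opP_borel_measurable[OF V f_meas gM Suc.IH] by (simp add: P_def)
  qed (simp add: h0M)
  have Ppow_in: "(P ^^ i) h0 \<in> Lpsi1 \<psi> \<Omega>" for i
  proof -
    \<comment> \<open>A single term is bounded by the whole tail that starts with it.\<close>
    have "qnorm (tau_inv \<psi>) ?M (\<lambda>x. ennreal (norm ((P ^^ i) h0 x))) \<le> qnorm (tau_inv \<psi>) ?M (R i u)"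
    proof (rule qnorm_mono)
      fix x
      have "(Q ^^ i) u x \<le> R i u x"
        unfolding R_def using sum_le_suminf[of "\<lambda>k. (Q ^^ (i + k)) u x" "{0}"] by simp
      then show "ennreal (norm ((P ^^ i) h0 x)) \<le> R i u x" using norm_Ppow[of i x] by simp
    qed measurable
    also have "\<dots> \<le> ennreal ((2 * \<alpha>) ^ i / (1 - 2 * \<alpha>)) * qnorm (tau_inv \<psi>) ?M u"
      by (rule qnorm_R_le[OF uM half])
    also have "\<dots> < top" using u_fin by (simp add: ennreal_mult_less_top)
    finally show ?thesis using in_Lpsi1_iff[OF \<Omega>L psi] Ppow_M by blast
  qed
  \<comment> \<open>The scalar majorant is finite almost everywhere, so the default value 0 of
    \<open>\<phi>\<close> concerns a null set only.\<close>
  define good where "good x \<longleftrightarrow> R 0 u x < top" for x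
  define \<phi> where "\<phi> x = (if good x then \<Sum>i. (P ^^ i) h0 x else 0)" for x
  have summ: "summable (\<lambda>i. norm ((P ^^ i) h0 x))" if "good x" for x
  proof (rule summable_suminf_not_top)
    have "(\<Sum>i. ennreal (norm ((P ^^ i) h0 x))) \<le> R 0 u x"
      unfolding R_def using norm_Ppow by (intro suminf_le) auto
    also have "\<dots> < top" using that by (simp add: good_def)
    finally show "(\<Sum>i. ennreal (norm ((P ^^ i) h0 x))) \<noteq> top" by simp
  qed simp
  have \<phi>_sums: "(\<lambda>i. (P ^^ i) h0 x) sums \<phi> x" if "good x" for x
    using summable_sums[OF summable_norm_cancel[OF summ[OF that]]] that by (simp add: \<phi>_def)
  have Qpow_fin: "(Q ^^ i) u x < top" for i x
  proof (induction i arbitrary: x)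
    case (Suc i)
    then show ?case by (simp add: Q_def ennreal_mult_less_top)
  qed (simp add: u_def)
  have tail: "ennreal (norm (\<phi> x - (\<Sum>i<j. (P ^^ i) h0 x))) \<le> R j u x" for j x
  proof (cases "good x")
    case True
    have s: "summable (\<lambda>i. norm ((P ^^ (i + j)) h0 x))"
      using summ[OF True] by (rule summable_ignore_initial_segment)
    have "\<phi> x - (\<Sum>i<j. (P ^^ i) h0 x) = (\<Sum>i. (P ^^ (i + j)) h0 x)"
      using suminf_minus_initial_segment[OF summable_norm_cancel[OF summ[OF True]], of j] True
      by (simp add: \<phi>_def)
    then have "norm (\<phi> x - (\<Sum>i<j. (P ^^ i) h0 x)) \<le> (\<Sum>i. norm ((P ^^ (i + j)) h0 x))"
      using summable_norm[OF s] by simp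
    then have "ennreal (norm (\<phi> x - (\<Sum>i<j. (P ^^ i) h0 x))) \<le> ennreal (\<Sum>i. norm ((P ^^ (i + j)) h0 x))"
      by (rule ennreal_leI)
    also have "\<dots> = (\<Sum>i. ennreal (norm ((P ^^ (i + j)) h0 x)))"
      using s by (intro suminf_ennreal2[symmetric]) auto
    also have "\<dots> \<le> R j u x"
      unfolding R_def using norm_Ppow by (intro suminf_le) (auto simp: add.commute)
    finally show ?thesis .
  next
    case False
    \<comment> \<open>At an exceptional point the partial sums of the majorant are finite, so every
      tail is infinite and the bound holds trivially. The tail estimate is thus valid at every
      point.\<close>
    then have "R 0 u x = top" by (simp add: good_def less_top[symmetric])
    moreover have "(\<Sum>i<j. (Q ^^ i) u x) \<noteq> top" using Qpow_fin by (simp add: less_top)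
    ultimately have "R j u x = top" using R_0_split[of u x j] by (metis ennreal_add_eq_top)
    then show ?thesis by simp
  qed
  have \<phi>M: "\<phi> \<in> borel_measurable ?M"
  proof (rule borel_measurable_LIMSEQ_metric)
    show "(\<lambda>x. if good x then (\<Sum>i<m. (P ^^ i) h0 x) else 0) \<in> borel_measurable ?M" for m
    proof (rule measurable_If)
      show "(\<lambda>x. \<Sum>i<m. (P ^^ i) h0 x) \<in> borel_measurable ?M"
        by (rule borel_measurable_sum_separable[OF V(2) Ppow_M])
      show "{x \<in> space ?M. good x} \<in> sets ?M" unfolding good_def by measurable
    qed simp
    show "(\<lambda>m. if good x then (\<Sum>i<m. (P ^^ i) h0 x) else 0) \<longlonglongrightarrow> \<phi> x" for x
      using \<phi>_sums[of x] by (cases "good x") (auto simp: sums_def \<phi>_def)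
  qed
  have tail_q: "qnorm (tau_inv \<psi>) ?M (\<lambda>x. ennreal (norm (\<phi> x - (\<Sum>i<j. (P ^^ i) h0 x))))
      \<le> ennreal ((2 * \<alpha>) ^ j / (1 - 2 * \<alpha>)) * qnorm (tau_inv \<psi>) ?M u" for j
  proof -
    have "qnorm (tau_inv \<psi>) ?M (\<lambda>x. ennreal (norm (\<phi> x - (\<Sum>i<j. (P ^^ i) h0 x)))) \<le> qnorm (tau_inv \<psi>) ?M (R j u)"
      by (rule qnorm_mono) (use tail in auto)
    also note qnorm_R_le[OF uM half]
    finally show ?thesis .
  qed
  have bound: "Lpsi1_norm \<psi> \<Omega> (\<lambda>x. \<phi> x - (\<Sum>i<j. (P ^^ i) h0 x)) \<le> (2 * \<alpha>) ^ j / (1 - 2 * \<alpha>) * Lpsi1_norm \<psi> \<Omega> h0" for j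
  proof -
    have "enn2real (qnorm (tau_inv \<psi>) ?M (\<lambda>x. ennreal (norm (\<phi> x - (\<Sum>i<j. (P ^^ i) h0 x)))))
        \<le> enn2real (ennreal ((2 * \<alpha>) ^ j / (1 - 2 * \<alpha>)) * qnorm (tau_inv \<psi>) ?M u)"
      using tail_q u_fin by (intro enn2real_mono) (auto simp: ennreal_mult_less_top)
    also have "\<dots> = (2 * \<alpha>) ^ j / (1 - 2 * \<alpha>) * enn2real (qnorm (tau_inv \<psi>) ?M u)"
      using \<alpha> half by (simp add: enn2real_mult)
    finally show ?thesis
      unfolding Lpsi1_norm_def Lpsi1_enorm_eq_qnorm[OF \<Omega>L] u_def[abs_def] .
  qed
  have \<phi>_in: "\<phi> \<in> Lpsi1 \<psi> \<Omega>"
  proof -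
    have "qnorm (tau_inv \<psi>) ?M (\<lambda>x. ennreal (norm (\<phi> x))) \<le> ennreal ((2 * \<alpha>) ^ 0 / (1 - 2 * \<alpha>)) * qnorm (tau_inv \<psi>) ?M u"
      using tail_q[of 0] by simp
    also have "\<dots> < top" using u_fin by (simp add: ennreal_mult_less_top)
    finally show ?thesis using in_Lpsi1_iff[OF \<Omega>L psi] \<phi>M by blast
  qed
  have lim: "(\<lambda>m. Lpsi1_norm \<psi> \<Omega> (\<lambda>x. \<phi> x - (\<Sum>i<m. (P ^^ i) h0 x))) \<longlonglongrightarrow> 0"
  proof (rule tendsto_sandwich[OF _ _ tendsto_const])
    have "(\<lambda>m. (2 * \<alpha>) ^ m / (1 - 2 * \<alpha>) * Lpsi1_norm \<psi> \<Omega> h0) \<longlonglongrightarrow> 0 / (1 - 2 * \<alpha>) * Lpsi1_norm \<psi> \<Omega> h0"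
      using \<alpha> half by (intro tendsto_intros LIMSEQ_power_zero) auto
    then show "(\<lambda>m. (2 * \<alpha>) ^ m / (1 - 2 * \<alpha>) * Lpsi1_norm \<psi> \<Omega> h0) \<longlonglongrightarrow> 0" by simp
  qed (use bound in \<open>auto simp: Lpsi1_norm_def\<close>)
  have solves: "solves_eq smul N \<Omega> f g h0 \<phi>"
    unfolding solves_eq_def
    using R_finite_AE[OF uM u_fin, of 0]
  proof eventually_elim
    case (elim x)
    then have gx: "good x" by (simp add: good_def)
    \<comment> \<open>Finiteness at \<open>x\<close> passes to each \<open>f n x\<close> with
      nonzero weight, because \<open>R 1 u x\<close> is the weighted sum of the values
      \<open>R 0 u (f n x)\<close>. Where \<open>g n x = 0\<close>, the term vanishes whatever
      \<open>\<phi>\<close> is at \<open>f n x\<close>.\<close>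
    have "R 1 u x = (\<Sum>i. \<Sum>n\<in>{1..N}. ?W n x * (Q ^^ i) u (f n x))"
      by (simp add: R_def Q_def plus_1_eq_Suc)
    also have "\<dots> = (\<Sum>n\<in>{1..N}. \<Sum>i. ?W n x * (Q ^^ i) u (f n x))"
      by (rule suminf_sum) auto
    also have "\<dots> = (\<Sum>n\<in>{1..N}. ?W n x * R 0 u (f n x))" by (simp add: R_def)
    finally have R1: "R 1 u x = (\<Sum>n\<in>{1..N}. ?W n x * R 0 u (f n x))" .
    have "R 1 u x < top" using elim R_0_split[of u x 1] by (auto simp: less_top[symmetric])
    then have fin: "?W n x * R 0 u (f n x) < top" if "n \<in> {1..N}" for n
      using R1 that by simp
    have "(\<lambda>i. smul (g n x) ((P ^^ i) h0 (f n x))) sums smul (g n x) (\<phi> (f n x))" if n: "n \<in> {1..N}" for n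
    proof (cases "g n x = 0")
      case True
      then show ?thesis by (simp add: smul_0)
    next
      case False
      then have "good (f n x)" using fin[OF n] by (auto simp: good_def ennreal_mult_less_top)
      then show ?thesis by (intro bounded_linear.sums[OF smul_lin] \<phi>_sums)
    qed
    then have "(\<lambda>i. \<Sum>n\<in>{1..N}. smul (g n x) ((P ^^ i) h0 (f n x))) sums (\<Sum>n\<in>{1..N}. smul (g n x) (\<phi> (f n x)))"
      by (rule sums_sum)
    then have "(\<lambda>i. (P ^^ Suc i) h0 x) sums opP smul N f g \<phi> x"
      by (simp add: P_def opP_def)
    then have "(\<lambda>i. (P ^^ i) h0 x) sums (opP smul N f g \<phi> x + (P ^^ 0) h0 x)"
      by (rule sums_Suc)
    then show "\<phi> x = opP smul N f g \<phi> x + h0 x"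
      using sums_unique2[OF \<phi>_sums[OF gx]] by simp
  qed
  have unique: "AE x in ?M. \<phi>' x = \<phi> x" if \<phi>': "\<phi>' \<in> Lpsi1 \<psi> \<Omega>" "solves_eq smul N \<Omega> f g h0 \<phi>'" for \<phi>'
  proof -
    have M': "\<phi>' \<in> borel_measurable ?M" and fin': "qnorm (tau_inv \<psi>) ?M (\<lambda>x. ennreal (norm (\<phi>' x))) < top"
      and fin: "qnorm (tau_inv \<psi>) ?M (\<lambda>x. ennreal (norm (\<phi> x))) < top"
      using \<phi>'(1) \<phi>_in in_Lpsi1_iff[OF \<Omega>L psi] by blast+
    define v where "v x = ennreal (norm (\<phi>' x - \<phi> x))" for x
    have nM[measurable]: "(\<lambda>x. norm (\<phi>' x)) \<in> borel_measurable ?M" "(\<lambda>x. norm (\<phi> x)) \<in> borel_measurable ?M"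
      using M' \<phi>M by (auto intro: borel_measurable_norm_normed)
    have vM: "v \<in> borel_measurable ?M"
      unfolding v_def
      using borel_measurable_norm_normed[OF borel_measurable_diff_separable[OF V(2) M' \<phi>M]] by simp
    have "AE x in ?M. v x = 0"
    proof (rule Q_subinvariant_AE_zero[OF vM])
      show "AE x in ?M. v x \<le> Q v x"
        using \<phi>'(2) solves unfolding solves_eq_def
      proof eventually_elim
        case (elim x)
        have "\<phi>' x - \<phi> x = opP smul N f g \<phi>' x - opP smul N f g \<phi> x"
          by (subst elim(1), subst elim(2)) simp
        also have "\<dots> = P (\<lambda>x. \<phi>' x - \<phi> x) x"
          by (simp add: P_def opP_def smul_diff sum_subtractf)
        finally have eq: "\<phi>' x - \<phi> x = P (\<lambda>x. \<phi>' x - \<phi> x) x" .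
        show "v x \<le> Q v x"
          using norm_P[of "\<lambda>x. \<phi>' x - \<phi> x" x] unfolding eq[symmetric] v_def[abs_def] .
      qed
      \<comment> \<open>The level is shared equally: the excess of the difference over
        \<open>r\<close> is at most the sum of the excesses of both solutions over
        \<open>r/2\<close>, and these are integrable.\<close>
      fix r :: real assume r: "r > 0"
      have "(\<integral>\<^sup>+x. (v x - ennreal r) \<partial>?M)
          \<le> (\<integral>\<^sup>+x. (ennreal (norm (\<phi>' x)) - ennreal (r/2)) + (ennreal (norm (\<phi> x)) - ennreal (r/2)) \<partial>?M)"
      proof (rule nn_integral_mono)
        fix x
        let ?a = "ennreal (norm (\<phi>' x))" and ?b = "ennreal (norm (\<phi> x))" and ?r = "ennreal (r/2)"
        have "v x \<le> ennreal (norm (\<phi>' x) + norm (\<phi> x))"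
          unfolding v_def by (intro ennreal_leI norm_triangle_ineq4)
        also have "\<dots> = ?a + ?b" by (rule ennreal_plus) auto
        also have "\<dots> \<le> (?r + (?a - ?r)) + (?r + (?b - ?r))"
          by (intro add_mono ennreal_le_add_diff)
        also have "\<dots> = (?r + ?r) + ((?a - ?r) + (?b - ?r))" by (simp only: add_ac)
        also have "?r + ?r = ennreal (r/2 + r/2)" using r by (intro ennreal_plus[symmetric]) auto
        also have "r/2 + r/2 = r" by simp
        finally show "v x - ennreal r \<le> (?a - ?r) + (?b - ?r)" by (simp add: ennreal_minus_le_iff)
      qed
      also have "\<dots> = (\<integral>\<^sup>+x. (ennreal (norm (\<phi>' x)) - ennreal (r/2)) \<partial>?M) + (\<integral>\<^sup>+x. (ennreal (norm (\<phi> x)) - ennreal (r/2)) \<partial>?M)"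
        by (rule nn_integral_add) measurable
      also have "\<dots> < top"
        using tail_integral_finite[OF sigma_finite_lebesgue_on[OF \<Omega>L] _ fin', of "r/2"]
          tail_integral_finite[OF sigma_finite_lebesgue_on[OF \<Omega>L] _ fin, of "r/2"] r by simp
      finally show "(\<integral>\<^sup>+x. (v x - ennreal r) \<partial>?M) < top" .
    qed
    then show ?thesis by eventually_elim (simp add: v_def)
  qed
  show ?thesis
    using Ppow_in \<phi>_in lim solves unique bound unfolding P_def by blast
qed

end
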